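(* Let $\mathbb{O}$ be the octonions, let $i\in\mathrm{Im}\,\mathbb{O}$ be an imaginary octonion with $|i|^2=1$, and let $J_R:\mathbb{O}^2\to\mathbb{O}^2$ be the complex structure $$J_R=\begin{pmatrix} R_i & 0\\ 0 & R_i\end{pmatrix},\qquad J_R(a,b)=(a\,i,\;b\,i),$$ where $R_i$ denotes right multiplication by $i$. Let $\mathrm{Spin}(9)\subset \mathrm{End}_{\mathbb{R}}(\mathbb{O}\oplus\mathbb{O})$ be the group consisting of all products of an even number of operators $X(s,\mathbf{y})$ with $s\in\mathbb{R}$, $\mathbf{y}\in\mathbb{O}$, $s^2+|\mathbf{y}|^2=1$, where $$X(s,\mathbf{y})=\begin{pmatrix} s & L_{\mathbf{y}}\\ L_{\overline{\mathbf{y}}} & -s\end{pmatrix}$$ and $L_{\mathbf{y}}$ denotes left multiplication by $\mathbf{y}$. Then the subgroup $$\{\,g\in\mathrm{Spin}(9)\;:\; g J_R=J_R g\,\}$$ is (isomorphic as a Lie group to) the Standard Model gauge group $$G_{\rm SM}=\mathrm{SU}(3)\times\mathrm{SU}(2)\times\mathrm{U}(1)/\mathbb{Z}_6 .$$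
   Context: $\mathbb{O}$ is the real 8-dimensional normed division algebra of octonions (non-commutative, non-associative, alternative), with conjugation $x\mapsto\overline{x}$, norm $|x|^2=x\overline{x}$ and inner product $\langle x,y\rangle=\mathrm{Re}(x\overline{y})$. $\mathrm{Im}\,\mathbb{O}$ is the 7-dimensional space of octonions with $\overline{x}=-x$. For $\mathbf{x}\in\mathbb{O}$, $L_{\mathbf{x}}$ and $R_{\mathbf{x}}$ are the real-linear operators $a\mapsto \mathbf{x}a$ and $a\mapsto a\mathbf{x}$ on $\mathbb{O}$. The operators $X(r,\mathbf{x})$, $r\in\mathbb{R}$, $\mathbf{x}\in\mathbb{O}$, act real-linearly on 2-component columns with entries in $\mathbb{O}$ and satisfy $X(r,\mathbf{x})^2=(r^2+|\mathbf{x}|^2)\,\mathbb{I}$, so they generate the Clifford algebra $\mathrm{Cl}_9$ of $\mathbb{R}^9=\mathbb{R}\oplus\mathbb{O}$. The resulting group $\mathrm{Spin}(9)$ acts on its 16-dimensional real spinor representation $\mathbb{O}^2=\mathbb{R}^{16}$. Products and commutation of elements of $\mathrm{Spin}(9)$ and $J_R$ refer to composition of real-linear operators on $\mathbb{O}^2$. A complex structure on a real vector space is a real-linear operator $J$ with $J^2=-\mathbb{I}$; $J_R$ is one because $i^2=-1$ and $\mathbb{O}$ is alternative. The group $\mathbb{Z}_6$ in $G_{\rm SM}$ is the central subgroup of $\mathrm{U}(1)\times\mathrm{SU}(3)\times\mathrm{SU}(2)$ generated by the element $(e^{\pi \mathrm{i}/3},\,e^{2\pi \mathrm{i}/3}\,\mathbb{I},\,-\mathbb{I})$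 (here $\mathrm{i}=\sqrt{-1}\in\mathbb{C}$). *)

theory Defs
  imports
    "HOL-Analysis.Analysis"
    "HOL-Algebra.Coset"
    "HOL-Algebra.Generated_Groups"
begin

section \<open>Octonions\<close>

text \<open>
  The octonions are built by two Cayley--Dickson doublings from the complex numbers,
  with doubling formula \<open>(a, b) (c, d) = (a c - d\<^sup>* b, d a + b c\<^sup>*)\<close>.  The product type already
  carries the Euclidean vector space structure in which the eight units are orthonormal,
  so \<open>norm\<close> is the octonion norm (see \<open>omult_ocnj\<close> and \<open>norm_omult\<close> below).
\<close>

type_synonym quat = "complex \<times> complex"
type_synonym octo = "quat \<times> quat"

definition qmult :: "quat \<Rightarrow> quat \<Rightarrow> quat" where
  "qmult x y = (case x of (a, b) \<Rightarrow> case y of (c, d) \<Rightarrow>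
     (a * c - cnj d * b, d * a + b * cnj c))"

definition qcnj :: "quat \<Rightarrow> quat" where
  "qcnj x = (case x of (a, b) \<Rightarrow> (cnj a, - b))"

definition omult :: "octo \<Rightarrow> octo \<Rightarrow> octo" (infixl \<open>*\<^sub>O\<close> 70) where
  "x *\<^sub>O y = (case x of (a, b) \<Rightarrow> case y of (c, d) \<Rightarrow>
     (qmult a c - qmult (qcnj d) b, qmult d a + qmult b (qcnj c)))"

definition ocnj :: "octo \<Rightarrow> octo" where
  "ocnj x = (case x of (a, b) \<Rightarrow> (qcnj a, - b))"

definition oone :: octo where
  "oone = ((1, 0), (0, 0))"

lemmas octo_defs = qmult_def qcnj_def omult_def ocnj_def oone_def

lemma bounded_bilinear_omult: "bounded_bilinear (*\<^sub>O)"
  unfolding bilinear_conv_bounded_bilinear[symmetric] bilinear_def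
  by (auto intro!: linearI simp: octo_defs algebra_simps complex_eq_iff split: prod.splits)

lemma linear_ocnj: "linear ocnj"
  by (auto intro!: linearI simp: octo_defs algebra_simps split: prod.splits)

lemma oone_omult [simp]: "oone *\<^sub>O x = x"
  and omult_oone [simp]: "x *\<^sub>O oone = x"
  by (auto simp: octo_defs zero_prod_def split: prod.splits)

lemma omult_ocnj: "x *\<^sub>O ocnj x = ((norm x)\<^sup>2) *\<^sub>R oone"
  by (auto simp: octo_defs norm_prod_def complex_eq_iff cmod_power2 split: prod.splits)
     (simp_all add: algebra_simps power2_eq_square)

lemma octo_cases:
  obtains a b c d e f g h where "x = ((Complex a b, Complex c d), (Complex e f, Complex g h))"
  by (metis complex.exhaust_sel prod.exhaust_sel)

lemma norm_omult: "norm (x *\<^sub>O y) = norm x * norm y"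
proof -
  have "(norm (x *\<^sub>O y))\<^sup>2 = (norm x)\<^sup>2 * (norm y)\<^sup>2"
    by (cases x rule: octo_cases; cases y rule: octo_cases;
        simp add: octo_defs norm_prod_def cmod_power2;
        simp add: power2_eq_square algebra_simps)
  thus ?thesis
    by (metis norm_ge_zero power2_eq_imp_eq power_mult_distrib mult_nonneg_nonneg)
qed

lemma omult_left_alternative: "(x *\<^sub>O x) *\<^sub>O y = x *\<^sub>O (x *\<^sub>O y)"
  by (cases x rule: octo_cases; cases y rule: octo_cases;
      simp add: octo_defs complex_eq_iff; intro conjI; simp add: algebra_simps)

lemma omult_right_alternative: "(y *\<^sub>O x) *\<^sub>O x = y *\<^sub>O (x *\<^sub>O x)"
  by (cases x rule: octo_cases; cases y rule: octo_cases;
      simp add: octo_defs complex_eq_iff; intro conjI; simp add: algebra_simps)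


section \<open>The group Spin(9) and the complex structure\<close>

type_synonym spinor = "octo \<times> octo"
type_synonym operator = "spinor \<Rightarrow>\<^sub>L spinor"

definition spinX :: "real \<Rightarrow> octo \<Rightarrow> operator" where
  "spinX s y = Blinfun (\<lambda>(a, b). (s *\<^sub>R a + y *\<^sub>O b, ocnj y *\<^sub>O a - s *\<^sub>R b))"

definition J_R :: "octo \<Rightarrow> operator" where
  "J_R i = Blinfun (\<lambda>(a, b). (a *\<^sub>O i, b *\<^sub>O i))"

definition Spin9 :: "operator monoid" where
  "Spin9 = \<lparr>
     carrier = {foldr (\<lambda>(s, y) g. spinX s y o\<^sub>L g) vs id_blinfun | vs.
                  even (length vs) \<and> (\<forall>(s, y) \<in> set vs. s\<^sup>2 + (norm y)\<^sup>2 = 1)},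
     monoid.mult = (o\<^sub>L),
     one = id_blinfun\<rparr>"

definition Spin9_commutant :: "operator \<Rightarrow> operator set" where
  "Spin9_commutant J = {g \<in> carrier Spin9. g o\<^sub>L J = J o\<^sub>L g}"

text \<open>The arguments of \<open>Blinfun\<close> above are linear, so the operators are the intended ones.\<close>

lemma spinX_apply:
  "blinfun_apply (spinX s y) (a, b) = (s *\<^sub>R a + y *\<^sub>O b, ocnj y *\<^sub>O a - s *\<^sub>R b)"
proof -
  interpret omult: bounded_bilinear "(*\<^sub>O)" by (rule bounded_bilinear_omult)
  have "bounded_linear (\<lambda>(a, b). (s *\<^sub>R a + y *\<^sub>O b, ocnj y *\<^sub>O a - s *\<^sub>R b))"
    unfolding linear_conv_bounded_linear[symmetric]
    by (rule linearI; simp add: split_beta omult.add_right omult.scaleR_right algebra_simps)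
  thus ?thesis by (simp add: spinX_def bounded_linear_Blinfun_apply)
qed

lemma J_R_apply: "blinfun_apply (J_R i) (a, b) = (a *\<^sub>O i, b *\<^sub>O i)"
proof -
  interpret omult: bounded_bilinear "(*\<^sub>O)" by (rule bounded_bilinear_omult)
  have "bounded_linear (\<lambda>(a, b). (a *\<^sub>O i, b *\<^sub>O i))"
    unfolding linear_conv_bounded_linear[symmetric]
    by (rule linearI; simp add: split_beta omult.add_left omult.scaleR_left)
  thus ?thesis by (simp add: J_R_def bounded_linear_Blinfun_apply)
qed


lemma omult_ocnj_cancel:
  "x *\<^sub>O (ocnj x *\<^sub>O y) = (norm x)\<^sup>2 *\<^sub>R y"
  "ocnj x *\<^sub>O (x *\<^sub>O y) = (norm x)\<^sup>2 *\<^sub>R y"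
  by (cases x rule: octo_cases; cases y rule: octo_cases;
      simp add: octo_defs norm_prod_def cmod_power2 complex_eq_iff; intro conjI;
      simp add: power2_eq_square algebra_simps)+

lemma spinX_squared: "spinX s y o\<^sub>L spinX s y = (s\<^sup>2 + (norm y)\<^sup>2) *\<^sub>R id_blinfun"
proof -
  interpret omult: bounded_bilinear "(*\<^sub>O)" by (rule bounded_bilinear_omult)
  have "spinX s y (spinX s y v) = (s\<^sup>2 + (norm y)\<^sup>2) *\<^sub>R v" for v
    by (cases v rule: prod.exhaust)
       (simp add: spinX_apply omult.add_right omult.diff_right omult.scaleR_right
         omult_ocnj_cancel scaleR_add_left scaleR_add_right scaleR_diff_right power2_eq_square)
  thus ?thesis by (intro blinfun_eqI) (simp add: blinfun.scaleR_left)
qed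


section \<open>Lie groups as groups with a sheaf of smooth functions\<close>

text \<open>
  \<open>Ck_on k U f\<close> is meant for open \<open>U\<close> and finite-dimensional domains, where a map is of class
  \<open>C\<^sup>k\<^sup>+\<^sup>1\<close> iff it is differentiable and all its directional derivatives are of class \<open>C\<^sup>k\<close>.
\<close>

primrec Ck_on :: "nat \<Rightarrow> 'a::real_normed_vector set \<Rightarrow> ('a \<Rightarrow> 'b::real_normed_vector) \<Rightarrow> bool" where
  "Ck_on 0 U f \<longleftrightarrow> continuous_on U f"
| "Ck_on (Suc k) U f \<longleftrightarrow>
     (\<exists>f'. (\<forall>x\<in>U. (f has_derivative f' x) (at x)) \<and> (\<forall>v. Ck_on k U (\<lambda>x. f' x v)))"

definition smooth_on :: "'a::real_normed_vector set \<Rightarrow> ('a \<Rightarrow> 'b::real_normed_vector) \<Rightarrow> bool" where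
  "smooth_on U f \<longleftrightarrow> (\<forall>k. Ck_on k U f)"

text \<open>
  A smooth manifold is determined by its topology together with, for every open set \<open>U\<close>, the
  set of smooth real-valued functions on \<open>U\<close>; a diffeomorphism is a homeomorphism
  that identifies the smooth functions on both sides.  The records below carry this structure on
  top of a group.  Functions are total in HOL; only the values on \<open>U\<close> matter.
\<close>

record 'a lie_data = "'a monoid" +
  lie_top :: "'a topology"
  lie_smooth :: "'a set \<Rightarrow> ('a \<Rightarrow> real) set"

definition lie_iso :: "'a lie_data \<Rightarrow> 'b lie_data \<Rightarrow> ('a \<Rightarrow> 'b) set" where
  "lie_iso G H = {\<phi> \<in> iso G H.
     homeomorphic_map (lie_top G) (lie_top H) \<phi> \<and>
     (\<forall>V f. openin (lie_top H) V \<longrightarrow>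
        (f \<in> lie_smooth H V \<longleftrightarrow> f \<circ> \<phi> \<in> lie_smooth G {x \<in> carrier G. \<phi> x \<in> V}))}"

definition lie_isomorphic :: "'a lie_data \<Rightarrow> 'b lie_data \<Rightarrow> bool" where
  "lie_isomorphic G H \<longleftrightarrow> lie_iso G H \<noteq> {}"

text \<open>
  A closed group inside a finite-dimensional space is an embedded submanifold: it has the subspace
  topology, and a function on it is smooth iff it extends smoothly to the ambient space
  around every point.
\<close>

definition embedded_lie_group :: "'a::real_normed_vector monoid \<Rightarrow> 'a lie_data" where
  "embedded_lie_group G = \<lparr>
     carrier = carrier G, monoid.mult = monoid.mult G, one = one G,
     lie_top = top_of_set (carrier G),
     lie_smooth = (\<lambda>U. {f. \<forall>x\<in>U. \<exists>W F. open W \<and> x \<in> W \<and> smooth_on W F \<and>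
                                      (\<forall>y \<in> U \<inter> W. F y = f y)})\<rparr>"

definition quotient_top :: "'a topology \<Rightarrow> ('a \<Rightarrow> 'b) \<Rightarrow> 'b topology" where
  "quotient_top X p =
     topology (\<lambda>U. U \<subseteq> p ` topspace X \<and> openin X {x \<in> topspace X. p x \<in> U})"

lemma openin_quotient_top:
  "openin (quotient_top X p) U \<longleftrightarrow>
     U \<subseteq> p ` topspace X \<and> openin X {x \<in> topspace X. p x \<in> U}"
proof -
  have "istopology (\<lambda>U. U \<subseteq> p ` topspace X \<and> openin X {x \<in> topspace X. p x \<in> U})"
    unfolding istopology_def
  proof (intro conjI allI impI; (elim conjE)?)
    fix S T assume "openin X {x \<in> topspace X. p x \<in> S}" "openin X {x \<in> topspace X. p x \<in> T}"
    moreover have "{x \<in> topspace X. p x \<in> S \<inter> T}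
        = {x \<in> topspace X. p x \<in> S} \<inter> {x \<in> topspace X. p x \<in> T}" by auto
    ultimately show "openin X {x \<in> topspace X. p x \<in> S \<inter> T}" by auto
  next
    fix \<K> assume *: "\<forall>K\<in>\<K>. K \<subseteq> p ` topspace X \<and> openin X {x \<in> topspace X. p x \<in> K}"
    have "{x \<in> topspace X. p x \<in> \<Union>\<K>} = (\<Union>K\<in>\<K>. {x \<in> topspace X. p x \<in> K})" by auto
    with * show "openin X {x \<in> topspace X. p x \<in> \<Union>\<K>}" by auto
    from * show "\<Union>\<K> \<subseteq> p ` topspace X" by blast
  qed auto
  thus ?thesis by (simp add: quotient_top_def topology_inverse')
qed

text \<open>
  For a discrete normal subgroup \<open>N\<close>, the manifold structure on the quotient is the one that
  makes the projection a local diffeomorphism: a function is smooth iff its pullback to \<open>G\<close> is.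
\<close>

definition quotient_lie_group :: "'a lie_data \<Rightarrow> 'a set \<Rightarrow> 'a set lie_data" where
  "quotient_lie_group G N = \<lparr>
     carrier = carrier (G Mod N), monoid.mult = monoid.mult (G Mod N), one = one (G Mod N),
     lie_top = quotient_top (lie_top G) (\<lambda>x. N #>\<^bsub>G\<^esub> x),
     lie_smooth = (\<lambda>U. {f. (\<lambda>x. f (N #>\<^bsub>G\<^esub> x)) \<in>
                             lie_smooth G {x \<in> carrier G. N #>\<^bsub>G\<^esub> x \<in> U}})\<rparr>"


section \<open>The Standard Model gauge group\<close>

definition U1 :: "complex monoid" where
  "U1 = \<lparr>carrier = {z. norm z = 1}, monoid.mult = (*), one = 1\<rparr>"

definition cadjoint :: "complex^'n^'n \<Rightarrow> complex^'n^'n" where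
  "cadjoint A = (\<chi> i j. cnj (A $ j $ i))"

definition SU :: "(complex^'n^'n) monoid" where
  "SU = \<lparr>carrier = {A. A ** cadjoint A = mat 1 \<and> det A = 1}, monoid.mult = (**), one = mat 1\<rparr>"

type_synonym sm_ambient = "complex \<times> (complex^3^3) \<times> (complex^2^2)"

text \<open>
  The product manifold \<open>U(1) \<times> SU(3) \<times> SU(2)\<close> is the submanifold of the product of the ambient
  spaces of the factors.
\<close>

definition U1_SU3_SU2 :: "sm_ambient lie_data" where
  "U1_SU3_SU2 = embedded_lie_group (U1 \<times>\<times> SU \<times>\<times> SU)"

definition Z6 :: "sm_ambient set" where
  "Z6 = generate U1_SU3_SU2 {(cis (pi / 3), mat (cis (2 * pi / 3)), mat (- 1))}"

definition G_SM :: "sm_ambient set lie_data" where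
  "G_SM = quotient_lie_group U1_SU3_SU2 Z6"

end

theory Submission
  imports Defs "HOL-Complex_Analysis.Cauchy_Integral_Formula"
begin

text \<open>
  Write octonions as pairs in \<open>\<complex> \<oplus> \<complex>\<^sup>3\<close> so that left multiplication by \<open>i\<close> is complex scalar
  multiplication; then \<open>R\<^sub>i\<close> is \<open>i\<close> on \<open>\<complex>\<close> and \<open>- i\<close> on \<open>\<complex>\<^sup>3\<close>.  On \<open>\<O>\<^sup>2 = (\<complex> \<oplus> \<complex>\<^sup>3) \<otimes> \<complex>\<^sup>2\<close> put
  \<open>\<psi>(z, A, B) = z\<^sup>-\<^sup>3 B \<oplus> z A \<otimes> B\<close>.  This is a homomorphism with kernel \<open>\<int>\<^sub>6\<close>.

  Its image lies in Spin(9): for a unit vector \<open>v \<in> \<complex>\<^sup>3\<close> and a phase \<open>\<alpha>\<close> the product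
  \<open>X(0, v) X(0, \<alpha> v)\<close> is a multiple of a complex reflection on \<open>\<complex>\<^sup>3\<close>, such products generate \<open>U(3)\<close>,
  and the vectors in \<open>\<real> \<oplus> \<complex>\<close> generate \<open>SU(2)\<close>.

  Conversely, let \<open>g\<close> in Spin(9) commute with \<open>J\<^sub>R\<close>.  Conjugation by \<open>g\<close> preserves the vectors
  \<open>\<real> \<oplus> \<complex>\<close> whose Clifford operators commute with \<open>J\<^sub>R\<close>, hence the product of an
  orthonormal basis of them, which is \<open>L\<^sub>i\<close>, up to sign; the sign is \<open>+\<close> because \<open>g\<close> cannot exchange the eigenspaces of \<open>L\<^sub>i R\<^sub>i\<close>, of dimensions 4
  and 12.  So \<open>g\<close> is complex linear and block diagonal.  Dividing by an element of \<open>SU(2)\<close> makes its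
  block on \<open>\<complex>\<^sup>2\<close> a scalar \<open>w\<close>; then \<open>g = (w \<oplus> U) \<otimes> 1\<close>, and compatibility with the octonion product
  on \<open>\<complex>\<^sup>3\<close> forces \<open>w det U = 1\<close>.

  The map \<open>\<psi>\<close> is polynomial and has smooth local sections, obtained from a branch of the sixth root of
  the determinant of the block on \<open>\<complex>\<^sup>2\<close>, so it induces a diffeomorphism of the quotient.  An
  arbitrary imaginary unit is reduced to a fixed one by an octonion automorphism.
\<close>

section \<open>Smooth maps\<close>

lemma Ck_on_subset: "Ck_on k U f \<Longrightarrow> V \<subseteq> U \<Longrightarrow> Ck_on k V f"
proof (induction k arbitrary: f)
  case 0
  then show ?case by (auto intro: continuous_on_subset)
next
  case (Suc k)
  then show ?case by (simp; meson subsetD)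
qed

lemma Ck_on_SucI:
  "(\<And>x. x \<in> U \<Longrightarrow> (f has_derivative f' x) (at x)) \<Longrightarrow> (\<And>v. Ck_on k U (\<lambda>x. f' x v))
    \<Longrightarrow> Ck_on (Suc k) U f"
  by auto

lemma Ck_on_SucE:
  assumes "Ck_on (Suc k) U f"
  obtains f' where "\<And>x. x \<in> U \<Longrightarrow> (f has_derivative f' x) (at x)" "\<And>v. Ck_on k U (\<lambda>x. f' x v)"
  using assms by auto

lemma Ck_on_SucD: "Ck_on (Suc k) U f \<Longrightarrow> Ck_on k U f"
proof (induction k arbitrary: f)
  case 0
  then show ?case
    using has_derivative_continuous by (fastforce intro!: continuous_at_imp_continuous_on)
next
  case (Suc k)
  from Suc.prems obtain f' where
    f': "\<forall>x\<in>U. (f has_derivative f' x) (at x)" "\<forall>v. Ck_on (Suc k) U (\<lambda>x. f' x v)"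
    using Ck_on.simps(2) by blast
  then show ?case using Suc.IH by auto
qed

lemma Ck_on_const: "Ck_on k U (\<lambda>x. c)"
proof (induction k arbitrary: c)
  case (Suc k)
  then show ?case by (auto intro!: exI[of _ "\<lambda>x v. 0"])
qed simp

lemma Ck_on_bounded_linear:
  assumes "bounded_linear f"
  shows "Ck_on k U f"
proof (cases k)
  case 0
  then show ?thesis using assms by (simp add: linear_continuous_on)
next
  case (Suc m)
  then show ?thesis using assms
    by (auto intro!: exI[of _ "\<lambda>x. f"] bounded_linear_imp_has_derivative Ck_on_const)
qed

lemma Ck_on_compose_bounded_linear:
  assumes "bounded_linear h"
  shows "Ck_on k U f \<Longrightarrow> Ck_on k U (\<lambda>x. h (f x))"
proof (induction k arbitrary: f)
  case 0
  then show ?case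
    using assms bounded_linear.continuous_on by auto
next
  case (Suc k)
  then obtain f' where
    f': "\<forall>x\<in>U. (f has_derivative f' x) (at x)" "\<forall>v. Ck_on k U (\<lambda>x. f' x v)"
    using Ck_on.simps(2) by blast
  then show ?case using Suc.IH
    by (auto intro!: exI[of _ "\<lambda>x v. h (f' x v)"] bounded_linear.has_derivative[OF assms])
qed

lemma Ck_on_add: "Ck_on k U f \<Longrightarrow> Ck_on k U g \<Longrightarrow> Ck_on k U (\<lambda>x. f x + g x)"
proof (induction k arbitrary: f g)
  case 0
  then show ?case by (auto intro: continuous_on_add)
next
  case (Suc k)
  from Suc.prems(1) obtain f' where
    f: "\<And>x. x \<in> U \<Longrightarrow> (f has_derivative f' x) (at x)" "\<And>v. Ck_on k U (\<lambda>x. f' x v)"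
    by (rule Ck_on_SucE) blast
  from Suc.prems(2) obtain g' where
    g: "\<And>x. x \<in> U \<Longrightarrow> (g has_derivative g' x) (at x)" "\<And>v. Ck_on k U (\<lambda>x. g' x v)"
    by (rule Ck_on_SucE) blast
  show ?case
    by (rule Ck_on_SucI[where f' = "\<lambda>x v. f' x v + g' x v"])
      (intro has_derivative_add f g Suc.IH; assumption)+
qed

lemma Ck_on_sum:
  assumes "\<And>i. i \<in> I \<Longrightarrow> Ck_on k U (f i)"
  shows "Ck_on k U (\<lambda>x. \<Sum>i\<in>I. f i x)"
  using assms by (induction I rule: infinite_finite_induct) (auto intro: Ck_on_add Ck_on_const)

text \<open>Each summand of the product rule contains one factor undifferentiated, so the induction
  step also uses that \<open>f\<close> and \<open>g\<close> themselves are of the lower class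
  (\<open>Ck_on_SucD\<close>).\<close>

lemma Ck_on_bounded_bilinear:
  assumes "bounded_bilinear h"
  shows "Ck_on k U f \<Longrightarrow> Ck_on k U g \<Longrightarrow> Ck_on k U (\<lambda>x. h (f x) (g x))"
proof (induction k arbitrary: f g)
  case 0
  then show ?case by (auto intro: bounded_bilinear.continuous_on[OF assms])
next
  case (Suc k)
  from Suc.prems(1) obtain f' where
    f: "\<And>x. x \<in> U \<Longrightarrow> (f has_derivative f' x) (at x)" "\<And>v. Ck_on k U (\<lambda>x. f' x v)"
    by (rule Ck_on_SucE) blast
  from Suc.prems(2) obtain g' where
    g: "\<And>x. x \<in> U \<Longrightarrow> (g has_derivative g' x) (at x)" "\<And>v. Ck_on k U (\<lambda>x. g' x v)"
    by (rule Ck_on_SucE) blast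
  show ?case
  proof (rule Ck_on_SucI[where f' = "\<lambda>x v. h (f x) (g' x v) + h (f' x v) (g x)"])
    show "((\<lambda>x. h (f x) (g x)) has_derivative (\<lambda>v. h (f x) (g' x v) + h (f' x v) (g x))) (at x)"
      if "x \<in> U" for x by (intro bounded_bilinear.FDERIV[OF assms] f g that)
    show "Ck_on k U (\<lambda>x. h (f x) (g' x v) + h (f' x v) (g x))" for v
      by (intro Ck_on_add Suc.IH f g Suc.prems[THEN Ck_on_SucD])
  qed
qed

text \<open>The space of operators is not an instance of \<^class>\<open>euclidean_space\<close>; a finite
  resolution of the identity replaces the basis.\<close>

definition finite_frame :: "nat \<Rightarrow> (nat \<Rightarrow> 'a::real_normed_vector \<Rightarrow> real) \<Rightarrow> (nat \<Rightarrow> 'a) \<Rightarrow> bool" where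
  "finite_frame n l e \<longleftrightarrow> (\<forall>m<n. bounded_linear (l m)) \<and> (\<forall>y. (\<Sum>m<n. l m y *\<^sub>R e m) = y)"

text \<open>The chain rule gives \<open>g' (f x) (f' x v)\<close>, where the direction fed to
  \<open>g'\<close> varies with \<open>x\<close>, while \<open>Ck_on\<close> only controls fixed
  directions. Expanding \<open>f' x v\<close> in the frame gives a finite sum of scalar functions
  times derivatives of \<open>g\<close> in the fixed directions \<open>e m\<close>, to which the
  induction hypothesis applies.\<close>

lemma Ck_on_compose:
  fixes g :: "'b::real_normed_vector \<Rightarrow> 'c::real_normed_vector"
    and f :: "'a::real_normed_vector \<Rightarrow> 'b" and e :: "nat \<Rightarrow> 'b"
  assumes fr: "finite_frame n l e"
  shows "Ck_on k W g \<Longrightarrow> Ck_on k U f \<Longrightarrow> f ` U \<subseteq> W \<Longrightarrow> Ck_on k U (\<lambda>x. g (f x))"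
proof (induction k arbitrary: f g)
  case 0
  then show ?case by (auto intro: continuous_on_compose2)
next
  case (Suc k)
  from Suc.prems(2) obtain f' where
    f: "\<And>x. x \<in> U \<Longrightarrow> (f has_derivative f' x) (at x)" "\<And>v. Ck_on k U (\<lambda>x. f' x v)"
    by (rule Ck_on_SucE) blast
  from Suc.prems(1) obtain g' where
    g: "\<And>x. x \<in> W \<Longrightarrow> (g has_derivative g' x) (at x)" "\<And>v. Ck_on k W (\<lambda>x. g' x v)"
    by (rule Ck_on_SucE) blast
  let ?D = "\<lambda>x v. \<Sum>m<n. l m (f' x v) *\<^sub>R g' (f x) (e m)"
  have "((\<lambda>x. g (f x)) has_derivative ?D x) (at x)" if "x \<in> U" for x
  proof -
    have fx: "f x \<in> W" using that Suc.prems by auto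
    then have lin: "linear (g' (f x))"
      using g has_derivative_linear by blast
    have "g' (f x) (f' x v) = ?D x v" for v
    proof -
      have "(\<Sum>m<n. l m (f' x v) *\<^sub>R e m) = f' x v" using fr by (simp add: finite_frame_def)
      then have "g' (f x) (f' x v) = g' (f x) (\<Sum>m<n. l m (f' x v) *\<^sub>R e m)" by simp
      also have "\<dots> = ?D x v"
        by (simp add: linear_sum[OF lin] linear_scale[OF lin])
      finally show ?thesis .
    qed
    moreover have "((\<lambda>x. g (f x)) has_derivative (\<lambda>v. g' (f x) (f' x v))) (at x)"
      using has_derivative_compose f g that fx by blast
    ultimately show ?thesis by simp
  qed
  moreover have "Ck_on k U (\<lambda>x. ?D x v)" for v
  proof (intro Ck_on_sum Ck_on_bounded_bilinear[OF bounded_bilinear_scaleR])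
    fix m assume "m \<in> {..<n}"
    then have "bounded_linear (l m)" using fr by (simp add: finite_frame_def)
    then show "Ck_on k U (\<lambda>x. l m (f' x v))"
      by (rule Ck_on_compose_bounded_linear) (rule f)
    show "Ck_on k U (\<lambda>x. g' (f x) (e m))"
      by (intro Suc.IH g Ck_on_SucD[OF Suc.prems(2)] Suc.prems(3))
  qed
  ultimately show ?case by (rule Ck_on_SucI)
qed

text \<open>The derivative in direction \<open>v\<close> is \<open>deriv f x * v\<close>, and
  \<open>deriv f\<close> is again holomorphic. This supplies smooth branches of the sixth
  root.\<close>

lemma Ck_on_holomorphic:
  assumes "open U"
  shows "f holomorphic_on U \<Longrightarrow> Ck_on k U f"
proof (induction k arbitrary: f)
  case 0
  then show ?case by (simp add: holomorphic_on_imp_continuous_on)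
next
  case (Suc k)
  have "Ck_on k U (\<lambda>x. deriv f x * v)" for v
    by (rule Ck_on_compose_bounded_linear[OF bounded_linear_mult_left])
      (intro Suc.IH holomorphic_deriv Suc.prems assms)
  moreover have "(f has_derivative (*) (deriv f x)) (at x)" if "x \<in> U" for x
    using Suc.prems assms that
    by (metis has_field_derivative_def holomorphic_derivI)
  ultimately show ?case unfolding Ck_on.simps by (intro exI[of _ "\<lambda>x v. deriv f x * v"]) auto
qed

section \<open>Calculus of smooth maps\<close>

lemma smooth_on_subset: "smooth_on U f \<Longrightarrow> V \<subseteq> U \<Longrightarrow> smooth_on V f"
  by (auto simp: smooth_on_def intro: Ck_on_subset)

lemma smooth_on_const: "smooth_on U (\<lambda>x. c)"
  by (auto simp: smooth_on_def intro: Ck_on_const)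

lemma smooth_on_bounded_linear: "bounded_linear f \<Longrightarrow> smooth_on U f"
  by (auto simp: smooth_on_def intro: Ck_on_bounded_linear)

lemma smooth_on_compose_bounded_linear:
  "bounded_linear h \<Longrightarrow> smooth_on U f \<Longrightarrow> smooth_on U (\<lambda>x. h (f x))"
  by (auto simp: smooth_on_def intro: Ck_on_compose_bounded_linear)

lemma smooth_on_add: "smooth_on U f \<Longrightarrow> smooth_on U g \<Longrightarrow> smooth_on U (\<lambda>x. f x + g x)"
  by (auto simp: smooth_on_def intro: Ck_on_add)

lemma smooth_on_sum:
  "(\<And>i. i \<in> I \<Longrightarrow> smooth_on U (f i)) \<Longrightarrow> smooth_on U (\<lambda>x. \<Sum>i\<in>I. f i x)"
  by (auto simp: smooth_on_def intro: Ck_on_sum)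

lemma smooth_on_bounded_bilinear:
  "bounded_bilinear h \<Longrightarrow> smooth_on U f \<Longrightarrow> smooth_on U g \<Longrightarrow> smooth_on U (\<lambda>x. h (f x) (g x))"
  by (auto simp: smooth_on_def intro: Ck_on_bounded_bilinear)

lemma smooth_on_compose:
  fixes g :: "'b::real_normed_vector \<Rightarrow> 'c::real_normed_vector"
    and f :: "'a::real_normed_vector \<Rightarrow> 'b" and e :: "nat \<Rightarrow> 'b"
  shows "finite_frame n l e \<Longrightarrow> smooth_on W g \<Longrightarrow> smooth_on U f \<Longrightarrow> f ` U \<subseteq> W
    \<Longrightarrow> smooth_on U (\<lambda>x. g (f x))"
  by (auto simp: smooth_on_def intro: Ck_on_compose)

lemma smooth_on_holomorphic: "open U \<Longrightarrow> f holomorphic_on U \<Longrightarrow> smooth_on U f"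
  by (auto simp: smooth_on_def intro: Ck_on_holomorphic)

lemma smooth_on_imp_continuous_on: "smooth_on U f \<Longrightarrow> continuous_on U f"
  by (metis Ck_on.simps(1) smooth_on_def)

lemma smooth_on_Pair:
  assumes "smooth_on U f" "smooth_on U g"
  shows "smooth_on U (\<lambda>x. (f x, g x))"
proof -
  have "bounded_linear (\<lambda>x. (x, 0))" "bounded_linear (\<lambda>x. (0, x))"
    by (auto intro: bounded_linear_Pair bounded_linear_ident bounded_linear_zero)
  then have "smooth_on U (\<lambda>x. (f x, 0) + (0, g x))"
    using assms by (intro smooth_on_add) (auto intro: smooth_on_compose_bounded_linear)
  then show ?thesis by simp
qed

lemma smooth_on_vec:
  fixes f :: "'i::finite \<Rightarrow> 'a::real_normed_vector \<Rightarrow> 'b::euclidean_space"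
  assumes "\<And>i. smooth_on U (f i)"
  shows "smooth_on U (\<lambda>x. \<chi> i. f i x)"
proof -
  have "bounded_linear (axis i :: 'b \<Rightarrow> 'b^'i)" for i
    by (rule linear_conv_bounded_linear[THEN iffD1]) (auto intro!: linearI simp: axis_def vec_eq_iff)
  then have "smooth_on U (\<lambda>x. \<Sum>i\<in>UNIV. axis i (f i x))"
    using assms by (intro smooth_on_sum) (auto intro: smooth_on_compose_bounded_linear)
  moreover have "(\<Sum>i\<in>UNIV. axis i (f i x)) = (\<chi> i. f i x)" for x
    by (simp add: vec_eq_iff axis_def if_distrib if_distribR cong: if_cong)
  ultimately show ?thesis by simp
qed

lemma smooth_on_vec_nth:
  fixes f :: "'a::real_normed_vector \<Rightarrow> 'b::real_normed_vector^'i"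
  shows "smooth_on U f \<Longrightarrow> smooth_on U (\<lambda>x. f x $ i)"
  by (rule smooth_on_compose_bounded_linear[OF bounded_linear_vec_nth])

lemma smooth_on_mult:
  fixes f :: "'a::real_normed_vector \<Rightarrow> 'b::real_normed_algebra"
  shows "smooth_on U f \<Longrightarrow> smooth_on U g \<Longrightarrow> smooth_on U (\<lambda>x. f x * g x)"
  by (rule smooth_on_bounded_bilinear[OF bounded_bilinear_mult])

lemma smooth_on_cnj: "smooth_on U f \<Longrightarrow> smooth_on U (\<lambda>x. cnj (f x))"
  by (rule smooth_on_compose_bounded_linear[OF bounded_linear_cnj])

lemma smooth_on_power:
  fixes f :: "'a::real_normed_vector \<Rightarrow> 'b::real_normed_algebra_1"
  shows "smooth_on U f \<Longrightarrow> smooth_on U (\<lambda>x. f x ^ n)"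
  by (induction n) (auto intro: smooth_on_mult smooth_on_const)

section \<open>Finite frames of Euclidean and operator spaces\<close>

lemma finite_frame_euclidean:
  obtains n l and e :: "nat \<Rightarrow> 'a::euclidean_space" where "finite_frame n l e"
proof -
  obtain e :: "nat \<Rightarrow> 'a" where e: "bij_betw e {..<DIM('a)} Basis"
    by (metis finite_Basis finite_same_card_bij finite_lessThan card_lessThan)
  have "(\<Sum>m<DIM('a). (y \<bullet> e m) *\<^sub>R e m) = y" for y
    using sum.reindex_bij_betw[OF e, of "\<lambda>b. (y \<bullet> b) *\<^sub>R b"] euclidean_representation[of y] by simp
  then have "finite_frame DIM('a) (\<lambda>m y. y \<bullet> e m) e"
    by (simp add: finite_frame_def bounded_linear_inner_left)
  then show thesis by (rule that)
qed

lemma finite_frame_blinfun: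
  obtains n l and e :: "nat \<Rightarrow> 'a::euclidean_space \<Rightarrow>\<^sub>L 'b::euclidean_space" where "finite_frame n l e"
proof -
  let ?B = "(Basis :: 'a set) \<times> (Basis :: 'b set)"
  let ?N = "card ?B"
  obtain e where e: "bij_betw e {..<?N} ?B"
    by (metis finite_Basis finite_cartesian_product finite_same_card_bij finite_lessThan card_lessThan)
  \<comment> \<open>The rank-one operators sending x to (a \<bullet> x) b, that is, the matrix units
    of the two bases.\<close>
  let ?E = "\<lambda>(a::'a, b::'b). blinfun_scaleR_left b o\<^sub>L blinfun_inner_right a"
  have rep: "(\<Sum>p\<in>?B. (blinfun_apply T (fst p) \<bullet> snd p) *\<^sub>R ?E p) = T" for T :: "'a \<Rightarrow>\<^sub>L 'b"
  proof (rule blinfun_eqI)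
    fix x
    have "blinfun_apply (\<Sum>p\<in>?B. (blinfun_apply T (fst p) \<bullet> snd p) *\<^sub>R ?E p) x
      = (\<Sum>a\<in>Basis. \<Sum>b\<in>Basis. (blinfun_apply T a \<bullet> b) *\<^sub>R ((a \<bullet> x) *\<^sub>R b))"
      by (simp add: sum.cartesian_product split_def blinfun.sum_left blinfun.scaleR_left)
    also have "\<dots> = (\<Sum>a\<in>Basis. (x \<bullet> a) *\<^sub>R (\<Sum>b\<in>Basis. (blinfun_apply T a \<bullet> b) *\<^sub>R b))"
      by (simp add: scaleR_sum_right inner_commute mult.commute)
    also have "\<dots> = (\<Sum>a\<in>Basis. (x \<bullet> a) *\<^sub>R blinfun_apply T a)"
      by (simp only: euclidean_representation)
    also have "\<dots> = blinfun_apply T (\<Sum>a\<in>Basis. (x \<bullet> a) *\<^sub>R a)"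
      by (simp only: blinfun.sum_right blinfun.scaleR_right)
    finally show "blinfun_apply (\<Sum>p\<in>?B. (blinfun_apply T (fst p) \<bullet> snd p) *\<^sub>R ?E p) x = blinfun_apply T x"
      by (simp add: euclidean_representation)
  qed
  let ?l = "\<lambda>m T. blinfun_apply T (fst (e m)) \<bullet> snd (e m)"
  have "bounded_linear (?l m)" for m
    by (intro bounded_linear_compose[OF bounded_linear_inner_left]
        bounded_bilinear.bounded_linear_left[OF bounded_bilinear_blinfun_apply])
  moreover have "(\<Sum>m<?N. ?l m T *\<^sub>R ?E (e m)) = T" for T
    using sum.reindex_bij_betw[OF e, of "\<lambda>p. (blinfun_apply T (fst p) \<bullet> snd p) *\<^sub>R ?E p"] rep[of T] by simp
  ultimately have "finite_frame ?N ?l (\<lambda>m. ?E (e m))"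
    unfolding finite_frame_def by blast
  then show thesis by (rule that)
qed


section \<open>Quotients by a discrete kernel\<close>

text \<open>Algebraically this is the first isomorphism theorem. For topology and smooth functions,
  \<open>\<psi>\<close> carries data from \<open>G\<close> to \<open>K\<close> by pullback, and the
  smooth local sections carry it back.\<close>

lemma lie_isomorphic_quotient:
  fixes K :: "'a::euclidean_space monoid" and G :: "('b::real_normed_vector) monoid"
  assumes K: "group K" and G: "group G"
    and hom: "\<psi> \<in> hom K G" and surj: "\<psi> ` carrier K = carrier G"
    and ker: "kernel K G \<psi> = N"
    and smooth: "smooth_on UNIV \<psi>"
    and frK: "finite_frame nK lK (eK :: nat \<Rightarrow> 'a)" and frG: "finite_frame nG lG (eG :: nat \<Rightarrow> 'b)"
    and sect: "\<And>g. g \<in> carrier G \<Longrightarrow> \<exists>W \<sigma>. open W \<and> g \<in> W \<and> smooth_on W \<sigma> \<and>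
        (\<forall>y \<in> carrier G \<inter> W. \<sigma> y \<in> carrier K \<and> \<psi> (\<sigma> y) = y)"
  shows "lie_isomorphic (embedded_lie_group G) (quotient_lie_group (embedded_lie_group K) N)"
proof -
  let ?K = "embedded_lie_group K" and ?G = "embedded_lie_group G"
  let ?Q = "quotient_lie_group ?K N"
  interpret gh: group_hom K G \<psi> using K G hom by (simp add: group_hom_def group_hom_axioms_def)
  have Nn: "N \<lhd> K" using gh.normal_kernel ker by simp
  have coset: "N #>\<^bsub>?K\<^esub> x = N #>\<^bsub>K\<^esub> x" for x
    by (simp add: r_coset_def embedded_lie_group_def)
  have cK: "carrier ?K = carrier K" "carrier ?G = carrier G" by (simp_all add: embedded_lie_group_def)
  have coset_eq: "N #>\<^bsub>K\<^esub> x = {k \<in> carrier K. \<psi> k = \<psi> x}" if x: "x \<in> carrier K" for x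
  proof (intro Set.set_eqI iffI)
    fix k assume "k \<in> N #>\<^bsub>K\<^esub> x"
    then show "k \<in> {k \<in> carrier K. \<psi> k = \<psi> x}"
      using x by (auto simp: r_coset_def ker[symmetric] kernel_def)
  next
    fix k assume k: "k \<in> {k \<in> carrier K. \<psi> k = \<psi> x}"
    then have "k \<otimes>\<^bsub>K\<^esub> inv\<^bsub>K\<^esub> x \<in> N"
      using x by (auto simp: ker[symmetric] kernel_def)
    moreover have "k = (k \<otimes>\<^bsub>K\<^esub> inv\<^bsub>K\<^esub> x) \<otimes>\<^bsub>K\<^esub> x"
      using x k by (simp add: gh.G.m_assoc)
    ultimately show "k \<in> N #>\<^bsub>K\<^esub> x" by (auto simp: r_coset_def)
  qed
  \<comment> \<open>The inverse of the induced map on the quotient: the fibre over \<open>g\<close>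
    is a coset of the kernel, so no representative has to be chosen.\<close>
  define \<phi> where "\<phi> = (\<lambda>g. {k \<in> carrier K. \<psi> k = g})"
  have phi_psi: "\<phi> (\<psi> x) = N #>\<^bsub>K\<^esub> x" if "x \<in> carrier K" for x
    using coset_eq that by (simp add: \<phi>_def)
  have psi_mem: "\<psi> x \<in> carrier G" if "x \<in> carrier K" for x using that by simp
  have surjE: "\<exists>x. x \<in> carrier K \<and> \<psi> x = g" if "g \<in> carrier G" for g
    using that unfolding surj[symmetric] by blast
  have cQ: "carrier ?Q = (\<lambda>x. N #>\<^bsub>K\<^esub> x) ` carrier K"
    by (auto simp: quotient_lie_group_def FactGroup_def RCOSETS_def coset cK)
  have img: "\<phi> ` carrier G = carrier ?Q"
    unfolding cQ surj[symmetric] image_image using phi_psi by (intro image_cong) auto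
  have inj: "inj_on \<phi> (carrier G)"
  proof (rule inj_onI)
    fix g h assume g: "g \<in> carrier G" and "h \<in> carrier G" and eq: "\<phi> g = \<phi> h"
    from g obtain x where "x \<in> carrier K" "\<psi> x = g" using surjE by blast
    then have "x \<in> \<phi> g" by (simp add: \<phi>_def)
    then have "x \<in> \<phi> h" using eq by simp
    with \<open>\<psi> x = g\<close> show "g = h" by (simp add: \<phi>_def)
  qed
  have "\<phi> \<in> hom ?G ?Q"
  proof (rule homI)
    fix g assume "g \<in> carrier ?G"
    then show "\<phi> g \<in> carrier ?Q" using img cK by auto
  next
    fix g h assume "g \<in> carrier ?G" "h \<in> carrier ?G"
    then obtain x y where x: "x \<in> carrier K" "\<psi> x = g" and y: "y \<in> carrier K" "\<psi> y = h"
      using surjE cK by metis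
    have "\<phi> (g \<otimes>\<^bsub>G\<^esub> h) = N #>\<^bsub>K\<^esub> (x \<otimes>\<^bsub>K\<^esub> y)"
      using x y phi_psi[of "x \<otimes>\<^bsub>K\<^esub> y"] by simp
    also have "\<dots> = (N #>\<^bsub>K\<^esub> x) <#>\<^bsub>K\<^esub> (N #>\<^bsub>K\<^esub> y)"
      using normal.rcos_sum[OF Nn] x y by simp
    also have "\<dots> = \<phi> g <#>\<^bsub>K\<^esub> \<phi> h" using x y phi_psi by auto
    finally show "\<phi> (g \<otimes>\<^bsub>?G\<^esub> h) = \<phi> g \<otimes>\<^bsub>?Q\<^esub> \<phi> h"
      by (simp add: embedded_lie_group_def quotient_lie_group_def FactGroup_def set_mult_def)
  qed
  then have iso: "\<phi> \<in> iso ?G ?Q"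
    using img inj by (simp add: iso_def bij_betw_def cK)
  have pre: "{x \<in> carrier K. N #>\<^bsub>K\<^esub> x \<in> V} = {x \<in> carrier K. \<phi> (\<psi> x) \<in> V}" for V
    using phi_psi by auto
  have topK: "lie_top ?K = top_of_set (carrier K)" "lie_top ?G = top_of_set (carrier G)"
    by (simp_all add: embedded_lie_group_def)
  have topQ: "lie_top ?Q = quotient_top (top_of_set (carrier K)) (\<lambda>x. N #>\<^bsub>K\<^esub> x)"
    by (simp add: quotient_lie_group_def topK coset)
  have cont: "continuous_on UNIV \<psi>" by (rule smooth_on_imp_continuous_on[OF smooth])
  have openQ: "openin (lie_top ?Q) V \<longleftrightarrow>
      V \<subseteq> carrier ?Q \<and> openin (top_of_set (carrier K)) {x \<in> carrier K. \<phi> (\<psi> x) \<in> V}" for V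
    unfolding topQ openin_quotient_top by (simp add: pre cQ)
  have open_iff: "openin (top_of_set (carrier K)) {x \<in> carrier K. \<psi> x \<in> U}
      \<longleftrightarrow> openin (top_of_set (carrier G)) U" if U: "U \<subseteq> carrier G" for U
  proof
    assume op: "openin (top_of_set (carrier K)) {x \<in> carrier K. \<psi> x \<in> U}"
    then obtain T where T: "open T" "{x \<in> carrier K. \<psi> x \<in> U} = carrier K \<inter> T"
      by (auto simp: openin_open)
    have Tiff: "x \<in> T \<longleftrightarrow> \<psi> x \<in> U" if "x \<in> carrier K" for x using T(2) that by blast
    show "openin (top_of_set (carrier G)) U"
    proof (subst openin_subopen, intro ballI)
      fix g assume "g \<in> U"
      with U obtain W \<sigma> where W: "open W" "g \<in> W" "smooth_on W \<sigma>"
        "\<forall>y \<in> carrier G \<inter> W. \<sigma> y \<in> carrier K \<and> \<psi> (\<sigma> y) = y" using sect by (meson subsetD)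
      \<comment> \<open>Inside \<open>W\<close> and \<open>G\<close>, a point y lies in
        \<open>U\<close> exactly if its lift \<open>\<sigma> y\<close> lies in the ambient open set
        \<open>T\<close>, so the preimage of \<open>T\<close> under the section is a neighbourhood
        that stays in \<open>U\<close>.\<close>
      have "open (W \<inter> \<sigma> -` T)"
        by (intro continuous_open_preimage smooth_on_imp_continuous_on W T)
      moreover have \<sigma>: "\<sigma> y \<in> T \<longleftrightarrow> y \<in> U" if "y \<in> carrier G" "y \<in> W" for y
        using Tiff[of "\<sigma> y"] W(4) that by simp
      then have "carrier G \<inter> (W \<inter> \<sigma> -` T) \<subseteq> U" by blast
      moreover have "g \<in> carrier G \<inter> (W \<inter> \<sigma> -` T)"
        using \<sigma>[of g] W(2) U \<open>g \<in> U\<close> by blast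
      ultimately show "\<exists>T. openin (top_of_set (carrier G)) T \<and> g \<in> T \<and> T \<subseteq> U"
        by (intro exI[of _ "carrier G \<inter> (W \<inter> \<sigma> -` T)"] conjI openin_open_Int)
    qed
  next
    assume "openin (top_of_set (carrier G)) U"
    then obtain T where T: "open T" "U = carrier G \<inter> T" by (auto simp: openin_open)
    have "{x \<in> carrier K. \<psi> x \<in> U} = carrier K \<inter> \<psi> -` T" using T psi_mem by auto
    moreover have "open (\<psi> -` T)" using cont T(1) by (simp add: open_vimage)
    ultimately show "openin (top_of_set (carrier K)) {x \<in> carrier K. \<psi> x \<in> U}"
      by (metis openin_open_Int)
  qed
  have openQG: "openin (lie_top ?Q) (\<phi> ` U) \<longleftrightarrow> openin (lie_top ?G) U"
    if U: "U \<subseteq> carrier G" for U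
  proof -
    have "{x \<in> carrier K. \<phi> (\<psi> x) \<in> \<phi> ` U} = {x \<in> carrier K. \<psi> x \<in> U}"
      using inj_on_image_mem_iff[OF inj _ U] psi_mem by blast
    moreover have "\<phi> ` U \<subseteq> carrier ?Q" using img U by blast
    ultimately show ?thesis using open_iff[OF U] by (simp add: openQ topK)
  qed
  have topspQ: "topspace (lie_top ?Q) = carrier ?Q"
  proof
    show "topspace (lie_top ?Q) \<subseteq> carrier ?Q" using openQ[of "topspace (lie_top ?Q)"] by simp
    have "openin (lie_top ?Q) (carrier ?Q)"
      using openQG[of "carrier G"] img by (simp add: topK)
    then show "carrier ?Q \<subseteq> topspace (lie_top ?Q)" by (rule openin_subset)
  qed
  have homeo: "homeomorphic_map (lie_top ?G) (lie_top ?Q) \<phi>"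
  proof (rule bijective_open_imp_homeomorphic_map)
    show "open_map (lie_top ?G) (lie_top ?Q) \<phi>"
      unfolding open_map_def
    proof (intro allI impI)
      fix U assume U: "openin (lie_top ?G) U"
      then have "U \<subseteq> carrier G" using openin_subset topK by fastforce
      with U show "openin (lie_top ?Q) (\<phi> ` U)" by (simp add: openQG)
    qed
    show "continuous_map (lie_top ?G) (lie_top ?Q) \<phi>"
      unfolding continuous_map_def topspQ
    proof (intro conjI allI impI)
      show "\<phi> \<in> topspace (lie_top ?G) \<rightarrow> carrier ?Q" using img by (auto simp: topK)
      fix V assume V: "openin (lie_top ?Q) V"
      let ?U = "{x \<in> topspace (lie_top ?G). \<phi> x \<in> V}"
      have "V \<subseteq> \<phi> ` carrier G" using V openQ img by blast
      then have "\<phi> ` {x \<in> carrier G. \<phi> x \<in> V} = V" by blast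
      then have "\<phi> ` ?U = V" by (simp add: topK)
      then show "openin (lie_top ?G) ?U" using V openQG[of ?U] by (auto simp: topK)
    qed
    show "\<phi> ` topspace (lie_top ?G) = topspace (lie_top ?Q)" using img topspQ by (simp add: topK)
    show "inj_on \<phi> (topspace (lie_top ?G))" using inj by (simp add: topK)
  qed
  have smooth_iff: "f \<in> lie_smooth ?Q V \<longleftrightarrow> f \<circ> \<phi> \<in> lie_smooth ?G {x \<in> carrier ?G. \<phi> x \<in> V}"
    if V: "openin (lie_top ?Q) V" for V f
  proof -
    define h where "h = f \<circ> \<phi>"
    define U where "U = {g \<in> carrier G. \<phi> g \<in> V}"
    define U' where "U' = {x \<in> carrier K. \<psi> x \<in> U}"
    have U'eq: "U' = {x \<in> carrier K. N #>\<^bsub>K\<^esub> x \<in> V}"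
      using pre psi_mem by (auto simp: U'_def U_def)
    let ?S = "\<lambda>U f. \<forall>x\<in>U. \<exists>W F. open W \<and> x \<in> W \<and> smooth_on W F \<and> (\<forall>y \<in> U \<inter> W. F y = f y)"
    have "f \<in> lie_smooth ?Q V \<longleftrightarrow> ?S U' (\<lambda>x. f (N #>\<^bsub>K\<^esub> x))"
      unfolding U'eq by (simp add: quotient_lie_group_def embedded_lie_group_def r_coset_def)
    also have "\<dots> \<longleftrightarrow> ?S U' (\<lambda>x. h (\<psi> x))"
      using phi_psi by (auto simp: U'_def h_def)
    \<comment> \<open>A local extension on the side of \<open>K\<close> is composed with a section,
      one on the side of \<open>G\<close> with \<open>\<psi>\<close>.\<close>
    also have "\<dots> \<longleftrightarrow> ?S U h"
    proof
      assume L: "?S U' (\<lambda>x. h (\<psi> x))"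
      show "?S U h"
      proof
        fix g assume g: "g \<in> U"
        then obtain W \<sigma> where W: "open W" "g \<in> W" "smooth_on W \<sigma>" and
          \<sigma>: "\<forall>y \<in> carrier G \<inter> W. \<sigma> y \<in> carrier K \<and> \<psi> (\<sigma> y) = y" using sect
          unfolding U_def by blast
        have U\<sigma>: "\<sigma> y \<in> U'" if "y \<in> U" "y \<in> W" for y
          using that \<sigma> by (auto simp: U_def U'_def)
        with g W obtain T F where T: "open T" "\<sigma> g \<in> T" "smooth_on T F" and
          F: "\<forall>y \<in> U' \<inter> T. F y = h (\<psi> y)" using L by meson
        let ?W = "W \<inter> \<sigma> -` T"
        have "open ?W"
          by (intro continuous_open_preimage smooth_on_imp_continuous_on W T)
        moreover have "g \<in> ?W" using W T by simp
        moreover have "smooth_on ?W (\<lambda>y. F (\<sigma> y))"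
          by (rule smooth_on_compose[OF frK T(3)]) (auto intro: smooth_on_subset[OF W(3)])
        moreover have "\<forall>y \<in> U \<inter> ?W. F (\<sigma> y) = h y"
          using F U\<sigma> \<sigma> by (auto simp: U_def)
        ultimately show "\<exists>W F. open W \<and> g \<in> W \<and> smooth_on W F \<and> (\<forall>y \<in> U \<inter> W. F y = h y)"
          by (intro exI[of _ ?W] exI[of _ "\<lambda>y. F (\<sigma> y)"] conjI)
      qed
    next
      assume R: "?S U h"
      show "?S U' (\<lambda>x. h (\<psi> x))"
      proof
        fix x assume "x \<in> U'"
        then obtain T F where T: "open T" "\<psi> x \<in> T" "smooth_on T F" and
          F: "\<forall>y \<in> U \<inter> T. F y = h y" using R unfolding U'_def by blast
        have "open (\<psi> -` T)" using cont T(1) by (simp add: open_vimage)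
        moreover have "smooth_on (\<psi> -` T) (\<lambda>y. F (\<psi> y))"
          by (rule smooth_on_compose[OF frG T(3)]) (auto intro: smooth_on_subset[OF smooth])
        moreover have "\<forall>y \<in> U' \<inter> \<psi> -` T. F (\<psi> y) = h (\<psi> y)"
          using F by (auto simp: U'_def)
        ultimately show "\<exists>W F. open W \<and> x \<in> W \<and> smooth_on W F \<and> (\<forall>y \<in> U' \<inter> W. F y = h (\<psi> y))"
          using T(2) by (intro exI[of _ "\<psi> -` T"] exI[of _ "\<lambda>y. F (\<psi> y)"]) simp
      qed
    qed
    also have "\<dots> \<longleftrightarrow> f \<circ> \<phi> \<in> lie_smooth ?G {x \<in> carrier ?G. \<phi> x \<in> V}"
      by (simp add: embedded_lie_group_def U_def h_def)
    finally show ?thesis .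
  qed
  have "\<phi> \<in> lie_iso ?G ?Q"
    unfolding lie_iso_def using iso homeo smooth_iff by blast
  then show ?thesis unfolding lie_isomorphic_def by blast
qed


section \<open>The group Spin(9)\<close>

interpretation omult: bounded_bilinear "(*\<^sub>O)" by (rule bounded_bilinear_omult)

lemma blinfun_compose_assoc: "(f o\<^sub>L g) o\<^sub>L h = f o\<^sub>L (g o\<^sub>L h)"
  and id_blinfun_compose [simp]: "id_blinfun o\<^sub>L f = f" "f o\<^sub>L id_blinfun = f"
  by (auto intro!: blinfun_eqI)

lemma spinor_op_eqI:
  fixes f g :: operator
  assumes "\<And>x y. blinfun_apply f (x, y) = blinfun_apply g (x, y)"
  shows "f = g"
  by (rule blinfun_eqI) (metis assms surj_pair)

text \<open>Left multiplication by the conjugate is the adjoint of left multiplication; this makes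
  the Clifford operators symmetric.\<close>

lemma inner_omult: "a \<bullet> (y *\<^sub>O b) = (ocnj y *\<^sub>O a) \<bullet> b"
  by (cases a rule: octo_cases; cases b rule: octo_cases; cases y rule: octo_cases;
      simp add: octo_defs inner_complex_def; simp add: algebra_simps)

lemma norm_ocnj: "norm (ocnj y) = norm y"
  by (simp add: octo_defs norm_prod_def split: prod.splits)

lemma spinX_add: "spinX (s + t) (y + z) = spinX s y + spinX t z"
  by (rule spinor_op_eqI)
    (simp add: spinX_apply blinfun.add_left omult.add_left linear_add[OF linear_ocnj] algebra_simps)

lemma spinX_scaleR: "spinX (r * s) (r *\<^sub>R y) = r *\<^sub>R spinX s y"
  by (rule spinor_op_eqI)
    (simp add: spinX_apply blinfun.scaleR_left omult.scaleR_left linear_cmul[OF linear_ocnj] algebra_simps)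

lemma spinX_diff: "spinX (s - t) (y - z) = spinX s y - spinX t z"
  using spinX_add[of s "- t" y "- z"] spinX_scaleR[of "-1" t z] by simp

interpretation comp: bounded_bilinear "(o\<^sub>L) :: operator \<Rightarrow> operator \<Rightarrow> operator"
  by (rule bounded_bilinear_blinfun_compose)

text \<open>Polarization of \<open>spinX_squared\<close>.\<close>

lemma spinX_anticommute:
  "(spinX s y o\<^sub>L spinX t z) + (spinX t z o\<^sub>L spinX s y) = (2 * (s * t + y \<bullet> z)) *\<^sub>R id_blinfun"
proof -
  have "(spinX s y + spinX t z) o\<^sub>L (spinX s y + spinX t z) =
      ((s + t)\<^sup>2 + (norm (y + z))\<^sup>2) *\<^sub>R id_blinfun"
    by (simp only: spinX_add[symmetric] spinX_squared)
  then have "(spinX s y o\<^sub>L spinX t z) + (spinX t z o\<^sub>L spinX s y)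
    = ((s + t)\<^sup>2 + (norm (y + z))\<^sup>2) *\<^sub>R id_blinfun - (s\<^sup>2 + (norm y)\<^sup>2) *\<^sub>R id_blinfun
      - (t\<^sup>2 + (norm z)\<^sup>2) *\<^sub>R id_blinfun"
    by (simp add: comp.add_left comp.add_right spinX_squared algebra_simps)
  also have "\<dots> = ((s + t)\<^sup>2 + (norm (y + z))\<^sup>2 - (s\<^sup>2 + (norm y)\<^sup>2) - (t\<^sup>2 + (norm z)\<^sup>2)) *\<^sub>R id_blinfun"
    by (simp only: scaleR_diff_left)
  also have "(s + t)\<^sup>2 + (norm (y + z))\<^sup>2 - (s\<^sup>2 + (norm y)\<^sup>2) - (t\<^sup>2 + (norm z)\<^sup>2) = 2 * (s * t + y \<bullet> z)"
    by (simp add: dot_norm power2_eq_square field_simps)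
  finally show ?thesis .
qed

text \<open>By adjointness the cross terms of the two components are equal up to sign and
  cancel.\<close>

lemma norm_spinX:
  assumes "s\<^sup>2 + (norm y)\<^sup>2 = 1"
  shows "norm (blinfun_apply (spinX s y) v) = norm v"
proof -
  obtain a b where Pair: "v = (a, b)" by (metis surj_pair)
  have y: "(y *\<^sub>O b) \<bullet> (y *\<^sub>O b) = (norm y)\<^sup>2 * (b \<bullet> b)"
    "(ocnj y *\<^sub>O a) \<bullet> (ocnj y *\<^sub>O a) = (norm y)\<^sup>2 * (a \<bullet> a)"
    by (simp_all add: dot_square_norm norm_omult norm_ocnj power_mult_distrib)
  have e: "(y *\<^sub>O b) \<bullet> a = a \<bullet> (y *\<^sub>O b)" "b \<bullet> (ocnj y *\<^sub>O a) = a \<bullet> (y *\<^sub>O b)"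
    "(ocnj y *\<^sub>O a) \<bullet> b = a \<bullet> (y *\<^sub>O b)"
    using inner_omult[of a y b] inner_commute by metis+
  have "(norm (blinfun_apply (spinX s y) v))\<^sup>2 =
      (s *\<^sub>R a + y *\<^sub>O b) \<bullet> (s *\<^sub>R a + y *\<^sub>O b) + (ocnj y *\<^sub>O a - s *\<^sub>R b) \<bullet> (ocnj y *\<^sub>O a - s *\<^sub>R b)"
    by (simp only: Pair spinX_apply power2_norm_eq_inner inner_Pair)
  also have "\<dots> = (s\<^sup>2 + (norm y)\<^sup>2) * (a \<bullet> a + b \<bullet> b)"
    by (simp add: inner_add_left inner_add_right inner_diff_left inner_diff_right y e
        power2_eq_square algebra_simps)
  also have "a \<bullet> a + b \<bullet> b = (norm v)\<^sup>2"
    by (simp only: Pair power2_norm_eq_inner inner_Pair)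
  finally have "(norm (blinfun_apply (spinX s y) v))\<^sup>2 = (s\<^sup>2 + (norm y)\<^sup>2) * (norm v)\<^sup>2" .
  then show ?thesis using assms by simp
qed

section \<open>Group structure of Spin(9)\<close>

lemma spin_foldr_append:
  "foldr (\<lambda>(s, y) g. spinX s y o\<^sub>L g) (vs @ ws) id_blinfun =
   foldr (\<lambda>(s, y) g. spinX s y o\<^sub>L g) vs id_blinfun o\<^sub>L foldr (\<lambda>(s, y) g. spinX s y o\<^sub>L g) ws id_blinfun"
  by (induction vs) (auto simp: blinfun_compose_assoc)

lemma Spin9_simps [simp]: "monoid.mult Spin9 = (o\<^sub>L)" "one Spin9 = id_blinfun"
  by (simp_all add: Spin9_def)

lemma Spin9_one: "id_blinfun \<in> carrier Spin9"
  by (auto simp: Spin9_def intro!: exI[of _ "[]"])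

lemma Spin9_pair:
  assumes "s\<^sup>2 + (norm y)\<^sup>2 = 1" "t\<^sup>2 + (norm z)\<^sup>2 = 1"
  shows "spinX s y o\<^sub>L spinX t z \<in> carrier Spin9"
  using assms by (auto simp: Spin9_def intro!: exI[of _ "[(s, y), (t, z)]"])

lemma Spin9_mult:
  assumes "g \<in> carrier Spin9" "h \<in> carrier Spin9"
  shows "g o\<^sub>L h \<in> carrier Spin9"
proof -
  from assms obtain vs ws where
    "g = foldr (\<lambda>(s, y) g. spinX s y o\<^sub>L g) vs id_blinfun" "even (length vs)"
    "\<forall>(s, y) \<in> set vs. s\<^sup>2 + (norm y)\<^sup>2 = 1"
    "h = foldr (\<lambda>(s, y) g. spinX s y o\<^sub>L g) ws id_blinfun" "even (length ws)"
    "\<forall>(s, y) \<in> set ws. s\<^sup>2 + (norm y)\<^sup>2 = 1"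
    by (auto simp: Spin9_def)
  then show ?thesis
    unfolding Spin9_def by (auto simp: spin_foldr_append simp del: foldr_append intro!: exI[of _ "vs @ ws"])
qed

text \<open>A word of even length is consumed two letters at a time from the left, so every
  intermediate operator is again in Spin(9).\<close>

lemma Spin9_induct [consumes 1, case_names one step]:
  assumes "g \<in> carrier Spin9" and one: "P id_blinfun"
    and step: "\<And>s y t z g. s\<^sup>2 + (norm y)\<^sup>2 = 1 \<Longrightarrow> t\<^sup>2 + (norm z)\<^sup>2 = 1 \<Longrightarrow> g \<in> carrier Spin9 \<Longrightarrow> P g
      \<Longrightarrow> P (spinX s y o\<^sub>L (spinX t z o\<^sub>L g))"
  shows "P g"
proof -
  from assms(1) obtain vs where
    g: "g = foldr (\<lambda>(s, y) g. spinX s y o\<^sub>L g) vs id_blinfun" and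
    vs: "even (length vs)" "\<forall>(s, y) \<in> set vs. s\<^sup>2 + (norm y)\<^sup>2 = 1"
    by (auto simp: Spin9_def)
  from vs have "P (foldr (\<lambda>(s, y) g. spinX s y o\<^sub>L g) vs id_blinfun)"
  proof (induction "length vs" arbitrary: vs rule: less_induct)
    case less
    show ?case
    proof (cases vs)
      case Nil
      then show ?thesis using one by simp
    next
      case (Cons v vs')
      with less.prems obtain w ws where ws: "vs' = w # ws" by (cases vs') auto
      obtain s y t z where vw: "v = (s, y)" "w = (t, z)" by (metis surj_pair)
      let ?g = "foldr (\<lambda>(s, y) g. spinX s y o\<^sub>L g) ws id_blinfun"
      have "P ?g" using less Cons ws by auto
      moreover have "?g \<in> carrier Spin9"
        using less.prems Cons ws by (auto simp: Spin9_def)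
      ultimately show ?thesis using step[of s y t z ?g] less.prems by (simp add: Cons ws vw)
    qed
  qed
  then show ?thesis using g by simp
qed

lemma spinX_involution:
  assumes "s\<^sup>2 + (norm y)\<^sup>2 = 1"
  shows "spinX s y o\<^sub>L spinX s y = id_blinfun" "spinX s y o\<^sub>L (spinX s y o\<^sub>L g) = g"
  using assms by (simp_all add: spinX_squared blinfun_compose_assoc[symmetric])

text \<open>The inverse is the reversed word, since the operator of a unit vector is an
  involution.\<close>

lemma Spin9_inverse:
  assumes "g \<in> carrier Spin9"
  shows "\<exists>h \<in> carrier Spin9. h o\<^sub>L g = id_blinfun \<and> g o\<^sub>L h = id_blinfun"
  using assms
proof (induction rule: Spin9_induct)
  case one
  then show ?case using Spin9_one by (intro bexI[of _ id_blinfun]) auto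
next
  case (step s y t z g)
  then obtain h where h: "h \<in> carrier Spin9" "h o\<^sub>L g = id_blinfun" "g o\<^sub>L h = id_blinfun" by blast
  have gh: "g o\<^sub>L (h o\<^sub>L f) = f" for f using h(3) by (simp add: blinfun_compose_assoc[symmetric])
  show ?case
  proof (intro bexI conjI)
    show "h o\<^sub>L (spinX t z o\<^sub>L spinX s y) \<in> carrier Spin9"
      by (intro Spin9_mult Spin9_pair step h)
  qed (simp_all add: blinfun_compose_assoc spinX_involution step h gh)
qed

lemma group_Spin9: "group Spin9"
proof (rule groupI)
  fix g assume "g \<in> carrier Spin9"
  then show "\<exists>h \<in> carrier Spin9. h \<otimes>\<^bsub>Spin9\<^esub> g = \<one>\<^bsub>Spin9\<^esub>" using Spin9_inverse by fastforce
qed (auto simp: Spin9_mult Spin9_one blinfun_compose_assoc)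

lemma norm_Spin9:
  assumes "g \<in> carrier Spin9"
  shows "norm (blinfun_apply g v) = norm v"
  using assms by (induction rule: Spin9_induct) (auto simp: norm_spinX)

section \<open>The vector representation of Spin(9)\<close>

lemma spinX_conj:
  assumes "s\<^sup>2 + (norm y)\<^sup>2 = 1"
  shows "\<exists>t' z'. spinX s y o\<^sub>L spinX t z = spinX t' z' o\<^sub>L spinX s y"
proof -
  \<comment> \<open>With r twice the inner product of (s, y) and (t, z), the conjugate of (t, z) is
    r (s, y) - (t, z), the negative of its reflection in the hyperplane orthogonal to (s,
    y).\<close>
  define r where "r = 2 * (s * t + y \<bullet> z)"
  have "spinX s y o\<^sub>L spinX t z = r *\<^sub>R id_blinfun - (spinX t z o\<^sub>L spinX s y)"
    using spinX_anticommute[of s y t z] unfolding r_def by (simp only: eq_diff_eq)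
  also have "r *\<^sub>R id_blinfun = r *\<^sub>R (spinX s y o\<^sub>L spinX s y)"
    by (simp only: spinX_involution(1)[OF assms])
  finally have "spinX s y o\<^sub>L spinX t z = spinX (r * s - t) (r *\<^sub>R y - z) o\<^sub>L spinX s y"
    by (simp only: spinX_diff spinX_scaleR comp.diff_left comp.scaleR_left)
  then show ?thesis by blast
qed

lemma Spin9_conj_spinX:
  assumes "g \<in> carrier Spin9"
  shows "\<exists>t' z'. g o\<^sub>L spinX t z = spinX t' z' o\<^sub>L g"
  using assms
proof (induction rule: Spin9_induct)
  case one
  then show ?case by (intro exI) auto
next
  case (step s y u w g)
  then obtain t1 z1 where 1: "g o\<^sub>L spinX t z = spinX t1 z1 o\<^sub>L g" by blast
  obtain t2 z2 where 2: "spinX u w o\<^sub>L spinX t1 z1 = spinX t2 z2 o\<^sub>L spinX u w"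
    using spinX_conj[OF step(2)] by blast
  obtain t3 z3 where 3: "spinX s y o\<^sub>L spinX t2 z2 = spinX t3 z3 o\<^sub>L spinX s y"
    using spinX_conj[OF step(1)] by blast
  have "spinX s y o\<^sub>L (spinX u w o\<^sub>L g) o\<^sub>L spinX t z = spinX t3 z3 o\<^sub>L (spinX s y o\<^sub>L (spinX u w o\<^sub>L g))"
    by (simp only: blinfun_compose_assoc 1) (simp only: blinfun_compose_assoc[symmetric] 2 3)
  then show ?case by blast
qed

lemma subgroup_Spin9_commutant: "subgroup (Spin9_commutant J) Spin9"
proof (rule group.subgroupI[OF group_Spin9])
  fix g assume g: "g \<in> Spin9_commutant J"
  then have gc: "g \<in> carrier Spin9" and gJ: "g o\<^sub>L J = J o\<^sub>L g" by (auto simp: Spin9_commutant_def)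
  let ?h = "inv\<^bsub>Spin9\<^esub> g"
  have h: "?h \<in> carrier Spin9" "?h o\<^sub>L g = id_blinfun" "g o\<^sub>L ?h = id_blinfun"
    using group.inv_closed[OF group_Spin9 gc] group.l_inv[OF group_Spin9 gc]
      group.r_inv[OF group_Spin9 gc] by simp_all
  have "?h o\<^sub>L J = ?h o\<^sub>L (J o\<^sub>L g) o\<^sub>L ?h"
    using h(3) by (simp add: blinfun_compose_assoc)
  also have "\<dots> = J o\<^sub>L ?h"
    using h(2) by (simp add: gJ[symmetric] blinfun_compose_assoc[symmetric])
  finally show "?h \<in> Spin9_commutant J" using h(1) by (simp add: Spin9_commutant_def)
next
  fix g h assume "g \<in> Spin9_commutant J" "h \<in> Spin9_commutant J"
  then have g: "g \<in> carrier Spin9" "g o\<^sub>L J = J o\<^sub>L g" and h: "h \<in> carrier Spin9" "h o\<^sub>L J = J o\<^sub>L h"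
    by (auto simp: Spin9_commutant_def)
  have "(g o\<^sub>L h) o\<^sub>L J = J o\<^sub>L (g o\<^sub>L h)"
    by (simp only: blinfun_compose_assoc h) (simp only: blinfun_compose_assoc[symmetric] g)
  then show "g \<otimes>\<^bsub>Spin9\<^esub> h \<in> Spin9_commutant J"
    using g h by (simp add: Spin9_commutant_def Spin9_mult)
qed (use Spin9_one in \<open>auto simp: Spin9_commutant_def\<close>)


section \<open>Complex coordinates on the octonions\<close>

text \<open>The conjugate on the last coordinate makes left multiplication by
  \<open>octo_of c 0\<close> equal to scalar multiplication by \<open>c\<close> on all of
  \<open>complex^3\<close>, see \<open>omult_cscale\<close>.\<close>

definition octo_of :: "complex \<Rightarrow> complex^3 \<Rightarrow> octo" where
  "octo_of a p = ((a, p $ 1), (p $ 2, cnj (p $ 3)))"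

definition cpart :: "octo \<Rightarrow> complex" where "cpart x = fst (fst x)"

definition vpart :: "octo \<Rightarrow> complex^3" where
  "vpart x = vector [snd (fst x), fst (snd x), cnj (snd (snd x))]"

lemma cpart_octo_of [simp]: "cpart (octo_of a p) = a"
  and vpart_octo_of [simp]: "vpart (octo_of a p) = p"
  and octo_of_parts [simp]: "octo_of (cpart x) (vpart x) = x"
  by (auto simp: octo_of_def cpart_def vpart_def vec_eq_iff forall_3)

lemma octo_eq_iff: "x = y \<longleftrightarrow> cpart x = cpart y \<and> vpart x = vpart y"
  by (metis octo_of_parts)

lemma linear_cpart: "linear cpart" and linear_vpart: "linear vpart"
  by (auto intro!: linearI simp: cpart_def vpart_def vec_eq_iff forall_3)

lemmas cpart_simps [simp] = linear_add[OF linear_cpart] linear_diff[OF linear_cpart]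
  linear_neg[OF linear_cpart] linear_0[OF linear_cpart] linear_cmul[OF linear_cpart]

lemmas vpart_simps [simp] = linear_add[OF linear_vpart] linear_diff[OF linear_vpart]
  linear_neg[OF linear_vpart] linear_0[OF linear_vpart] linear_cmul[OF linear_vpart]

lemma octo_of_0 [simp]: "octo_of 0 0 = 0"
  by (simp add: octo_eq_iff)

lemma oone_eq: "oone = octo_of 1 0"
  by (simp add: oone_def octo_of_def)

lemma norm_octo: "(norm x)\<^sup>2 = (norm (cpart x))\<^sup>2 + (norm (vpart x))\<^sup>2"
  by (simp add: cpart_def vpart_def norm_prod_def norm_vec_def L2_set_def sum_3 sum_nonneg)

lemma ocnj_octo_of [simp]: "ocnj (octo_of a p) = octo_of (cnj a) (- p)"
  by (simp add: ocnj_def qcnj_def octo_of_def)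

text \<open>The complex conjugate of the vector product. It is conjugate linear in both arguments
  and equivariant under SU(3).\<close>

definition cross_cnj :: "complex^3 \<Rightarrow> complex^3 \<Rightarrow> complex^3" where
  "cross_cnj p q = vector [cnj (p$2 * q$3 - p$3 * q$2), cnj (p$3 * q$1 - p$1 * q$3),
     cnj (p$1 * q$2 - p$2 * q$1)]"

lemma omult_octo_of [simp]:
  "octo_of a p *\<^sub>O octo_of b q =
     octo_of (a * b - (\<Sum>k\<in>UNIV. p $ k * cnj (q $ k))) (a *s q + cnj b *s p + cross_cnj p q)"
  by (simp add: octo_of_def omult_def qmult_def qcnj_def cross_cnj_def sum_3 algebra_simps)

lemma cross_cnj_0 [simp]: "cross_cnj 0 q = 0" "cross_cnj p 0 = 0"
  by (simp_all add: cross_cnj_def vec_eq_iff forall_3)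

definition cscale :: "complex \<Rightarrow> octo \<Rightarrow> octo" where
  "cscale c x = octo_of (c * cpart x) (c *s vpart x)"

lemma cscale_parts [simp]:
  "cpart (cscale c x) = c * cpart x" "vpart (cscale c x) = c *s vpart x"
  by (simp_all add: cscale_def)

lemma omult_cscale: "octo_of c 0 *\<^sub>O x = cscale c x"
  using omult_octo_of[of c 0 "cpart x" "vpart x"] by (simp add: cscale_def)

lemma omult_complex_right: "x *\<^sub>O octo_of c 0 = octo_of (cpart x * c) (cnj c *s vpart x)"
  using omult_octo_of[of "cpart x" "vpart x" c 0] by simp


section \<open>The Standard Model operators\<close>

definition umap :: "complex \<Rightarrow> complex^3^3 \<Rightarrow> octo \<Rightarrow> octo" where
  "umap w U x = octo_of (w * cpart x) (U *v vpart x)"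

lemma umap_parts [simp]:
  "cpart (umap w U x) = w * cpart x" "vpart (umap w U x) = U *v vpart x"
  by (simp_all add: umap_def)

text \<open>The operator (w \<oplus> U) \<otimes> B. The arguments are arbitrary rather than
  unitary, so that \<open>J_R\<close> and the Clifford operators of \<real> \<oplus> \<complex> have
  this form too and all compositions reduce to \<open>sm_op_mult\<close>.\<close>

definition sm_op :: "complex \<Rightarrow> complex^3^3 \<Rightarrow> complex^2^2 \<Rightarrow> operator" where
  "sm_op w U B = Blinfun (\<lambda>(x, y).
     (umap w U (cscale (B$1$1) x + cscale (B$1$2) y), umap w U (cscale (B$2$1) x + cscale (B$2$2) y)))"

lemma vec_scaleR_simps:
  "(r *\<^sub>R c) *s (v :: complex^'n) = r *\<^sub>R (c *s v)"
  "c *s (r *\<^sub>R v) = r *\<^sub>R (c *s (v :: complex^'n))"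
  by (simp_all add: vec_eq_iff)

lemma matrix_vector_scaleR: "(U :: complex^'n^'m) *v (r *\<^sub>R v) = r *\<^sub>R (U *v v)"
  by (simp add: matrix_vector_mult_def vec_eq_iff scaleR_sum_right)

lemma sm_op_apply:
  "blinfun_apply (sm_op w U B) (x, y) =
     (umap w U (cscale (B$1$1) x + cscale (B$1$2) y), umap w U (cscale (B$2$1) x + cscale (B$2$2) y))"
proof -
  have "linear (\<lambda>(x, y). (umap w U (cscale (B$1$1) x + cscale (B$1$2) y),
      umap w U (cscale (B$2$1) x + cscale (B$2$2) y)))"
    by (rule linearI) (simp_all add: split_beta octo_eq_iff algebra_simps vec.add vec_scaleR_simps
        vector_add_ldistrib matrix_vector_scaleR scaleR_add_right)
  then show ?thesis
    by (simp add: sm_op_def bounded_linear_Blinfun_apply linear_conv_bounded_linear)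
qed

lemma matrix_mul_2: "((A :: complex^2^2) ** B) $ i $ j = A$i$1 * B$1$j + A$i$2 * B$2$j"
  by (simp add: matrix_matrix_mult_def sum_2)

lemma mat_2 [simp]:
  "(mat c :: complex^2^2) $ 1 $ 1 = c" "(mat c :: complex^2^2) $ 1 $ 2 = 0"
  "(mat c :: complex^2^2) $ 2 $ 1 = 0" "(mat c :: complex^2^2) $ 2 $ 2 = c"
  by (simp_all add: mat_def)

lemma mat_vector_mul: "mat c *v (v :: complex^'n) = c *s v"
  by (simp add: mat_def matrix_vector_mult_def vec_eq_iff if_distrib if_distribR sum.delta cong: if_cong)

lemma sm_op_mult: "sm_op w U B o\<^sub>L sm_op w' U' B' = sm_op (w * w') (U ** U') (B ** B')"
  by (rule spinor_op_eqI)
    (simp add: sm_op_apply octo_eq_iff matrix_mul_2 algebra_simps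
      vec.scale matrix_vector_mul_assoc[symmetric] vec.add)

lemma sm_op_one: "sm_op 1 (mat 1) (mat 1) = id_blinfun"
  by (rule spinor_op_eqI) (simp add: sm_op_apply octo_eq_iff)

lemma J_R_eq_sm_op: "J_R (octo_of \<i> 0) = sm_op \<i> (mat (- \<i>)) (mat 1)"
  by (rule spinor_op_eqI)
    (simp add: sm_op_apply J_R_apply octo_eq_iff mat_vector_mul omult_complex_right mult.commute)

lemma matrix_mul_mat: "(A :: complex^'n^'n) ** mat c = mat c ** A"
  by (simp add: matrix_matrix_mult_def mat_def vec_eq_iff if_distrib if_distribR sum.delta cong: if_cong)

text \<open>Right multiplication by the standard unit is the scalar \<i> on the complex line and -
  \<i> on \<open>complex^3\<close>, hence commutes with every operator that respects this splitting
  complex linearly.\<close>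

lemma sm_op_J_R_commute:
  "sm_op w U B o\<^sub>L J_R (octo_of \<i> 0) = J_R (octo_of \<i> 0) o\<^sub>L sm_op w U B"
  by (simp add: J_R_eq_sm_op sm_op_mult matrix_mul_mat mult.commute)

lemma scaleR_eq_scalar_mult:
  "r *\<^sub>R (c :: complex) = of_real r * c" "r *\<^sub>R (v :: complex^'n) = of_real r *s v"
  by (simp_all add: vec_eq_iff scaleR_conv_of_real[where 'a = complex])

text \<open>Trace-free Hermitian matrices, the real span of the Pauli matrices, as a model of the
  vectors in \<real> \<oplus> \<complex>.\<close>

definition hvec :: "real \<Rightarrow> complex \<Rightarrow> complex^2^2" where
  "hvec s c = vector [vector [of_real s, c], vector [cnj c, - of_real s]]"

lemma spinX_complex: "spinX s (octo_of c 0) = sm_op 1 (mat 1) (hvec s c)"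
  by (rule spinor_op_eqI)
    (simp add: sm_op_apply spinX_apply octo_eq_iff hvec_def omult_cscale scaleR_eq_scalar_mult)


section \<open>Automorphisms of the octonions\<close>

text \<open>The Moufang identities replace associativity in the proof that conjugation by a suitable
  unit octonion is multiplicative.\<close>

lemma moufang_middle: "(a *\<^sub>O x) *\<^sub>O (y *\<^sub>O a) = (a *\<^sub>O (x *\<^sub>O y)) *\<^sub>O a"
  and moufang_right: "((x *\<^sub>O a) *\<^sub>O y) *\<^sub>O a = x *\<^sub>O ((a *\<^sub>O y) *\<^sub>O a)"
  and flexible: "(a *\<^sub>O x) *\<^sub>O a = a *\<^sub>O (x *\<^sub>O a)"
  by (simp add: octo_defs split_beta; simp add: algebra_simps)+

lemma ocnj_omult: "ocnj (x *\<^sub>O y) = ocnj y *\<^sub>O ocnj x"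
  by (simp add: octo_defs split_beta; simp add: algebra_simps)

text \<open>Conjugation and norm are part of the preserved structure because \<open>spinX\<close>
  and the unit condition in \<open>Spin9\<close> refer to them.\<close>

definition octo_aut :: "(octo \<Rightarrow> octo) \<Rightarrow> bool" where
  "octo_aut f \<longleftrightarrow> linear f \<and> (\<forall>x y. f (x *\<^sub>O y) = f x *\<^sub>O f y) \<and> (\<forall>x. f (ocnj x) = ocnj (f x))
     \<and> (\<forall>x. norm (f x) = norm x)"

lemma octo_aut_compose: "octo_aut f \<Longrightarrow> octo_aut g \<Longrightarrow> octo_aut (f \<circ> g)"
  unfolding octo_aut_def o_apply using linear_compose[of g f] by (simp add: o_def del: split_paired_All)

text \<open>Conjugation by \<open>u\<close> is an automorphism because \<open>u\<^sup>3 = -1\<close>.\<close>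

lemma octo_aut_conj:
  assumes "norm u = 1" and Re: "ocnj u = oone - u"
  shows "octo_aut (\<lambda>x. (u *\<^sub>O x) *\<^sub>O ocnj u)"
proof -
  have "u *\<^sub>O ocnj u = oone" using assms(1) by (simp add: omult_ocnj)
  then have uu: "u *\<^sub>O u = - ocnj u"
    by (simp add: Re omult.diff_right algebra_simps)
  have uuu: "ocnj u *\<^sub>O u = oone"
    using \<open>u *\<^sub>O ocnj u = oone\<close> by (simp add: Re omult.diff_left omult.diff_right)
  have cu: "u *\<^sub>O (ocnj u *\<^sub>O x) = x" "(x *\<^sub>O ocnj u) *\<^sub>O u = x" for x
    using assms(1) omult_ocnj_cancel(1)[of u x] omult_right_alternative[of x u]
    by (simp_all add: uu) (simp add: Re omult.diff_right omult.diff_left uu)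
  let ?f = "\<lambda>x. (u *\<^sub>O x) *\<^sub>O ocnj u"
  have "?f (x *\<^sub>O y) = ?f x *\<^sub>O ?f y" for x y
  proof -
    \<comment> \<open>Since \<open>u *\<^sub>O u = - ocnj u\<close>, right multiplication by
      \<open>ocnj u\<close> becomes a double right multiplication by \<open>u\<close>, which brings
      the product into Moufang form.\<close>
    have f: "?f z = - (((u *\<^sub>O z) *\<^sub>O u) *\<^sub>O u)" for z
      by (simp add: omult_right_alternative uu omult.minus_right)
    have fx: "?f x = u *\<^sub>O (x *\<^sub>O ocnj u)"
      by (simp add: Re omult.diff_right omult.diff_left flexible)
    have "?f x *\<^sub>O ?f y = - ((u *\<^sub>O (x *\<^sub>O ocnj u)) *\<^sub>O (((u *\<^sub>O y) *\<^sub>O u) *\<^sub>O u))"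
      unfolding fx f[of y] by (simp add: omult.minus_right)
    also have "\<dots> = - ((u *\<^sub>O ((x *\<^sub>O ocnj u) *\<^sub>O ((u *\<^sub>O y) *\<^sub>O u))) *\<^sub>O u)"
      by (simp only: moufang_middle)
    also have "(x *\<^sub>O ocnj u) *\<^sub>O ((u *\<^sub>O y) *\<^sub>O u) = (x *\<^sub>O y) *\<^sub>O u"
      by (simp only: moufang_right[symmetric] cu)
    also have "- ((u *\<^sub>O ((x *\<^sub>O y) *\<^sub>O u)) *\<^sub>O u) = ?f (x *\<^sub>O y)"
      by (simp only: f flexible)
    finally show ?thesis ..
  qed
  moreover have "linear ?f"
    by (rule linearI) (simp_all add: omult.add_left omult.add_right omult.scaleR_left omult.scaleR_right)
  moreover have "?f (ocnj x) = ocnj (?f x)" for x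
  proof -
    have inv: "ocnj (ocnj z) = z" for z by (simp add: octo_defs split: prod.splits)
    show ?thesis
      by (simp add: ocnj_omult inv) (simp add: Re omult.diff_right omult.diff_left flexible)
  qed
  moreover have "norm (?f x) = norm x" for x
    by (simp only: norm_omult norm_ocnj assms(1) mult_1_left mult_1_right)
  ultimately show ?thesis by (simp add: octo_aut_def)
qed

lemma ocnj_plus: "ocnj x = (2 * (x \<bullet> oone)) *\<^sub>R oone - x"
  by (cases x rule: octo_cases) (simp add: octo_defs complex_eq_iff)

text \<open>Every real combination u of 1 - j i and i + j satisfies u i = j u. If moreover u has
  norm 1 and real part 1/2, then conjugation by u is an automorphism, and it takes i to j.\<close>

lemma octo_aut_between:
  assumes i: "ocnj i = - i" "norm i = 1" and j: "ocnj j = - j" "norm j = 1"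
    and ij: "0 \<le> i \<bullet> j"
  obtains f where "octo_aut f" "f i = j"
proof -
  define c where "c = i \<bullet> j"
  have ii: "i *\<^sub>O i = - oone" using omult_ocnj[of i] i by (simp add: omult.minus_right minus_equation_iff)
  have jj: "j *\<^sub>O j = - oone" using omult_ocnj[of j] j by (simp add: omult.minus_right minus_equation_iff)
  \<comment> \<open>The value of \<open>s\<close> makes the real part of u equal to 1/2 and that of
    \<open>t\<close> makes its norm 1. The radicand of \<open>t\<close> is s - s^2, nonnegative
    because \<open>0 \<le> i \<bullet> j\<close> gives \<open>s \<le> 1\<close>.\<close>
  define s where "s = 1 / (2 * (1 + c))"
  define t where "t = sqrt (1 / (2 * (1 + c)) - s\<^sup>2)"
  have c: "0 \<le> c" using ij by (simp add: c_def)
  have "s \<le> 1" using c by (simp add: s_def field_simps)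
  then have st: "s\<^sup>2 + t\<^sup>2 = 1 / (2 * (1 + c))"
    using c mult_left_mono[of s 1 s] by (simp add: t_def s_def power2_eq_square)
  define u where "u = s *\<^sub>R (oone - j *\<^sub>O i) + t *\<^sub>R (i + j)"
  have ui: "u *\<^sub>O i = j *\<^sub>O u"
    by (simp add: u_def omult.add_left omult.diff_left omult.add_right omult.diff_right
        omult.scaleR_left omult.scaleR_right omult_right_alternative
        omult_left_alternative[symmetric] ii jj omult.minus_left omult.minus_right algebra_simps)
  have one: "oone \<bullet> i = 0" "oone \<bullet> j = 0"
    using ocnj_plus[of i] ocnj_plus[of j] i j by (auto simp: oone_def zero_prod_def inner_commute)
  have adj: "(j *\<^sub>O i) \<bullet> x = - (i \<bullet> (j *\<^sub>O x))" for x
    using inner_omult[of i j x] inner_omult[of x j i] j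
    by (simp add: omult.minus_left inner_commute)
  have unit: "oone \<bullet> oone = 1" "i \<bullet> i = 1" "j \<bullet> j = 1" "(j *\<^sub>O i) \<bullet> (j *\<^sub>O i) = 1"
    using i j by (simp_all add: dot_square_norm norm_omult) (simp add: oone_def norm_prod_def)
  have "(j *\<^sub>O i) \<bullet> oone = - c" by (simp add: adj c_def)
  then have ji: "oone \<bullet> (j *\<^sub>O i) = - c" by (simp add: inner_commute)
  have "(j *\<^sub>O i) \<bullet> j = - (i \<bullet> (j *\<^sub>O j))" by (rule adj)
  then have "(j *\<^sub>O i) \<bullet> j = 0" using one by (simp add: jj inner_commute)
  moreover have "(j *\<^sub>O i) \<bullet> i = 0"
  proof -
    have "(j *\<^sub>O i) \<bullet> (oone *\<^sub>O i) = (norm i)\<^sup>2 * (j \<bullet> oone)"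
      using norm_omult[of "j + oone" i] norm_omult[of "j" i]
      by (simp only: dot_norm omult.add_left[symmetric] norm_omult) (simp add: i)
    then show ?thesis using one by (simp add: inner_commute)
  qed
  ultimately have "(norm u)\<^sup>2 = (2 + 2 * c) * (s\<^sup>2 + t\<^sup>2)"
    using one ji unit
    unfolding u_def power2_norm_eq_inner c_def[symmetric]
    by (simp add: inner_add_left inner_add_right inner_diff_left inner_diff_right inner_commute
      c_def power2_eq_square algebra_simps)
  then have "(norm u)\<^sup>2 = 1" using st c by (simp add: field_simps)
  then have nu: "norm u = 1" by (simp add: power2_eq_1_iff) (use norm_ge_zero[of u] in linarith)
  have "u \<bullet> oone = s * (1 + c)"
    using one ji unit by (simp add: u_def inner_add_left inner_diff_left inner_commute algebra_simps)
  moreover have "s * (1 + c) = 1 / 2" using c by (simp add: s_def)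
  ultimately have uo: "u \<bullet> oone = 1 / 2" by simp
  have "ocnj u = oone - u" by (simp only: ocnj_plus uo) simp
  with nu have "octo_aut (\<lambda>x. (u *\<^sub>O x) *\<^sub>O ocnj u)" by (rule octo_aut_conj)
  moreover have "(u *\<^sub>O i) *\<^sub>O ocnj u = j"
  proof -
    have "u *\<^sub>O u = - ocnj u"
      using omult_ocnj[of u] nu by (simp add: \<open>ocnj u = oone - u\<close> omult.diff_right algebra_simps)
    then show ?thesis
      unfolding ui \<open>ocnj u = oone - u\<close>
      by (simp add: omult.diff_right omult_right_alternative \<open>ocnj u = oone - u\<close> omult.minus_right)
  qed
  ultimately show thesis by (rule that)
qed

text \<open>The inner product of \<open>octo_of \<i> 0\<close> with \<open>j\<close> may be
  negative, so the way leads through a unit \<open>k\<close> orthogonal to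
  \<open>octo_of \<i> 0\<close>, with its sign chosen such that
  \<open>0 \<le> k \<bullet> j\<close>.\<close>

lemma octo_aut_transitive:
  assumes "ocnj j = - j" "norm j = 1"
  obtains f where "octo_aut f" "f (octo_of \<i> 0) = j"
proof -
  define e where "e = octo_of 0 (axis 1 1)"
  define k where "k = (if 0 \<le> e \<bullet> j then e else - e)"
  have e: "ocnj e = - e" "norm e = 1" "octo_of \<i> 0 \<bullet> e = 0"
    by (simp_all add: e_def octo_of_def axis_def ocnj_def qcnj_def norm_prod_def)
  then have k: "ocnj k = - k" "norm k = 1" "octo_of \<i> 0 \<bullet> k = 0" "0 \<le> k \<bullet> j"
    by (auto simp: k_def linear_neg[OF linear_ocnj])
  have "ocnj (octo_of \<i> 0) = - octo_of \<i> 0" "norm (octo_of \<i> 0) = 1"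
    by (simp_all add: octo_of_def ocnj_def qcnj_def norm_prod_def)
  then obtain f where f: "octo_aut f" "f (octo_of \<i> 0) = k"
    using octo_aut_between k by (metis order_refl)
  obtain g where "octo_aut g" "g k = j"
    using octo_aut_between k assms by metis
  with f that[of "g \<circ> f"] show thesis by (simp add: octo_aut_compose)
qed


section \<open>Unitary matrices\<close>

definition hdot :: "complex^'n \<Rightarrow> complex^'n \<Rightarrow> complex" where
  "hdot p q = (\<Sum>k\<in>UNIV. cnj (p $ k) * q $ k)"

lemma hdot_linear:
  "hdot p (q + r) = hdot p q + hdot p r" "hdot p (q - r) = hdot p q - hdot p r"
  "hdot (p + q) r = hdot p r + hdot q r" "hdot (p - q) r = hdot p r - hdot q r"
  "hdot p (c *s q) = c * hdot p q" "hdot (c *s p) q = cnj c * hdot p q"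
  by (simp_all add: hdot_def algebra_simps sum.distrib sum_subtractf sum_distrib_left)

lemma cnj_hdot: "cnj (hdot p q) = hdot q p"
  by (simp add: hdot_def mult.commute)

lemma Re_hdot: "Re (hdot p q) = p \<bullet> q"
  by (simp add: hdot_def inner_vec_def inner_complex_def)

lemma hdot_self: "hdot p p = of_real ((norm p)\<^sup>2)"
proof (rule complex_eqI)
  show "Im (hdot p p) = Im (of_real ((norm p)\<^sup>2))"
    using cnj_hdot[of p p] by (simp add: complex_eq_iff)
qed (simp add: Re_hdot power2_norm_eq_inner)

lemma norm_smult: "norm (c *s (v :: complex^'n)) = cmod c * norm v"
  by (simp add: norm_vec_def norm_mult L2_set_right_distrib)

lemma hdot_axis: "hdot (axis i 1) p = p $ i"
  by (simp add: hdot_def axis_def if_distrib if_distribR sum.delta cong: if_cong)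

lemma norm_axis_complex: "norm (axis k (1 :: complex)) = 1"
proof -
  have "of_real ((norm (axis k (1 :: complex)))\<^sup>2) = (1 :: complex)"
    unfolding hdot_self[symmetric] hdot_axis by simp
  then show ?thesis unfolding of_real_eq_1_iff by simp
qed

lemma matrix_vector_axis: "((U :: complex^'n^'m) *v axis k 1) $ i = U $ i $ k"
  by (simp add: matrix_vector_mult_def axis_def if_distrib if_distribR sum.delta cong: if_cong)

lemma matrix_eq_axisI:
  fixes U V :: "complex^'n^'m"
  assumes "\<And>k. U *v axis k 1 = V *v axis k 1"
  shows "U = V"
  using assms matrix_vector_axis by (metis vec_eq_iff)

definition cunitary :: "complex^'n^'n \<Rightarrow> bool" where
  "cunitary A \<longleftrightarrow> A ** cadjoint A = mat 1"

lemma cadjoint_mult: "cadjoint (A ** B) = cadjoint B ** cadjoint A"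
  by (simp add: cadjoint_def matrix_matrix_mult_def vec_eq_iff mult.commute)

lemma cadjoint_involutive [simp]: "cadjoint (cadjoint A) = A"
  by (simp add: cadjoint_def vec_eq_iff)

lemma cadjoint_mat [simp]: "cadjoint (mat c) = mat (cnj c)"
  by (simp add: cadjoint_def mat_def vec_eq_iff)

lemma cunitary_left: "cunitary A \<Longrightarrow> cadjoint A ** A = mat 1"
  by (simp add: cunitary_def matrix_left_right_inverse)

lemma cunitary_mult: "cunitary A \<Longrightarrow> cunitary B \<Longrightarrow> cunitary (A ** B)"
  unfolding cunitary_def cadjoint_mult by (metis matrix_mul_assoc matrix_mul_rid)

lemma cunitary_cadjoint: "cunitary A \<Longrightarrow> cunitary (cadjoint A)"
  by (simp add: cunitary_def[of "cadjoint A"] cunitary_left)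

lemma hdot_cadjoint: "hdot (U *v p) q = hdot p (cadjoint U *v q)"
proof -
  have "hdot (U *v p) q = (\<Sum>i\<in>UNIV. \<Sum>j\<in>UNIV. cnj (p $ j) * (cnj (U $ i $ j) * q $ i))"
    by (simp add: hdot_def matrix_vector_mult_def sum_distrib_right sum_distrib_left algebra_simps)
  also have "\<dots> = hdot p (cadjoint U *v q)"
    by (subst sum.swap) (simp add: hdot_def matrix_vector_mult_def cadjoint_def sum_distrib_left)
  finally show ?thesis .
qed

lemma hdot_cunitary: "cunitary U \<Longrightarrow> hdot (U *v p) (U *v q) = hdot p q"
  by (simp add: hdot_cadjoint matrix_vector_mul_assoc cunitary_left)

lemma norm_cunitary: "cunitary U \<Longrightarrow> norm (U *v p) = norm p"
  using hdot_cunitary[of U p p] unfolding hdot_self of_real_eq_iff by simp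

text \<open>Polarization gives invariance of the real inner product, which is the real part of
  \<open>hdot\<close>; replacing q by \<i> q gives the imaginary part.\<close>

lemma cunitaryI:
  fixes U :: "complex^'n^'n"
  assumes "\<And>p. norm (U *v p) = norm p"
  shows "cunitary U"
proof -
  have inner: "(U *v p) \<bullet> (U *v q) = p \<bullet> q" for p q
    using assms[of "p + q"] assms[of p] assms[of q] by (simp add: dot_norm vec.add)
  have hdot: "hdot (U *v p) (U *v q) = hdot p q" for p q
  proof (rule complex_eqI)
    show "Re (hdot (U *v p) (U *v q)) = Re (hdot p q)" by (simp add: Re_hdot inner)
    have "Re (hdot (U *v p) (U *v (\<i> *s q))) = Re (hdot p (\<i> *s q))" by (simp add: Re_hdot inner)
    then show "Im (hdot (U *v p) (U *v q)) = Im (hdot p q)"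
      by (simp add: vec.scale hdot_linear)
  qed
  have "(cadjoint U ** U) *v axis k 1 = mat 1 *v axis k 1" for k
  proof (simp add: vec_eq_iff, intro allI)
    fix i
    have "((cadjoint U ** U) *v axis k 1) $ i = hdot (U *v axis i 1) (U *v axis k 1)"
      by (simp add: hdot_cadjoint matrix_vector_mul_assoc hdot_axis)
    then show "((cadjoint U ** U) *v axis k 1) $ i = axis k 1 $ i"
      by (simp add: hdot hdot_axis)
  qed
  then have "cadjoint U ** U = mat 1" by (rule matrix_eq_axisI)
  then show ?thesis by (simp add: cunitary_def matrix_left_right_inverse)
qed

lemma det_cadjoint: "det (cadjoint U) = cnj (det U)"
proof -
  have "cadjoint U = transpose (\<chi> i j. cnj (U $ i $ j))"
    by (simp add: cadjoint_def transpose_def vec_eq_iff)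
  then have "det (cadjoint U) = det (\<chi> i j. cnj (U $ i $ j))"
    by (simp only: det_transpose)
  also have "\<dots> = cnj (det U)" by (simp add: det_def)
  finally show ?thesis .
qed

lemma unit_complex_mult_cnj: "cmod \<alpha> = 1 \<Longrightarrow> \<alpha> * cnj \<alpha> = 1"
  using complex_norm_square[of \<alpha>] by simp

lemma cmod_det_cunitary:
  assumes "cunitary U"
  shows "cmod (det U) = 1"
proof -
  have "det U * cnj (det U) = 1"
    using assms det_cadjoint[of U] unfolding cunitary_def by (metis det_I det_mul)
  then have "(cmod (det U))\<^sup>2 = 1"
    by (metis complex_norm_square of_real_eq_1_iff)
  then show ?thesis by (simp add: power2_eq_1_iff) (use norm_ge_zero[of "det U"] in linarith)
qed


section \<open>Standard Model operators in Spin(9)\<close>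

text \<open>For a unit vector \<open>v\<close>: eigenvalue \<open>cnj \<alpha>\<close> on
  \<open>v\<close> and \<open>\<alpha>\<close> on its orthogonal complement.\<close>

definition phase_mat :: "complex \<Rightarrow> complex^3 \<Rightarrow> complex^3^3" where
  "phase_mat \<alpha> v = (\<chi> i j. (if i = j then \<alpha> else 0) + (cnj \<alpha> - \<alpha>) * v $ i * cnj (v $ j))"

lemma phase_mat_mult: "phase_mat \<alpha> v *v x = \<alpha> *s x + ((cnj \<alpha> - \<alpha>) * hdot v x) *s v"
  by (simp add: phase_mat_def matrix_vector_mult_def hdot_def vec_eq_iff forall_3 sum_3 algebra_simps)

lemma hdot_3: "hdot p (q :: complex^3) = cnj (p$1) * q$1 + cnj (p$2) * q$2 + cnj (p$3) * q$3"
  by (simp add: hdot_def sum_3)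

lemma det_phase_mat:
  assumes "hdot v v = 1" "\<alpha> * cnj \<alpha> = 1"
  shows "det (phase_mat \<alpha> v) = \<alpha>"
proof -
  have "det (phase_mat \<alpha> v) = \<alpha>^3 + \<alpha>^2 * (cnj \<alpha> - \<alpha>) * hdot v v"
    by (simp add: phase_mat_def det_3 hdot_3) (simp add: algebra_simps power2_eq_square power3_eq_cube)
  also have "\<dots> = \<alpha> * (\<alpha> * cnj \<alpha>)"
    by (simp add: assms(1) algebra_simps power2_eq_square power3_eq_cube)
  finally show ?thesis by (simp add: assms(2))
qed

lemma omult_phase:
  "octo_of 0 v *\<^sub>O (octo_of 0 (\<alpha> *s v) *\<^sub>O octo_of a x) =
   - octo_of (hdot v v * cnj \<alpha> * a)
      ((\<alpha> * hdot v v) *s x + ((cnj \<alpha> - \<alpha>) * hdot v x) *s v)"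
  by (simp add: octo_eq_iff cross_cnj_def vec_eq_iff forall_3 hdot_3 sum_3) (simp add: algebra_simps)

text \<open>The conjugate in the lower left block of \<open>spinX\<close> is a sign on imaginary
  octonions; it cancels the sign in \<open>omult_phase\<close> on both components.\<close>

lemma spinX_phase:
  assumes "hdot v v = 1"
  shows "spinX 0 (octo_of 0 v) o\<^sub>L spinX 0 (octo_of 0 (\<alpha> *s v))
    = sm_op (cnj \<alpha>) (phase_mat \<alpha> v) (mat 1)"
proof (rule spinor_op_eqI)
  fix x y
  have neg: "octo_of 0 (- p) = - octo_of 0 p" for p by (simp add: octo_eq_iff)
  have "umap (cnj \<alpha>) (phase_mat \<alpha> v) z = - (octo_of 0 v *\<^sub>O (octo_of 0 (\<alpha> *s v) *\<^sub>O z))" for z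
    using omult_phase[of v \<alpha> "cpart z" "vpart z"] assms
    by (simp add: octo_eq_iff phase_mat_mult)
  then show "blinfun_apply (spinX 0 (octo_of 0 v) o\<^sub>L spinX 0 (octo_of 0 (\<alpha> *s v))) (x, y) =
      blinfun_apply (sm_op (cnj \<alpha>) (phase_mat \<alpha> v) (mat 1)) (x, y)"
    by (simp add: spinX_apply sm_op_apply neg omult.minus_left omult.minus_right cscale_def)
qed

text \<open>The phase on the complex line is tied to the determinant because the generators in
  \<open>spinX_phase\<close> have phase \<open>cnj \<alpha>\<close> and determinant
  \<open>\<alpha>\<close>.\<close>

definition spin_unitary :: "complex^3^3 \<Rightarrow> bool" where
  "spin_unitary U \<longleftrightarrow> sm_op (cnj (det U)) U (mat 1) \<in> carrier Spin9"

lemma spin_unitary_mult: "spin_unitary U \<Longrightarrow> spin_unitary V \<Longrightarrow> spin_unitary (U ** V)"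
  unfolding spin_unitary_def using Spin9_mult by (fastforce simp: sm_op_mult det_mul)

lemma spin_unitary_one: "spin_unitary (mat 1)"
  unfolding spin_unitary_def using Spin9_one by (simp add: sm_op_one)

lemma spin_unitary_phase_mat:
  assumes "norm v = 1" "cmod \<alpha> = 1"
  shows "spin_unitary (phase_mat \<alpha> v)"
proof -
  have 1: "hdot v v = 1" "\<alpha> * cnj \<alpha> = 1"
    using assms by (auto simp: hdot_self unit_complex_mult_cnj)
  then have "norm (\<alpha> *s v) = 1"
    using assms by (simp add: norm_smult)
  then have "spinX 0 (octo_of 0 v) o\<^sub>L spinX 0 (octo_of 0 (\<alpha> *s v)) \<in> carrier Spin9"
    using assms by (intro Spin9_pair) (simp_all add: norm_octo)
  then show ?thesis
    using 1 by (simp add: spin_unitary_def det_phase_mat spinX_phase)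
qed

lemma spin_unitary_mat:
  assumes "cmod \<alpha> = 1"
  shows "spin_unitary (mat \<alpha>)"
proof -
  have 1: "\<alpha> * (\<alpha> * cnj \<alpha>) = \<alpha>" using assms by (simp add: unit_complex_mult_cnj)
  \<comment> \<open>Each axis receives \<open>\<alpha>\<close> twice and \<open>cnj \<alpha>\<close>
    once.\<close>
  have "phase_mat \<alpha> (axis 1 1) ** phase_mat \<alpha> (axis 2 1) ** phase_mat \<alpha> (axis 3 1) = mat \<alpha>"
    using 1 by (simp add: phase_mat_def matrix_matrix_mult_def mat_def axis_def vec_eq_iff forall_3 sum_3
        mult_ac)
  moreover have "norm (axis k 1 :: complex^3) = 1" for k by (simp add: norm_axis_complex)
  ultimately show ?thesis
    using assms spin_unitary_phase_mat spin_unitary_mult by metis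
qed

lemma cunitary_spin_unitary:
  assumes "spin_unitary U"
  shows "cunitary U"
proof (rule cunitaryI)
  fix p
  have "norm (blinfun_apply (sm_op (cnj (det U)) U (mat 1)) (octo_of 0 p, 0)) = norm (octo_of 0 p, 0 :: octo)"
    using assms norm_Spin9 unfolding spin_unitary_def by blast
  moreover have "norm (octo_of 0 q) = norm q" for q
    using norm_octo[of "octo_of 0 q"] by simp
  moreover have "umap (cnj (det U)) U (octo_of 0 p) = octo_of 0 (U *v p)" "umap (cnj (det U)) U 0 = 0"
    by (simp_all add: octo_eq_iff)
  ultimately show "norm (U *v p) = norm p"
    by (simp add: sm_op_apply cscale_def norm_Pair)
qed

text \<open>\<open>R\<close> is the complex reflection along x - y: it multiplies x - y by a phase
  \<open>\<kappa>\<close> and fixes the orthogonal complement, in particular every vector orthogonal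
  to both x and y.\<close>

lemma spin_unitary_transitive:
  fixes x y :: "complex^3"
  assumes "norm x = 1" "norm y = 1"
  obtains R where "spin_unitary R" "R *v x = y"
    "\<And>z. hdot x z = 0 \<Longrightarrow> hdot y z = 0 \<Longrightarrow> R *v z = z"
proof (cases "x = y")
  case True
  then show ?thesis using that[of "mat 1"] spin_unitary_one by simp
next
  case False
  define d where "d = x - y"
  define n where "n = norm d"
  define c where "c = hdot y x"
  \<comment> \<open>The solution of \<open>(\<kappa> - 1) * (1 - c) = - (norm d)^2\<close>, which is
    the condition that the reflection moves x by - d, that is, to y.\<close>
  define \<kappa> where "\<kappa> = - (1 - cnj c) / (1 - c)"
  have n0: "n \<noteq> 0" using False by (simp add: n_def d_def)
  have "hdot d d = hdot x x - hdot x y - (hdot y x - hdot y y)"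
    by (simp add: d_def hdot_linear)
  then have "hdot d d = 1 - c + (1 - cnj c)"
    using assms by (simp add: hdot_self[of x] hdot_self[of y] c_def cnj_hdot)
  then have n2: "of_real (n\<^sup>2) = 1 - c + (1 - cnj c)" by (simp add: hdot_self n_def)
  then have c1: "1 - c \<noteq> 0" using n0 by auto
  have "cmod (1 - cnj c) = cmod (1 - c)"
    by (metis complex_cnj_diff complex_cnj_one complex_mod_cnj)
  then have "cmod \<kappa> = 1" using c1 by (simp add: \<kappa>_def norm_divide norm_minus_commute[of "cnj c"])
  \<comment> \<open>A phase with \<open>cnj \<alpha> ^ 2 = \<kappa>\<close>: then
    \<open>cnj \<alpha>\<close> times \<open>phase_mat \<alpha> v\<close> has eigenvalue
    \<open>\<kappa>\<close> on v and 1 on the complement.\<close>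
  define \<alpha> where "\<alpha> = cnj (csqrt \<kappa>)"
  have \<alpha>: "cmod \<alpha> = 1" using \<open>cmod \<kappa> = 1\<close> by (simp add: \<alpha>_def)
  have \<alpha>2: "cnj \<alpha> * cnj \<alpha> = \<kappa>" by (simp add: \<alpha>_def power2_eq_square[symmetric])
  define v where "v = (of_real (1 / n)) *s d"
  define R where "R = mat (cnj \<alpha>) ** phase_mat \<alpha> v"
  have vd: "v = (1 / n) *\<^sub>R d" by (simp add: v_def scaleR_eq_scalar_mult)
  have "norm v = 1" using n0 by (simp add: vd n_def)
  then have sR: "spin_unitary R"
    unfolding R_def using \<alpha> by (intro spin_unitary_mult spin_unitary_mat spin_unitary_phase_mat) auto
  have Rz: "R *v z = z + ((\<kappa> - 1) * hdot d z / of_real (n\<^sup>2)) *s d" for z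
  proof -
    have "R *v z = (\<alpha> * cnj \<alpha>) *s z +
        ((cnj \<alpha> * cnj \<alpha> - \<alpha> * cnj \<alpha>) * (hdot d z * (of_real (1 / n) * of_real (1 / n)))) *s d"
      by (simp add: R_def matrix_vector_mul_assoc[symmetric] mat_vector_mul phase_mat_mult v_def
          hdot_linear vec_eq_iff algebra_simps del: of_real_divide)
    also have "\<dots> = z + ((\<kappa> - 1) * hdot d z / of_real (n\<^sup>2)) *s d"
      unfolding \<alpha>2 unit_complex_mult_cnj[OF \<alpha>] by (simp add: power2_eq_square)
    finally show ?thesis .
  qed
  have "hdot d x = 1 - c" using assms by (simp add: d_def hdot_linear hdot_self c_def)
  moreover have "(\<kappa> - 1) * (1 - c) = - of_real (n\<^sup>2)"
    unfolding n2 using c1 by (simp add: \<kappa>_def field_simps)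
  ultimately have "(\<kappa> - 1) * hdot d x / of_real (n\<^sup>2) = -1" using n0 by simp
  then have "R *v x = y" unfolding Rz by (simp add: d_def vec_eq_iff)
  moreover have "R *v z = z" if "hdot x z = 0" "hdot y z = 0" for z
    using that unfolding Rz by (simp add: d_def hdot_linear)
  ultimately show ?thesis using that[of R] sR by blast
qed

text \<open>Reduction by complex reflections: \<open>R1\<close>, \<open>R2\<close>,
  \<open>R3\<close> return the images of the three axes one after another. Each fixes the axes
  already returned, because unitary matrices keep the images orthogonal. So \<open>U\<close> has a
  left inverse made of such reflections.\<close>

lemma spin_unitary_if_cunitary:
  assumes U: "cunitary U"
  shows "spin_unitary U"
proof -
  let ?e = "\<lambda>k. axis k (1 :: complex) :: complex^3"
  have ne: "norm (?e k) = 1" for k by (simp add: norm_axis_complex)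
  have e: "hdot (?e j) (?e k) = 0" if "j \<noteq> k" for j k
    using that unfolding hdot_axis by (simp add: axis_def)
  obtain R1 where R1: "spin_unitary R1" "R1 *v (U *v ?e 1) = ?e 1"
    using spin_unitary_transitive[of "U *v ?e 1" "?e 1"] norm_cunitary[OF U] ne by metis
  let ?U1 = "R1 ** U"
  have U1: "cunitary ?U1" using U R1 cunitary_spin_unitary cunitary_mult by blast
  have f1: "?U1 *v ?e 1 = ?e 1" using R1(2) by (simp add: matrix_vector_mul_assoc)
  obtain R2 where R2: "spin_unitary R2" "R2 *v (?U1 *v ?e 2) = ?e 2"
    "\<And>z. hdot (?U1 *v ?e 2) z = 0 \<Longrightarrow> hdot (?e 2) z = 0 \<Longrightarrow> R2 *v z = z"
    using spin_unitary_transitive[of "?U1 *v ?e 2" "?e 2"] norm_cunitary[OF U1] ne by metis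
  let ?U2 = "R2 ** ?U1"
  have U2: "cunitary ?U2" using U1 R2 cunitary_spin_unitary cunitary_mult by blast
  have "hdot (?U1 *v ?e 2) (?e 1) = 0" using hdot_cunitary[OF U1, of "?e 2" "?e 1"] f1 e by simp
  then have f2: "?U2 *v ?e 1 = ?e 1" "?U2 *v ?e 2 = ?e 2"
    using R2 f1 e by (simp_all add: matrix_vector_mul_assoc[symmetric])
  obtain R3 where R3: "spin_unitary R3" "R3 *v (?U2 *v ?e 3) = ?e 3"
    "\<And>z. hdot (?U2 *v ?e 3) z = 0 \<Longrightarrow> hdot (?e 3) z = 0 \<Longrightarrow> R3 *v z = z"
    using spin_unitary_transitive[of "?U2 *v ?e 3" "?e 3"] norm_cunitary[OF U2] ne by metis
  let ?U3 = "R3 ** ?U2"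
  have "hdot (?U2 *v ?e 3) (?e 1) = 0" "hdot (?U2 *v ?e 3) (?e 2) = 0"
    using hdot_cunitary[OF U2, of "?e 3" "?e 1"] hdot_cunitary[OF U2, of "?e 3" "?e 2"] f2 e by simp_all
  then have "?U3 *v ?e 1 = ?e 1" "?U3 *v ?e 2 = ?e 2" "?U3 *v ?e 3 = ?e 3"
    using R3 f2 e by (simp_all add: matrix_vector_mul_assoc[symmetric])
  then have "?U3 *v ?e k = mat 1 *v ?e k" for k
    using exhaust_3[of k] by auto
  then have "?U3 = mat 1" by (rule matrix_eq_axisI)
  define V where "V = R3 ** R2 ** R1"
  have VU: "V ** U = mat 1" using \<open>?U3 = mat 1\<close> by (simp add: V_def matrix_mul_assoc)
  have "spin_unitary V" unfolding V_def by (intro spin_unitary_mult R1 R2 R3)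
  \<comment> \<open>The operator of \<open>U\<close> is a right inverse of that of \<open>V\<close>,
    hence equal to the inverse \<open>h\<close> in Spin(9).\<close>
  then obtain h where h: "h \<in> carrier Spin9" "h o\<^sub>L sm_op (cnj (det V)) V (mat 1) = id_blinfun"
    unfolding spin_unitary_def using Spin9_inverse by blast
  have "cnj (det V) * cnj (det U) = 1"
    using VU by (metis complex_cnj_mult complex_cnj_one det_I det_mul)
  then have "sm_op (cnj (det V)) V (mat 1) o\<^sub>L sm_op (cnj (det U)) U (mat 1) = id_blinfun"
    using VU by (simp add: sm_op_mult sm_op_one)
  then have "h = (h o\<^sub>L sm_op (cnj (det V)) V (mat 1)) o\<^sub>L sm_op (cnj (det U)) U (mat 1)"
    by (simp add: blinfun_compose_assoc)
  then have "h = sm_op (cnj (det U)) U (mat 1)" by (simp add: h(2))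
  then show ?thesis using h(1) by (simp add: spin_unitary_def)
qed

lemma SU2_entries:
  fixes B :: "complex^2^2"
  assumes "cunitary B" "det B = 1"
  shows "B$2$2 = cnj (B$1$1)" "B$2$1 = - cnj (B$1$2)" "(cmod (B$1$1))\<^sup>2 + (cmod (B$1$2))\<^sup>2 = 1"
proof -
  have d: "B$1$1 * B$2$2 - B$1$2 * B$2$1 = 1" using assms(2) by (simp add: det_2)
  have u: "(B ** cadjoint B) $ i $ j = mat 1 $ i $ j" for i j using assms(1) by (simp add: cunitary_def)
  have 1: "B$1$1 * cnj (B$1$1) + B$1$2 * cnj (B$1$2) = 1"
    "B$1$1 * cnj (B$2$1) + B$1$2 * cnj (B$2$2) = 0"
    "B$2$1 * cnj (B$1$1) + B$2$2 * cnj (B$1$2) = 0"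
    using u[of 1 1] u[of 1 2] u[of 2 1] by (simp_all add: matrix_mul_2 cadjoint_def)
  have "B$2$2 = B$2$2 * (B$1$1 * cnj (B$1$1) + B$1$2 * cnj (B$1$2))" by (simp add: 1)
  also have "\<dots> = cnj (B$1$1) * (B$1$1 * B$2$2 - B$1$2 * B$2$1)
      + B$1$2 * (B$2$1 * cnj (B$1$1) + B$2$2 * cnj (B$1$2))" by (simp add: algebra_simps)
  finally show "B$2$2 = cnj (B$1$1)" by (simp add: 1 d)
  have "B$2$1 = B$2$1 * (B$1$1 * cnj (B$1$1) + B$1$2 * cnj (B$1$2))" by (simp add: 1)
  also have "\<dots> = - cnj (B$1$2) * (B$1$1 * B$2$2 - B$1$2 * B$2$1)
      + B$1$1 * (B$2$1 * cnj (B$1$1) + B$2$2 * cnj (B$1$2))" by (simp add: algebra_simps)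
  finally show "B$2$1 = - cnj (B$1$2)" by (simp add: 1 d)
  have "of_real ((cmod (B$1$1))\<^sup>2 + (cmod (B$1$2))\<^sup>2) = (1 :: complex)"
    by (simp add: 1(1)[symmetric] complex_norm_square del: of_real_power)
  then show "(cmod (B$1$1))\<^sup>2 + (cmod (B$1$2))\<^sup>2 = 1" by (simp only: of_real_eq_1_iff)
qed

lemma norm_octo_of_complex: "norm (octo_of c 0) = cmod c"
  using norm_octo[of "octo_of c 0"] by simp

text \<open>B = D E, where D is diagonal with entries \<open>\<mu>\<close> and
  \<open>cnj \<mu>\<close>, and E is the element of SU(2) with nonnegative upper left entry. Each
  factor is a product of two unit vectors of \<real> \<oplus> \<complex>.\<close>

lemma spin_SU2:
  assumes "cunitary B" "det B = 1"
  shows "sm_op 1 (mat 1) B \<in> carrier Spin9"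
proof -
  note B = SU2_entries[OF assms]
  define \<mu> where "\<mu> = cis (Arg (B$1$1))"
  have \<mu>: "of_real (cmod (B$1$1)) * \<mu> = B$1$1" "\<mu> * cnj \<mu> = 1" "cmod \<mu> = 1"
    by (simp_all add: \<mu>_def rcis_cmod_Arg[unfolded rcis_def] cis_cnj cis_mult)
  let ?s = "cmod (B$1$1)" and ?y = "cnj \<mu> * B$1$2"
  let ?D = "hvec 0 1 ** hvec 0 (cnj \<mu>)" and ?E = "hvec 1 0 ** hvec ?s ?y"
  have "spinX 0 (octo_of 1 0) o\<^sub>L spinX 0 (octo_of (cnj \<mu>) 0) \<in> carrier Spin9"
    using \<mu> by (intro Spin9_pair) (simp_all add: norm_octo_of_complex)
  then have D: "sm_op 1 (mat 1) ?D \<in> carrier Spin9" by (simp add: spinX_complex sm_op_mult)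
  have "spinX 1 (octo_of 0 0) o\<^sub>L spinX ?s (octo_of ?y 0) \<in> carrier Spin9"
    using \<mu> B(3) by (intro Spin9_pair) (simp_all add: norm_octo_of_complex norm_mult)
  then have E: "sm_op 1 (mat 1) ?E \<in> carrier Spin9"
    by (simp add: spinX_complex sm_op_mult del: octo_of_0)
  have "\<mu> * ?y = B$1$2" using \<mu>(2) by (simp add: mult.assoc[symmetric])
  moreover have "cnj \<mu> * cnj ?y = cnj (B$1$2)" by (metis calculation complex_cnj_mult)
  moreover have "cnj \<mu> * ?s = cnj (B$1$1)"
    by (metis \<mu>(1) complex_cnj_complex_of_real complex_cnj_mult mult.commute)
  ultimately have "?D ** ?E = B"
    using \<mu>(1) by (simp add: vec_eq_iff forall_2 matrix_mul_2 hvec_def B mult.commute)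
  then show ?thesis using Spin9_mult[OF D E] by (simp add: sm_op_mult)
qed

lemma sm_op_in_Spin9:
  assumes "cunitary U" "cunitary B" "det B = 1"
  shows "sm_op (cnj (det U)) U B \<in> carrier Spin9"
  using Spin9_mult[OF _ spin_SU2[OF assms(2,3)]] spin_unitary_if_cunitary[OF assms(1)]
  by (fastforce simp: spin_unitary_def sm_op_mult)


section \<open>Spin(9) operators commuting with the complex structure\<close>

lemma hvec_nth [simp]:
  "hvec s c $ 1 $ 1 = of_real s" "hvec s c $ 1 $ 2 = c"
  "hvec s c $ 2 $ 1 = cnj c" "hvec s c $ 2 $ 2 = - of_real s"
  by (simp_all add: hvec_def)

abbreviation "J0 \<equiv> J_R (octo_of \<i> 0)"

text \<open>\<open>P0\<close> is \<open>L\<^sub>i\<close> on both components.\<close>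

abbreviation "P0 \<equiv> sm_op 1 (mat 1) (mat \<i>)"

abbreviation "cX s c \<equiv> sm_op 1 (mat 1) (hvec s c)"

section \<open>Clifford operators commuting with right multiplication by i\<close>

lemma mat_mult_mat: "mat c ** (mat d :: complex^'n^'n) = mat (c * d)"
  by (simp add: matrix_eq matrix_vector_mul_assoc[symmetric] mat_vector_mul)

lemma mat_uminus: "mat (- c) = - (mat c :: complex^'n^'n)"
  by (simp add: mat_def vec_eq_iff)

lemma P0_commute: "P0 o\<^sub>L sm_op w U B = sm_op w U B o\<^sub>L P0"
  by (simp add: sm_op_mult matrix_mul_mat[of B])

text \<open>Commutation means y (b i) = (y b) i for all b; taking for b the three axes of
  \<open>complex^3\<close> annihilates the \<open>complex^3\<close> part of y.\<close>

lemma spinX_commute_J0: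
  assumes "spinX s y o\<^sub>L J0 = J0 o\<^sub>L spinX s y"
  shows "spinX s y = cX s (cpart y)"
proof -
  have *: "y *\<^sub>O (b *\<^sub>O octo_of \<i> 0) = (y *\<^sub>O b) *\<^sub>O octo_of \<i> 0" for b
    using arg_cong[OF assms, of "\<lambda>f. fst (blinfun_apply f (0, b))"]
    by (simp add: spinX_apply J_R_apply omult.zero_left)
  obtain a p where y: "y = octo_of a p" by (metis octo_of_parts)
  have "vpart (y *\<^sub>O (octo_of 0 (axis k 1) *\<^sub>O octo_of \<i> 0))
     = vpart ((y *\<^sub>O octo_of 0 (axis k 1)) *\<^sub>O octo_of \<i> 0)" for k
    by (simp only: *)
  from this[of 1] this[of 2] this[of 3] have "vpart y = 0"
    by (simp add: y cross_cnj_def axis_def vec_eq_iff forall_3)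
  then have "y = octo_of (cpart y) 0" by (simp add: octo_eq_iff)
  then show ?thesis by (metis spinX_complex)
qed

lemma cX_J0: "cX s c o\<^sub>L J0 = J0 o\<^sub>L cX s c"
  by (rule sm_op_J_R_commute)

lemma Spin9_commutant_inverse:
  assumes "g \<in> Spin9_commutant J"
  obtains h where "h \<in> Spin9_commutant J" "h o\<^sub>L g = id_blinfun" "g o\<^sub>L h = id_blinfun"
proof -
  have "inv\<^bsub>Spin9\<^esub> g \<in> Spin9_commutant J" "g \<in> carrier Spin9"
    using subgroup.m_inv_closed[OF subgroup_Spin9_commutant assms]
      subgroup.mem_carrier[OF subgroup_Spin9_commutant assms] by auto
  then show thesis
    using group.l_inv[OF group_Spin9, of g] group.r_inv[OF group_Spin9, of g] that by simp
qed

text \<open>The conjugate by g is a Clifford operator by \<open>Spin9_conj_spinX\<close>. It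
  commutes with \<open>J0\<close> since all factors do, so its vector lies in \<real> \<oplus>
  \<complex> again.\<close>

lemma commutant_cX:
  assumes g: "g \<in> Spin9_commutant J0"
  shows "\<exists>s' c'. g o\<^sub>L cX s c = cX s' c' o\<^sub>L g"
proof -
  obtain h where h: "h \<in> Spin9_commutant J0" "h o\<^sub>L g = id_blinfun" "g o\<^sub>L h = id_blinfun"
    by (rule Spin9_commutant_inverse[OF g])
  have gJ: "g o\<^sub>L J0 = J0 o\<^sub>L g" and hJ: "h o\<^sub>L J0 = J0 o\<^sub>L h" and gS: "g \<in> carrier Spin9"
    using g h by (auto simp: Spin9_commutant_def)
  obtain t y where ty: "g o\<^sub>L cX s c = spinX t y o\<^sub>L g"
    using Spin9_conj_spinX[OF gS, of s "octo_of c 0"] by (auto simp: spinX_complex)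
  have X: "spinX t y = g o\<^sub>L (cX s c o\<^sub>L h)"
    by (simp add: blinfun_compose_assoc[symmetric] ty) (simp add: blinfun_compose_assoc h)
  have "spinX t y o\<^sub>L J0 = g o\<^sub>L (cX s c o\<^sub>L (h o\<^sub>L J0))" by (simp add: X blinfun_compose_assoc)
  also have "\<dots> = g o\<^sub>L (cX s c o\<^sub>L J0 o\<^sub>L h)" by (simp only: hJ blinfun_compose_assoc)
  also have "\<dots> = (g o\<^sub>L J0) o\<^sub>L (cX s c o\<^sub>L h)" by (simp only: cX_J0 blinfun_compose_assoc)
  also have "\<dots> = J0 o\<^sub>L spinX t y" by (simp only: gJ X blinfun_compose_assoc)
  finally have "spinX t y = cX t (cpart y)" by (rule spinX_commute_J0)
  then show ?thesis using ty by auto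
qed

lemma sm_op_one_inj:
  assumes "sm_op 1 (mat 1) B = sm_op 1 (mat 1) B'"
  shows "B = B'"
proof -
  have "blinfun_apply (sm_op 1 (mat 1) B) v = blinfun_apply (sm_op 1 (mat 1) B') v" for v
    by (simp add: assms)
  from this[of "(octo_of 1 0, 0)"] this[of "(0, octo_of 1 0)"] show ?thesis
    by (simp add: sm_op_apply octo_eq_iff vec_eq_iff forall_2)
qed

lemma sm_op_uminus: "sm_op w U (- B) = - sm_op w U B"
  by (rule spinor_op_eqI) (simp add: sm_op_apply octo_eq_iff blinfun.minus_left
      vec.add vec.neg algebra_simps)

text \<open>Up to sign \<open>P0\<close> is the product of the Clifford operators of an orthonormal
  basis of \<real> \<oplus> \<complex>, so its conjugate by g is given by a matrix \<open>Q\<close>.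
  This matrix is shown to be scalar with square -1.\<close>

lemma commutant_P0_cases:
  assumes g: "g \<in> Spin9_commutant J0"
  shows "g o\<^sub>L P0 = P0 o\<^sub>L g \<or> g o\<^sub>L P0 = (- P0) o\<^sub>L g"
proof -
  obtain h where h: "h \<in> Spin9_commutant J0" "h o\<^sub>L g = id_blinfun" "g o\<^sub>L h = id_blinfun"
    by (rule Spin9_commutant_inverse[OF g])
  have hg: "h o\<^sub>L (g o\<^sub>L f) = f" "g o\<^sub>L (h o\<^sub>L f) = f" for f
    by (simp_all add: blinfun_compose_assoc[symmetric] h)
  have "mat \<i> = - (hvec 1 0 ** (hvec 0 1 ** hvec 0 \<i>))"
    by (simp add: vec_eq_iff forall_2 matrix_mul_2)
  then have P: "P0 = - (cX 1 0 o\<^sub>L (cX 0 1 o\<^sub>L cX 0 \<i>))"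
    by (simp add: sm_op_mult sm_op_uminus)
  obtain s1 c1 s2 c2 s3 c3 where
    X: "g o\<^sub>L cX 1 0 = cX s1 c1 o\<^sub>L g" "g o\<^sub>L cX 0 1 = cX s2 c2 o\<^sub>L g" "g o\<^sub>L cX 0 \<i> = cX s3 c3 o\<^sub>L g"
    using commutant_cX[OF g] by meson
  define Q where "Q = - (hvec s1 c1 ** (hvec s2 c2 ** hvec s3 c3))"
  let ?Q = "sm_op 1 (mat 1) Q"
  have "g o\<^sub>L P0 = - ((g o\<^sub>L cX 1 0) o\<^sub>L (cX 0 1 o\<^sub>L cX 0 \<i>))"
    by (simp only: P comp.minus_right blinfun_compose_assoc)
  also have "\<dots> = - (cX s1 c1 o\<^sub>L ((g o\<^sub>L cX 0 1) o\<^sub>L cX 0 \<i>))"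
    by (simp only: X(1)) (simp only: blinfun_compose_assoc)
  also have "\<dots> = - (cX s1 c1 o\<^sub>L (cX s2 c2 o\<^sub>L (g o\<^sub>L cX 0 \<i>)))"
    by (simp only: X(2)) (simp only: blinfun_compose_assoc)
  also have "\<dots> = - ((cX s1 c1 o\<^sub>L (cX s2 c2 o\<^sub>L cX s3 c3)) o\<^sub>L g)"
    by (simp only: X blinfun_compose_assoc)
  also have "\<dots> = ?Q o\<^sub>L g"
    by (simp add: Q_def sm_op_mult sm_op_uminus comp.minus_left)
  finally have gP: "g o\<^sub>L P0 = ?Q o\<^sub>L g" .
  then have Q: "?Q = g o\<^sub>L (P0 o\<^sub>L h)"
    by (simp add: blinfun_compose_assoc[symmetric]) (simp add: blinfun_compose_assoc h)
  \<comment> \<open>\<open>P0\<close> commutes with every \<open>cX s' c'\<close>, and conjugation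
    by g permutes these operators, so the conjugate of \<open>P0\<close> commutes with all of
    them.\<close>
  have Qc: "Q ** hvec s c = hvec s c ** Q" for s c
  proof -
    obtain s' c' where X': "h o\<^sub>L cX s c = cX s' c' o\<^sub>L h" using commutant_cX[OF h(1)] by blast
    have "cX s c o\<^sub>L g = g o\<^sub>L ((h o\<^sub>L cX s c) o\<^sub>L g)" by (simp add: blinfun_compose_assoc hg)
    also have "\<dots> = g o\<^sub>L cX s' c'" by (simp add: X' blinfun_compose_assoc h)
    finally have X'': "cX s c o\<^sub>L g = g o\<^sub>L cX s' c'" .
    have "?Q o\<^sub>L cX s c = g o\<^sub>L (P0 o\<^sub>L (h o\<^sub>L cX s c))" by (simp only: Q blinfun_compose_assoc)
    also have "\<dots> = g o\<^sub>L ((P0 o\<^sub>L cX s' c') o\<^sub>L h)" by (simp only: X' blinfun_compose_assoc)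
    also have "\<dots> = (g o\<^sub>L cX s' c') o\<^sub>L (P0 o\<^sub>L h)"
      by (simp only: P0_commute) (simp only: blinfun_compose_assoc)
    also have "\<dots> = cX s c o\<^sub>L ?Q" by (simp only: X''[symmetric]) (simp only: Q blinfun_compose_assoc)
    finally show ?thesis by (intro sm_op_one_inj) (simp add: sm_op_mult)
  qed
  have "Q $ 1 $ 2 = 0" "Q $ 2 $ 1 = 0"
    using arg_cong[OF Qc[of 1 0], of "\<lambda>A. A $ 1 $ 2"] arg_cong[OF Qc[of 1 0], of "\<lambda>A. A $ 2 $ 1"]
    by (simp_all add: matrix_mul_2 complex_eq_iff)
  moreover have "Q $ 1 $ 1 = Q $ 2 $ 2"
    using arg_cong[OF Qc[of 0 1], of "\<lambda>A. A $ 1 $ 2"] by (simp add: matrix_mul_2)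
  ultimately have Qm: "Q = mat (Q $ 1 $ 1)" by (simp add: vec_eq_iff forall_2)
  have "?Q o\<^sub>L ?Q = g o\<^sub>L ((P0 o\<^sub>L P0) o\<^sub>L h)" by (simp only: Q blinfun_compose_assoc hg)
  also have "P0 o\<^sub>L P0 = - id_blinfun"
    using sm_op_uminus[of 1 "mat 1" "mat 1"] by (simp add: sm_op_mult mat_mult_mat sm_op_one mat_uminus)
  also have "g o\<^sub>L ((- id_blinfun) o\<^sub>L h) = sm_op 1 (mat 1) (mat (- 1))"
    by (simp add: comp.minus_left comp.minus_right h mat_uminus sm_op_uminus sm_op_one)
  finally have "Q ** Q = mat (- 1)" by (intro sm_op_one_inj) (simp add: sm_op_mult)
  then have "mat (Q $ 1 $ 1 * Q $ 1 $ 1) = (mat (- 1) :: complex^2^2)"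
    using Qm mat_mult_mat by metis
  then have "(Q $ 1 $ 1)\<^sup>2 = \<i>\<^sup>2"
    by (metis mat_2(1) i_squared power2_eq_square power2_i)
  then have "Q $ 1 $ 1 = \<i> \<or> Q $ 1 $ 1 = - \<i>" by (simp only: power2_eq_iff)
  then have "?Q = P0 \<or> ?Q = - P0" using Qm by (metis mat_uminus sm_op_uminus)
  then show ?thesis using gP by auto
qed

section \<open>Complex linearity of the commutant\<close>

lemma P0_apply: "blinfun_apply P0 (x, y) = (cscale \<i> x, cscale \<i> y)"
  by (simp add: sm_op_apply octo_eq_iff)

lemma P0_J0_apply: "blinfun_apply P0 (blinfun_apply J0 (x, y)) =
    (octo_of (- cpart x) (vpart x), octo_of (- cpart y) (vpart y))"
  by (simp add: P0_apply J_R_apply omult_complex_right octo_eq_iff) (simp add: algebra_simps)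

lemma norm_octo_of: "(norm (octo_of a p))\<^sup>2 = (cmod a)\<^sup>2 + (norm p)\<^sup>2"
  by (simp add: norm_octo)

text \<open>If g anticommuted with \<open>P0\<close>, it would map the +1 eigenspace of
  \<open>P0 J0\<close> into the -1 eigenspace. The part \<open>complex^3\<close> of the first
  component, of real dimension 6, would embed into \<complex> \<times> \<complex>, of real dimension
  4.\<close>

lemma commutant_P0:
  assumes g: "g \<in> Spin9_commutant J0"
  shows "g o\<^sub>L P0 = P0 o\<^sub>L g"
proof (rule ccontr)
  assume "g o\<^sub>L P0 \<noteq> P0 o\<^sub>L g"
  then have gP: "g o\<^sub>L P0 = (- P0) o\<^sub>L g" using commutant_P0_cases[OF g] by blast
  have gJ: "g o\<^sub>L J0 = J0 o\<^sub>L g" and gS: "g \<in> carrier Spin9" using g by (auto simp: Spin9_commutant_def)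
  have gPJ: "blinfun_apply g (blinfun_apply P0 (blinfun_apply J0 v)) =
      - blinfun_apply P0 (blinfun_apply J0 (blinfun_apply g v))" for v
    using arg_cong[OF gP, of "\<lambda>f. blinfun_apply f (blinfun_apply J0 v)"]
      arg_cong[OF gJ, of "\<lambda>f. blinfun_apply f v"] by (simp add: blinfun.minus_left)
  let ?x = "\<lambda>p. (octo_of 0 p, 0 :: octo)"
  define f where "f p = (cpart (fst (blinfun_apply g (?x p))), cpart (snd (blinfun_apply g (?x p))))" for p
  have x: "?x (p + q) = ?x p + ?x q" "?x (r *\<^sub>R p) = r *\<^sub>R ?x p" for p q r
    by (simp_all add: octo_eq_iff)
  have lin: "linear f"
    by (rule linearI; simp only: f_def x blinfun.add_right blinfun.scaleR_right; simp)
  have "p = 0" if "f p = 0" for p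
  proof -
    obtain y z where yz: "blinfun_apply g (?x p) = (y, z)" by (metis surj_pair)
    have "blinfun_apply P0 (blinfun_apply J0 (?x p)) = ?x p"
      by (simp add: P0_J0_apply octo_eq_iff)
    then have "(y, z) = - blinfun_apply P0 (blinfun_apply J0 (y, z))"
      using gPJ[of "?x p"] yz by simp
    then have "vpart y = - vpart y" "vpart z = - vpart z"
      by (simp_all add: P0_J0_apply octo_eq_iff)
    then have "vpart y = 0" "vpart z = 0" by (simp_all add: vec_eq_iff)
    moreover have "fst (f p) = 0" "snd (f p) = 0" by (simp_all add: that)
    then have "cpart y = 0" "cpart z = 0" by (simp_all add: f_def yz)
    ultimately have "y = 0" "z = 0" by (simp_all add: octo_eq_iff)
    then have "norm (?x p) = 0" using norm_Spin9[OF gS, of "?x p"] yz by simp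
    then show "p = 0" by (simp add: octo_eq_iff)
  qed
  then have "inj f" using lin by (simp add: linear_injective_0)
  then have "dim (f ` UNIV) = dim (UNIV :: (complex^3) set)"
    using lin by (intro dim_image_eq) auto
  moreover have "dim (f ` UNIV) \<le> dim (UNIV :: (complex \<times> complex) set)" by (intro dim_subset) auto
  ultimately show False by (simp add: dim_UNIV)
qed

lemma commutant_cscale:
  assumes g: "g \<in> Spin9_commutant J0"
  shows "blinfun_apply g (cscale c x, cscale c y) =
    map_prod (cscale c) (cscale c) (blinfun_apply g (x, y))"
proof -
  have *: "(cscale c x, cscale c y) = Re c *\<^sub>R (x, y) + Im c *\<^sub>R blinfun_apply P0 (x, y)" for x y
    by (simp add: P0_apply octo_eq_iff scaleR_eq_scalar_mult vec_eq_iff)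
      (simp add: complex_eq_iff algebra_simps)
  have "blinfun_apply g (blinfun_apply P0 v) = blinfun_apply P0 (blinfun_apply g v)" for v
    using arg_cong[OF commutant_P0[OF g], of "\<lambda>f. blinfun_apply f v"] by simp
  then have "blinfun_apply g (cscale c x, cscale c y) =
      Re c *\<^sub>R blinfun_apply g (x, y) + Im c *\<^sub>R blinfun_apply P0 (blinfun_apply g (x, y))"
    by (simp only: *[of x y] blinfun.add_right blinfun.scaleR_right)
  then show ?thesis
    using *[of "fst (blinfun_apply g (x, y))" "snd (blinfun_apply g (x, y))"]
    by (simp add: map_prod_def split_beta)
qed

text \<open>The lepton space is the \<open>-1\<close>-eigenspace of \<open>P0 J0\<close>, the quark space is its
  \<open>+1\<close>-eigenspace.\<close>

lemma commutant_PJ: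
  assumes g: "g \<in> Spin9_commutant J0" and yz: "blinfun_apply g (x1, x2) = (y, z)"
  shows "vpart x1 = 0 \<Longrightarrow> vpart x2 = 0 \<Longrightarrow> vpart y = 0 \<and> vpart z = 0"
    and "cpart x1 = 0 \<Longrightarrow> cpart x2 = 0 \<Longrightarrow> cpart y = 0 \<and> cpart z = 0"
proof -
  have gJ: "g o\<^sub>L J0 = J0 o\<^sub>L g" using g by (auto simp: Spin9_commutant_def)
  have gPJ: "blinfun_apply g (blinfun_apply P0 (blinfun_apply J0 (x1, x2))) =
      blinfun_apply P0 (blinfun_apply J0 (y, z))"
    using arg_cong[OF commutant_P0[OF g], of "\<lambda>f. blinfun_apply f (blinfun_apply J0 (x1, x2))"]
      arg_cong[OF gJ, of "\<lambda>f. blinfun_apply f (x1, x2)"] yz by simp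
  {
    assume "vpart x1 = 0" "vpart x2 = 0"
    then have "blinfun_apply P0 (blinfun_apply J0 (x1, x2)) = - (x1, x2)"
      by (simp add: P0_J0_apply octo_eq_iff)
    then have "- (y, z) = blinfun_apply P0 (blinfun_apply J0 (y, z))"
      using gPJ yz by (simp add: blinfun.minus_right del: uminus_Pair)
    then have "vpart y = - vpart y" "vpart z = - vpart z"
      by (simp_all add: P0_J0_apply octo_eq_iff)
    then show "vpart y = 0 \<and> vpart z = 0" by (simp add: vec_eq_iff)
  next
    assume "cpart x1 = 0" "cpart x2 = 0"
    then have "blinfun_apply P0 (blinfun_apply J0 (x1, x2)) = (x1, x2)"
      by (simp add: P0_J0_apply octo_eq_iff)
    then have "(y, z) = blinfun_apply P0 (blinfun_apply J0 (y, z))"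
      using gPJ yz by simp
    then have "cpart y = - cpart y" "cpart z = - cpart z"
      by (simp_all add: P0_J0_apply octo_eq_iff)
    then show "cpart y = 0 \<and> cpart z = 0" by simp
  }
qed

section \<open>Block form of the commutant\<close>

lemma norm_spinor: "(norm (x, y :: octo))\<^sup>2 = (norm (x :: octo))\<^sup>2 + (norm y)\<^sup>2"
  by (simp add: norm_prod_def)

text \<open>By \<open>commutant_PJ\<close> the lepton space is invariant, and g is complex linear on
  it, so the images of its two basis vectors determine the matrix.\<close>

lemma commutant_lepton:
  assumes g: "g \<in> Spin9_commutant J0"
  obtains M :: "complex^2^2" where "cunitary M" "\<And>a b. blinfun_apply g (octo_of a 0, octo_of b 0) =
    (octo_of (M$1$1 * a + M$1$2 * b) 0, octo_of (M$2$1 * a + M$2$2 * b) 0)"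
proof -
  let ?e1 = "blinfun_apply g (octo_of 1 0, 0)" and ?e2 = "blinfun_apply g (0, octo_of 1 0)"
  define M :: "complex^2^2" where "M = vector [vector [cpart (fst ?e1), cpart (fst ?e2)],
    vector [cpart (snd ?e1), cpart (snd ?e2)]]"
  have M: "M$1$1 = cpart (fst ?e1)" "M$1$2 = cpart (fst ?e2)"
     "M$2$1 = cpart (snd ?e1)" "M$2$2 = cpart (snd ?e2)"
    by (simp_all add: M_def)
  have lep: "blinfun_apply g (octo_of a 0, octo_of b 0) =
    (octo_of (M$1$1 * a + M$1$2 * b) 0, octo_of (M$2$1 * a + M$2$2 * b) 0)" for a b
  proof -
    have "vpart (fst ?e1) = 0" "vpart (snd ?e1) = 0" "vpart (fst ?e2) = 0" "vpart (snd ?e2) = 0"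
      using commutant_PJ(1)[OF g, of "octo_of 1 0" 0 "fst ?e1" "snd ?e1"]
        commutant_PJ(1)[OF g, of 0 "octo_of 1 0" "fst ?e2" "snd ?e2"] by auto
    moreover have "(octo_of a 0, octo_of b 0) = (cscale a (octo_of 1 0), cscale a 0) +
        (cscale b 0, cscale b (octo_of 1 0))"
      by (simp add: octo_eq_iff)
    then have "blinfun_apply g (octo_of a 0, octo_of b 0) =
        map_prod (cscale a) (cscale a) ?e1 + map_prod (cscale b) (cscale b) ?e2"
      by (simp only: blinfun.add_right commutant_cscale[OF g])
    ultimately show ?thesis
      by (simp add: M map_prod_def split_beta octo_eq_iff prod_eq_iff mult.commute)
  qed
  have "cunitary M"
  proof (rule cunitaryI)
    fix p :: "complex^2"
    have n: "(norm p)\<^sup>2 = (cmod (p$1))\<^sup>2 + (cmod (p$2))\<^sup>2" for p :: "complex^2"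
      by (simp add: norm_vec_def L2_set_def sum_2)
    have "(norm (M *v p))\<^sup>2 = (norm (blinfun_apply g (octo_of (p$1) 0, octo_of (p$2) 0)))\<^sup>2"
      unfolding lep n by (simp add: norm_spinor norm_octo_of matrix_vector_mult_def sum_2)
    also have "\<dots> = (norm p)\<^sup>2"
      using g norm_Spin9 unfolding Spin9_commutant_def
      by (simp add: norm_spinor norm_octo_of n)
    finally show "norm (M *v p) = norm p" by simp
  qed
  then show thesis using that lep by blast
qed

text \<open>The determinant as the triple product of the columns.\<close>

lemma cross_cnj_det:
  "(\<Sum>k\<in>UNIV. cnj (cross_cnj (U *v axis 1 1) (U *v axis 2 1) $ k) * (U *v axis 3 1) $ k) = det U"
  unfolding sum_3 matrix_vector_axis
  by (simp add: cross_cnj_def matrix_vector_axis det_3 algebra_simps)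

text \<open>Once the lepton block is scalar, the operator commutes with the Clifford operators of
  \<open>\<real> \<oplus> \<complex>\<close> and hence acts by the same matrix on both components; compatibility with
  the remaining Clifford operators fixes the determinant.\<close>

lemma commutant_scalar_lepton:
  assumes h: "h \<in> Spin9_commutant J0"
    and lep: "\<And>a b. blinfun_apply h (octo_of a 0, octo_of b 0) = (octo_of (w * a) 0, octo_of (w * b) 0)"
  obtains U where "cunitary U" "w = cnj (det U)" "h = sm_op w U (mat 1)"
proof -
  have hS: "h \<in> carrier Spin9" using h by (simp add: Spin9_commutant_def)
  have "norm (octo_of w 0, 0 :: octo) = norm (octo_of 1 0, 0 :: octo)"
    using norm_Spin9[OF hS, of "(octo_of 1 0, octo_of 0 0)"] unfolding lep by simp
  then have w: "cmod w = 1" by (simp add: norm_Pair norm_octo_of_complex)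
  then have w0: "w \<noteq> 0" by auto
  have cXa: "blinfun_apply (cX s c) (x, y) =
      (cscale (of_real s) x + cscale c y, cscale (cnj c) x - cscale (of_real s) y)" for s c x y
    by (simp add: sm_op_apply octo_eq_iff vec_eq_iff)
  have hX: "blinfun_apply h (blinfun_apply (cX s c) v) = blinfun_apply (cX s c) (blinfun_apply h v)" for s c v
  proof -
    obtain s' c' where X: "h o\<^sub>L cX s c = cX s' c' o\<^sub>L h" using commutant_cX[OF h] by blast
    have c: "cscale d (octo_of a 0) = octo_of (d * a) 0" "cscale d 0 = 0"
       "octo_of a 0 + octo_of b 0 = octo_of (a + b) 0" "octo_of a 0 - octo_of b 0 = octo_of (a - b) 0" for a b d
      by (simp_all add: octo_eq_iff)
    have "blinfun_apply h (blinfun_apply (cX s c) (octo_of 1 0, octo_of 0 0)) =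
        blinfun_apply (cX s' c') (blinfun_apply h (octo_of 1 0, octo_of 0 0))"
      using arg_cong[OF X, of "\<lambda>f. blinfun_apply f (octo_of 1 0, octo_of 0 0)"] by simp
    \<comment> \<open>On a lepton vector h is the nonzero scalar w, which already determines the
      conjugated vector (s', c').\<close>
    then have "w * of_real s = of_real s' * w" "w * cnj c = cnj c' * w"
      unfolding cXa lep c by (simp_all add: octo_eq_iff)
    then have "s' = s" "c' = c" using w0 by auto
    then show ?thesis using arg_cong[OF X, of "\<lambda>f. blinfun_apply f v"] by simp
  qed
  define h1 where "h1 x = fst (blinfun_apply h (x, 0))" for x
  have c1: "cscale 1 x = x" "cscale 0 x = 0" for x by (simp_all add: octo_eq_iff)
  have hx: "blinfun_apply h (x, 0) = (h1 x, 0)" for x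
  proof -
    obtain y z where yz: "blinfun_apply h (x, 0) = (y, z)" by (metis surj_pair)
    \<comment> \<open>\<open>cX 1 0\<close> is +1 on the first component and -1 on the second;
      \<open>cX 0 1\<close> below exchanges the components.\<close>
    have "blinfun_apply h (x, 0) = blinfun_apply (cX 1 0) (blinfun_apply h (x, 0))"
      using hX[of 1 0 "(x, 0)"] by (simp add: cXa c1)
    then have "z = - z" by (simp add: yz cXa c1)
    then have "z = 0" by (simp add: octo_eq_iff vec_eq_iff)
    then show ?thesis by (simp add: h1_def yz)
  qed
  have hy: "blinfun_apply h (0, y) = (0, h1 y)" for y
    using hX[of 0 1 "(y, 0)"] by (simp add: cXa c1 hx)
  have h12: "blinfun_apply h (x, y) = (h1 x, h1 y)" for x y
    using blinfun.add_right[of h "(x, 0)" "(0, y)"] by (simp add: hx hy)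
  have h1_add: "h1 (x + y) = h1 x + h1 y" for x y
    using blinfun.add_right[of h "(x, 0)" "(y, 0)"] by (simp add: h12)
  have h1_c: "h1 (cscale c x) = cscale c (h1 x)" for c x
    using commutant_cscale[OF h, of c x 0] by (simp add: h12)
  have h1_lep: "h1 (octo_of a 0) = octo_of (w * a) 0" for a
    using lep[of a 0] by (simp add: h12 del: octo_of_0)
  then have h10: "h1 0 = 0" by (metis mult_zero_right octo_of_0)
  have h1_quark: "cpart (h1 (octo_of 0 p)) = 0" for p
    using commutant_PJ(2)[OF h h12[of "octo_of 0 p" "octo_of 0 p"]] by simp
  define U :: "complex^3^3" where "U = (\<chi> j k. vpart (h1 (octo_of 0 (axis k 1))) $ j)"
  have h1_axis: "h1 (octo_of 0 (axis k 1)) = octo_of 0 (U *v axis k 1)" for k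
    by (simp add: octo_eq_iff h1_quark vec_eq_iff matrix_vector_axis) (simp add: U_def)
  have h1_v: "h1 (octo_of 0 p) = octo_of 0 (U *v p)" for p
  proof -
    have p: "p = p$1 *s axis 1 1 + p$2 *s axis 2 1 + p$3 *s axis 3 1"
      by (simp add: vec_eq_iff forall_3 axis_def)
    have "octo_of 0 p = cscale (p$1) (octo_of 0 (axis 1 1)) + cscale (p$2) (octo_of 0 (axis 2 1))
        + cscale (p$3) (octo_of 0 (axis 3 1))"
      using p by (simp add: octo_eq_iff)
    then have "h1 (octo_of 0 p) = octo_of 0 (p$1 *s (U *v axis 1 1) + p$2 *s (U *v axis 2 1) + p$3 *s (U *v axis 3 1))"
      by (simp only: h1_add h1_c h1_axis) (simp add: octo_eq_iff)
    also have "p$1 *s (U *v axis 1 1) + p$2 *s (U *v axis 2 1) + p$3 *s (U *v axis 3 1) =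
        U *v (p$1 *s axis 1 1 + p$2 *s axis 2 1 + p$3 *s axis 3 1)"
      by (simp only: vec.add vec.scale)
    also have "\<dots> = U *v p" by (simp only: p[symmetric])
    finally show ?thesis .
  qed
  have h1: "h1 x = umap w U x" for x
  proof -
    have "x = octo_of (cpart x) 0 + octo_of 0 (vpart x)" by (simp add: octo_eq_iff)
    then have "h1 x = h1 (octo_of (cpart x) 0) + h1 (octo_of 0 (vpart x))" by (metis h1_add)
    then show ?thesis by (simp add: h1_lep h1_v octo_eq_iff)
  qed
  have hU: "h = sm_op w U (mat 1)"
    by (rule spinor_op_eqI) (simp add: h12 h1 sm_op_apply c1)
  have U: "cunitary U"
  proof (rule cunitaryI)
    fix p
    have "norm (blinfun_apply h (octo_of 0 p, 0)) = norm (octo_of 0 p, 0 :: octo)" by (rule norm_Spin9[OF hS])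
    then have "(norm (octo_of 0 (U *v p), 0 :: octo))\<^sup>2 = (norm (octo_of 0 p, 0 :: octo))\<^sup>2"
      by (simp add: hx h1_v)
    then show "norm (U *v p) = norm p" unfolding norm_spinor norm_octo_of by simp
  qed
  let ?e = "\<lambda>k. axis k 1 :: complex^3"
  obtain t z where tz: "h o\<^sub>L spinX 0 (octo_of 0 (?e 1)) = spinX t z o\<^sub>L h"
    using Spin9_conj_spinX[OF hS] by blast
  have "blinfun_apply h (blinfun_apply (spinX 0 (octo_of 0 (?e 1))) (0, x)) =
      blinfun_apply (spinX t z) (blinfun_apply h (0, x))" for x
    using arg_cong[OF tz, of "\<lambda>f. blinfun_apply f (0, x)"] by simp
  then have z: "h1 (octo_of 0 (?e 1) *\<^sub>O x) = z *\<^sub>O h1 x" for x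
    by (simp add: spinX_apply hy h12 h10)
  \<comment> \<open>Evaluation at the octonion one determines the vector z to which conjugation by h
    sends the first axis.\<close>
  have "octo_of 0 (U *v ?e 1) = z *\<^sub>O octo_of w 0"
    using z[of oone] by (simp only: omult_oone h1_v) (simp add: oone_eq h1_lep)
  then have "cpart z * w = 0" "U *v ?e 1 = cnj w *s vpart z"
    by (simp_all add: omult_complex_right octo_eq_iff)
  then have "cpart z = 0" and vz: "vpart z = w *s (U *v ?e 1)"
    using w0 unit_complex_mult_cnj[OF w] by simp_all
  then have z': "z = octo_of 0 (w *s (U *v ?e 1))" by (simp add: octo_eq_iff)
  \<comment> \<open>This octonion product expresses the third column of U by the first two. Pairing
    the result with the third column produces the determinant.\<close>
  have e: "octo_of 0 (?e 1) *\<^sub>O octo_of 0 (?e 2) = octo_of 0 (?e 3)"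
    by (simp add: octo_eq_iff cross_cnj_def axis_def vec_eq_iff forall_3 sum_3)
  have "octo_of 0 (U *v ?e 3) = octo_of 0 (w *s (U *v ?e 1)) *\<^sub>O octo_of 0 (U *v ?e 2)"
    using z[of "octo_of 0 (?e 2)"] by (simp only: e h1_v z')
  then have "U *v ?e 3 = cross_cnj (w *s (U *v ?e 1)) (U *v ?e 2)"
    by (simp add: octo_eq_iff)
  also have "\<dots> = cnj w *s cross_cnj (U *v ?e 1) (U *v ?e 2)"
    by (simp add: cross_cnj_def vec_eq_iff forall_3 algebra_simps)
  finally have U3: "U *v ?e 3 = cnj w *s cross_cnj (U *v ?e 1) (U *v ?e 2)" .
  have "1 = hdot (U *v ?e 3) (U *v ?e 3)"
    unfolding hdot_cunitary[OF U] hdot_axis by simp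
  also have "\<dots> = hdot (cnj w *s cross_cnj (U *v ?e 1) (U *v ?e 2)) (U *v ?e 3)"
    by (simp only: U3[symmetric])
  also have "\<dots> = w * det U"
    unfolding cross_cnj_det[symmetric] by (simp add: hdot_linear) (simp add: hdot_def)
  finally have "w * det U = 1" by simp
  then have "w * (det U * cnj (det U)) = cnj (det U)" by (simp add: mult.assoc[symmetric])
  then have "w = cnj (det U)" using unit_complex_mult_cnj[OF cmod_det_cunitary[OF U]] by simp
  then show thesis using that U hU by blast
qed

lemma commutant_eq_sm_op:
  assumes g: "g \<in> Spin9_commutant J0"
  obtains U B where "cunitary U" "cunitary B" "det B = 1" "g = sm_op (cnj (det U)) U B"
proof -
  obtain M :: "complex^2^2" where M: "cunitary M" and lep: "\<And>a b. blinfun_apply g (octo_of a 0, octo_of b 0) =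
    (octo_of (M$1$1 * a + M$1$2 * b) 0, octo_of (M$2$1 * a + M$2$2 * b) 0)"
    using commutant_lepton[OF g] by blast
  \<comment> \<open>A square root of the determinant, so that dividing \<open>M\<close> by it leaves
    an element of SU(2).\<close>
  define w where "w = csqrt (det M)"
  have "cmod w = 1" using cmod_det_cunitary[OF M] by (simp add: w_def)
  then have w: "w * cnj w = 1" by (rule unit_complex_mult_cnj)
  define B where "B = mat (cnj w) ** M"
  have "cunitary (mat (cnj w) :: complex^2^2)"
    using w by (simp add: cunitary_def mat_mult_mat mult.commute)
  then have B: "cunitary B" unfolding B_def using M by (rule cunitary_mult)
  have "det B = cnj w * cnj w * (w * w)"
    using power2_csqrt[of "det M"] by (simp add: B_def det_mul w_def[symmetric] power2_eq_square)
      (simp add: det_2)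
  also have "\<dots> = (w * cnj w) * (w * cnj w)" by (simp add: mult_ac)
  finally have dB: "det B = 1" by (simp add: w)
  have cB: "cunitary (cadjoint B)" "det (cadjoint B) = 1"
    using B dB by (simp_all add: cunitary_cadjoint det_cadjoint)
  define h where "h = sm_op 1 (mat 1) (cadjoint B) o\<^sub>L g"
  have "sm_op 1 (mat 1) (cadjoint B) \<in> Spin9_commutant J0"
    using spin_SU2[OF cB] by (simp add: Spin9_commutant_def sm_op_J_R_commute)
  then have h: "h \<in> Spin9_commutant J0"
    using subgroup.m_closed[OF subgroup_Spin9_commutant _ g] by (simp add: h_def)
  have gB: "g = sm_op 1 (mat 1) B o\<^sub>L h"
    using B by (simp add: h_def blinfun_compose_assoc[symmetric] sm_op_mult cunitary_def sm_op_one)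
  have "M = mat w ** B" by (simp add: B_def matrix_mul_assoc mat_mult_mat w)
  then have "cadjoint B ** M = mat w ** (cadjoint B ** B)"
    by (metis matrix_mul_assoc matrix_mul_mat)
  then have BM: "cadjoint B ** M = mat w" by (simp add: cunitary_left[OF B])
  have "blinfun_apply h (octo_of a 0, octo_of b 0) = (octo_of (w * a) 0, octo_of (w * b) 0)" for a b
  proof -
    have "blinfun_apply h (octo_of a 0, octo_of b 0) =
      (octo_of ((cadjoint B ** M)$1$1 * a + (cadjoint B ** M)$1$2 * b) 0,
       octo_of ((cadjoint B ** M)$2$1 * a + (cadjoint B ** M)$2$2 * b) 0)"
      by (simp add: h_def lep sm_op_apply octo_eq_iff matrix_mul_2 algebra_simps)
    then show ?thesis by (simp add: BM)
  qed
  then obtain U where U: "cunitary U" "w = cnj (det U)" "h = sm_op w U (mat 1)"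
    using commutant_scalar_lepton[OF h] by blast
  then have "g = sm_op (cnj (det U)) U B" by (simp add: gB sm_op_mult)
  then show thesis using that U B dB by blast
qed


section \<open>Transport along an octonion automorphism\<close>

lemma octo_aut_inverse:
  assumes f: "octo_aut f"
  obtains f' where "octo_aut f'" "\<And>x. f (f' x) = x" "\<And>x. f' (f x) = x"
proof -
  have lin: "linear f" and mult: "\<And>x y. f (x *\<^sub>O y) = f x *\<^sub>O f y"
    and cnj: "\<And>x. f (ocnj x) = ocnj (f x)" and norm: "\<And>x. norm (f x) = norm x"
    using f unfolding octo_aut_def by blast+
  have "x = 0" if "f x = 0" for x using norm[of x] that by simp
  then have "inj f" using lin by (simp add: linear_injective_0)
  then obtain f' where f': "linear f'" "\<forall>x. f' (f x) = x" "\<forall>x. f (f' x) = x"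
    using linear_injective_isomorphism[OF lin] by blast
  have "octo_aut f'"
    unfolding octo_aut_def
  proof (intro conjI allI)
    show "f' (x *\<^sub>O y) = f' x *\<^sub>O f' y" for x y using f' mult by metis
    show "f' (ocnj x) = ocnj (f' x)" for x using f' cnj by metis
    show "norm (f' x) = norm x" for x using f' norm by metis
  qed (rule f')
  then show thesis using that f' by blast
qed

definition aut_op :: "(octo \<Rightarrow> octo) \<Rightarrow> operator" where
  "aut_op f = Blinfun (\<lambda>(x, y). (f x, f y))"

lemma aut_op_apply:
  assumes "octo_aut f"
  shows "blinfun_apply (aut_op f) (x, y) = (f x, f y)"
proof -
  have "linear f" using assms by (simp add: octo_aut_def)
  then have "linear (\<lambda>(x, y). (f x, f y))"
    by (intro linearI) (simp_all add: split_beta linear_add linear_cmul)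
  then show ?thesis
    by (simp add: aut_op_def bounded_linear_Blinfun_apply linear_conv_bounded_linear)
qed

lemma aut_op_inverse:
  assumes "octo_aut f" "octo_aut f'" "\<And>x. f (f' x) = x"
  shows "aut_op f o\<^sub>L aut_op f' = id_blinfun" "aut_op f o\<^sub>L (aut_op f' o\<^sub>L g) = g"
proof -
  show "aut_op f o\<^sub>L aut_op f' = id_blinfun"
    by (rule spinor_op_eqI) (simp add: aut_op_apply assms)
  then show "aut_op f o\<^sub>L (aut_op f' o\<^sub>L g) = g" by (simp add: blinfun_compose_assoc[symmetric])
qed

lemma aut_op_spinX:
  assumes f: "octo_aut f"
  shows "aut_op f o\<^sub>L spinX s y = spinX s (f y) o\<^sub>L aut_op f"
proof (rule spinor_op_eqI)
  fix a b
  have lin: "linear f" and mult: "f (y *\<^sub>O b) = f y *\<^sub>O f b" "f (ocnj y *\<^sub>O a) = f (ocnj y) *\<^sub>O f a"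
    and cnj: "f (ocnj y) = ocnj (f y)"
    using f unfolding octo_aut_def by blast+
  show "blinfun_apply (aut_op f o\<^sub>L spinX s y) (a, b) = blinfun_apply (spinX s (f y) o\<^sub>L aut_op f) (a, b)"
    by (simp add: aut_op_apply[OF f] spinX_apply linear_add[OF lin] linear_diff[OF lin]
        linear_cmul[OF lin] mult cnj)
qed

lemma aut_op_J_R:
  assumes f: "octo_aut f"
  shows "aut_op f o\<^sub>L J_R i = J_R (f i) o\<^sub>L aut_op f"
proof (rule spinor_op_eqI)
  fix a b
  have "f (a *\<^sub>O i) = f a *\<^sub>O f i" "f (b *\<^sub>O i) = f b *\<^sub>O f i" using f unfolding octo_aut_def by blast+
  then show "blinfun_apply (aut_op f o\<^sub>L J_R i) (a, b) = blinfun_apply (J_R (f i) o\<^sub>L aut_op f) (a, b)"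
    by (simp add: aut_op_apply[OF f] J_R_apply)
qed

lemma aut_op_Spin9:
  assumes f: "octo_aut f" "octo_aut f'" "\<And>x. f (f' x) = x" and g: "g \<in> carrier Spin9"
  shows "aut_op f o\<^sub>L (g o\<^sub>L aut_op f') \<in> carrier Spin9"
  using g
proof (induction rule: Spin9_induct)
  case one
  then show ?case using Spin9_one by (simp add: aut_op_inverse[OF f])
next
  case (step s y t z g)
  have n: "norm (f x) = norm x" for x using f(1) unfolding octo_aut_def by blast
  have "aut_op f o\<^sub>L ((spinX s y o\<^sub>L (spinX t z o\<^sub>L g)) o\<^sub>L aut_op f') =
      (aut_op f o\<^sub>L spinX s y) o\<^sub>L (spinX t z o\<^sub>L (g o\<^sub>L aut_op f'))"
    by (simp only: blinfun_compose_assoc)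
  also have "\<dots> = spinX s (f y) o\<^sub>L ((aut_op f o\<^sub>L spinX t z) o\<^sub>L (g o\<^sub>L aut_op f'))"
    by (simp only: aut_op_spinX[OF f(1), of s y]) (simp only: blinfun_compose_assoc)
  also have "\<dots> = (spinX s (f y) o\<^sub>L spinX t (f z)) o\<^sub>L (aut_op f o\<^sub>L (g o\<^sub>L aut_op f'))"
    by (simp only: aut_op_spinX[OF f(1), of t z]) (simp only: blinfun_compose_assoc)
  finally show ?case
    using Spin9_mult[OF Spin9_pair step.IH, of s "f y" t "f z"] step(1,2) n by simp
qed

text \<open>Conjugation by an octonion automorphism permutes the generators of Spin(9) and moves
  \<open>J_R i\<close> to \<open>J_R (f i)\<close>; this reduces a general imaginary unit to the
  standard one.\<close>

lemma aut_op_commutant: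
  assumes f: "octo_aut f" "octo_aut f'" "\<And>x. f (f' x) = x" "\<And>x. f' (f x) = x"
    and g: "g \<in> Spin9_commutant (J_R i)"
  shows "aut_op f o\<^sub>L (g o\<^sub>L aut_op f') \<in> Spin9_commutant (J_R (f i))"
proof -
  have gJ: "g o\<^sub>L J_R i = J_R i o\<^sub>L g" and gS: "g \<in> carrier Spin9"
    using g by (auto simp: Spin9_commutant_def)
  have J': "aut_op f' o\<^sub>L J_R (f i) = J_R i o\<^sub>L aut_op f'" using aut_op_J_R[OF f(2), of "f i"] f(4) by simp
  have "(aut_op f o\<^sub>L (g o\<^sub>L aut_op f')) o\<^sub>L J_R (f i) = aut_op f o\<^sub>L (g o\<^sub>L (aut_op f' o\<^sub>L J_R (f i)))"
    by (simp only: blinfun_compose_assoc)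
  also have "\<dots> = aut_op f o\<^sub>L ((g o\<^sub>L J_R i) o\<^sub>L aut_op f')" by (simp only: J' blinfun_compose_assoc)
  also have "\<dots> = (aut_op f o\<^sub>L J_R i) o\<^sub>L (g o\<^sub>L aut_op f')" by (simp only: gJ) (simp only: blinfun_compose_assoc)
  also have "\<dots> = J_R (f i) o\<^sub>L (aut_op f o\<^sub>L (g o\<^sub>L aut_op f'))"
    by (simp only: aut_op_J_R[OF f(1)] blinfun_compose_assoc)
  finally show ?thesis using aut_op_Spin9[OF f(1,2,3) gS] by (simp add: Spin9_commutant_def)
qed


section \<open>The covering homomorphism\<close>

abbreviation "SM_cover \<equiv> U1 \<times>\<times> SU \<times>\<times> SU :: sm_ambient monoid"

lemma group_U1: "group U1"
proof (rule groupI)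
  fix z assume "z \<in> carrier U1"
  then show "\<exists>w\<in>carrier U1. w \<otimes>\<^bsub>U1\<^esub> z = \<one>\<^bsub>U1\<^esub>"
    using unit_complex_mult_cnj[of z] by (intro bexI[of _ "cnj z"]) (auto simp: U1_def mult.commute)
qed (auto simp: U1_def norm_mult)

lemma carrier_SU: "A \<in> carrier SU \<longleftrightarrow> cunitary A \<and> det A = 1"
  by (simp add: SU_def cunitary_def)

lemma group_SU: "group (SU :: (complex^'n^'n) monoid)"
proof (rule groupI)
  fix A :: "complex^'n^'n" assume "A \<in> carrier SU"
  then show "\<exists>B\<in>carrier SU. B \<otimes>\<^bsub>SU\<^esub> A = \<one>\<^bsub>SU\<^esub>"
    by (intro bexI[of _ "cadjoint A"])
      (auto simp: carrier_SU cunitary_cadjoint det_cadjoint, simp add: SU_def cunitary_left)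
next
  fix A B :: "complex^'n^'n" assume "A \<in> carrier SU" "B \<in> carrier SU"
  then have "A ** B \<in> carrier SU" by (simp add: carrier_SU cunitary_mult det_mul)
  then show "A \<otimes>\<^bsub>SU\<^esub> B \<in> carrier SU" by (simp add: SU_def)
qed (auto simp: SU_def matrix_mul_assoc)

lemma group_SM_cover: "group SM_cover"
  by (intro DirProd_group group_U1 group_SU)

lemma SM_cover_simps:
  "(z, A, B) \<in> carrier SM_cover \<longleftrightarrow> cmod z = 1 \<and> cunitary A \<and> det A = 1 \<and> cunitary B \<and> det B = 1"
  "(z, A, B) \<otimes>\<^bsub>SM_cover\<^esub> (z', A', B') = (z * z', A ** A', B ** B')"
  "\<one>\<^bsub>SM_cover\<^esub> = (1, mat 1, mat 1)"
  by (simp_all add: carrier_SU) (simp_all add: U1_def SU_def)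

text \<open>On the unit circle \<open>cnj z ^ 3\<close> is the inverse cube of z. Written this way
  the map is a real polynomial on the whole ambient space.\<close>

definition sm_rep :: "sm_ambient \<Rightarrow> operator" where
  "sm_rep k = (case k of (z, A, B) \<Rightarrow> sm_op (cnj z ^ 3) (mat z ** A) B)"

lemma det_mat_3: "det (mat z :: complex^3^3) = z ^ 3"
  by (simp add: det_3 mat_def power3_eq_cube)

lemma det_mat_2: "det (mat z :: complex^2^2) = z ^ 2"
  by (simp add: det_2 power2_eq_square)

lemma cunitary_mat: "cmod z = 1 \<Longrightarrow> cunitary (mat z)"
  by (simp add: cunitary_def mat_mult_mat unit_complex_mult_cnj)

lemma sm_rep_in_commutant:
  assumes "k \<in> carrier SM_cover"
  shows "sm_rep k \<in> Spin9_commutant J0"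
proof -
  obtain z A B where k: "k = (z, A, B)" by (metis prod_cases3)
  then have *: "cmod z = 1" "cunitary A" "det A = 1" "cunitary B" "det B = 1"
    using assms by (simp_all only: SM_cover_simps)
  then have "cunitary (mat z ** A)" by (intro cunitary_mult cunitary_mat)
  from sm_op_in_Spin9[OF this *(4,5)] show ?thesis
    by (simp add: k sm_rep_def Spin9_commutant_def sm_op_J_R_commute det_mul det_mat_3 *)
qed

lemma sm_rep_mult: "sm_rep (k \<otimes>\<^bsub>SM_cover\<^esub> l) = sm_rep k o\<^sub>L sm_rep l"
proof -
  obtain z A B z' A' B' where kl: "k = (z, A, B)" "l = (z', A', B')" by (metis prod_cases3)
  have "mat (z * z') ** (A ** A') = (mat z ** A) ** (mat z' ** A')"
  proof -
    have "(mat z ** A) ** (mat z' ** A') = mat z ** (A ** mat z') ** A'" by (simp only: matrix_mul_assoc)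
    also have "A ** mat z' = mat z' ** A" by (rule matrix_mul_mat)
    finally show ?thesis by (simp only: matrix_mul_assoc mat_mult_mat)
  qed
  then show ?thesis
    by (simp only: kl SM_cover_simps sm_rep_def prod.case sm_op_mult complex_cnj_mult power_mult_distrib)
qed

lemma sm_rep_surj:
  assumes "g \<in> Spin9_commutant J0"
  obtains k where "k \<in> carrier SM_cover" "sm_rep k = g"
proof -
  obtain U B where U: "cunitary U" "cunitary B" "det B = 1" "g = sm_op (cnj (det U)) U B"
    by (rule commutant_eq_sm_op[OF assms])
  \<comment> \<open>A cube root of the phase det U, so that U divided by z has determinant
    1.\<close>
  define z where "z = cis (Arg (det U) / 3)"
  have cz: "cmod z = 1" by (simp add: z_def)
  have z3: "z ^ 3 = det U"
    using rcis_cmod_Arg[of "det U"] cmod_det_cunitary[OF U(1)]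
    by (simp add: z_def Complex.DeMoivre rcis_def)
  define A where "A = mat (cnj z) ** U"
  have zA: "mat z ** A = U"
    using unit_complex_mult_cnj[OF cz] by (simp add: A_def matrix_mul_assoc mat_mult_mat)
  have "cunitary A" unfolding A_def using cz U by (intro cunitary_mult cunitary_mat) auto
  moreover have "det A = 1"
  proof -
    have "det A = cnj z ^ 3 * z ^ 3" by (simp add: A_def det_mul det_mat_3 z3)
    also have "\<dots> = (z * cnj z) ^ 3" by (simp add: power_mult_distrib mult.commute)
    finally show ?thesis using unit_complex_mult_cnj[OF cz] by simp
  qed
  ultimately have "(z, A, B) \<in> carrier SM_cover" unfolding SM_cover_simps using cz U by simp
  moreover have "sm_rep (z, A, B) = g" by (simp add: sm_rep_def zA U(4) z3[symmetric])
  ultimately show thesis by (rule that)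
qed

section \<open>The kernel of the covering and the group Z6\<close>

definition root_elem :: "complex \<Rightarrow> sm_ambient" where
  "root_elem z = (z, mat (z ^ 2), mat (z ^ 3))"

lemma root_of_unity_cmod: "z ^ 6 = 1 \<Longrightarrow> cmod z = 1"
  by (metis norm_ge_zero norm_one norm_power power_eq_1_iff zero_neq_numeral)

lemma root_elem_carrier: "z ^ 6 = 1 \<Longrightarrow> root_elem z \<in> carrier SM_cover"
  unfolding root_elem_def SM_cover_simps
  by (simp add: root_of_unity_cmod cunitary_mat norm_power det_mat_2 det_mat_3 power_mult[symmetric])

lemma sm_rep_root_elem:
  assumes "z ^ 6 = 1"
  shows "sm_rep (root_elem z) = id_blinfun"
proof -
  have c: "z * cnj z = 1" using root_of_unity_cmod[OF assms] by (rule unit_complex_mult_cnj)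
  have "cnj z ^ 3 * z ^ 3 = (z * cnj z) ^ 3" by (simp add: power_mult_distrib mult.commute)
  then have 1: "cnj z ^ 3 * z ^ 3 = 1" by (simp add: c)
  have 2: "z * z ^ 2 * z ^ 3 = 1" using assms by (simp add: power_add[symmetric] power_Suc[symmetric] del: power_Suc)
  show ?thesis
    by (rule spinor_op_eqI)
      (use 1 2 in \<open>simp add: sm_rep_def root_elem_def sm_op_apply octo_eq_iff mat_mult_mat mat_vector_mul mult.assoc[symmetric]\<close>)
qed

text \<open>The lepton block forces \<open>B = mat (z ^ 3)\<close>, then \<open>det B = 1\<close>
  forces \<open>z ^ 6 = 1\<close>, and the quark block forces A to be the inverse fourth power of z,
  which is \<open>z ^ 2\<close>.\<close>

lemma sm_rep_kernel:
  assumes k: "k \<in> carrier SM_cover" and id: "sm_rep k = id_blinfun"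
  shows "\<exists>z. z ^ 6 = 1 \<and> k = root_elem z"
proof -
  obtain z A B where zAB: "k = (z, A, B)" by (metis prod_cases3)
  then have *: "cmod z = 1" "cunitary A" "det A = 1" "cunitary B" "det B = 1"
    using k by (simp_all only: SM_cover_simps)
  have c: "z * cnj z = 1" using *(1) by (rule unit_complex_mult_cnj)
  have "z ^ 3 * cnj z ^ 3 = (z * cnj z) ^ 3" by (simp add: power_mult_distrib)
  then have c3: "z ^ 3 * cnj z ^ 3 = 1" by (simp add: c)
  have ap: "blinfun_apply (sm_op (cnj z ^ 3) (mat z ** A) B) v = v" for v
    using id by (simp add: zAB sm_rep_def)
  have "cnj z ^ 3 * B$1$1 = 1" "cnj z ^ 3 * B$2$1 = 0" "cnj z ^ 3 * B$1$2 = 0" "cnj z ^ 3 * B$2$2 = 1"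
    using ap[of "(octo_of 1 0, 0)"] ap[of "(0, octo_of 1 0)"] by (simp_all add: sm_op_apply octo_eq_iff)
  then have "z ^ 3 * cnj z ^ 3 * B$1$1 = z ^ 3" "z ^ 3 * cnj z ^ 3 * B$2$1 = 0"
    "z ^ 3 * cnj z ^ 3 * B$1$2 = 0" "z ^ 3 * cnj z ^ 3 * B$2$2 = z ^ 3"
    by (simp_all only: mult.assoc) simp_all
  then have B: "B = mat (z ^ 3)" unfolding c3 by (simp add: vec_eq_iff forall_2)
  then have "(z ^ 3) ^ 2 = 1" using *(5) by (simp only: det_mat_2)
  then have z6: "z ^ 6 = 1" by (simp add: power_mult[symmetric])
  have "A *v p = mat (z ^ 2) *v p" for p
  proof -
    have "z ^ 3 *s (z *s (A *v p)) = p"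
      using ap[of "(octo_of 0 p, 0)"]
      by (simp add: sm_op_apply octo_eq_iff B matrix_vector_mul_assoc[symmetric] mat_vector_mul vec.scale)
    then have "z ^ 2 *s p = z ^ 2 *s (z ^ 3 *s (z *s (A *v p)))" by simp
    also have "\<dots> = z ^ 6 *s (A *v p)" by (simp add: eval_nat_numeral mult.assoc)
    finally have "z ^ 2 *s p = z ^ 6 *s (A *v p)" .
    then show ?thesis by (simp add: z6 mat_vector_mul)
  qed
  then have "A = mat (z ^ 2)" by (simp add: matrix_eq)
  then show ?thesis using z6 B zAB by (auto simp: root_elem_def)
qed

lemma embedded_group:
  assumes "group K"
  shows "group (embedded_lie_group K)"
proof -
  interpret group K by (rule assms)
  show ?thesis
    by (rule groupI) (use l_inv_ex in \<open>auto simp: embedded_lie_group_def m_assoc\<close>)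
qed

lemma embedded_inv: "inv\<^bsub>embedded_lie_group K\<^esub> x = inv\<^bsub>K\<^esub> x"
  by (simp add: embedded_lie_group_def m_inv_def)

lemma embedded_subgroup: "subgroup S (embedded_lie_group K) = subgroup S K"
  by (simp add: subgroup_def embedded_inv) (simp add: embedded_lie_group_def)

text \<open>The generator is \<open>root_elem\<close> at the primitive root
  \<open>cis (pi / 3)\<close>. Every sixth root of unity is a power of it, and
  \<open>root_elem\<close> is multiplicative.\<close>

lemma Z6_eq: "Z6 = root_elem ` {z. z ^ 6 = 1}"
proof
  let ?\<zeta> = "cis (pi / 3)"
  have z2: "?\<zeta> ^ 2 = cis (2 * pi / 3)" by (simp add: Complex.DeMoivre)
  have z3: "?\<zeta> ^ 3 = - 1" by (simp add: Complex.DeMoivre)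
  have gen: "(cis (pi / 3), mat (cis (2 * pi / 3)), mat (- 1)) = root_elem ?\<zeta>"
    by (simp add: root_elem_def z2 z3)
  have z6: "?\<zeta> ^ 6 = 1" by (simp add: Complex.DeMoivre)
  have rm: "root_elem z \<otimes>\<^bsub>SM_cover\<^esub> root_elem w = root_elem (z * w)" for z w
    unfolding root_elem_def SM_cover_simps by (simp add: mat_mult_mat power_mult_distrib)
  show "root_elem ` {z. z ^ 6 = 1} \<subseteq> Z6"
  proof (rule image_subsetI)
    fix z :: complex assume "z \<in> {z. z ^ 6 = 1}"
    then have "z \<in> (\<lambda>k. cis (2 * pi * real k / real 6)) ` {..<6}"
      using Complex.bij_betw_roots_unity[of 6] by (auto simp: bij_betw_def)
    then obtain n where "z = cis (2 * pi * real n / 6)" by auto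
    then have z: "z = ?\<zeta> ^ n" by (simp add: Complex.DeMoivre algebra_simps)
    have "root_elem (?\<zeta> ^ n) \<in> Z6"
    proof (induction n)
      case 0
      have "root_elem 1 = \<one>\<^bsub>U1_SU3_SU2\<^esub>"
        using SM_cover_simps(3) by (simp add: root_elem_def U1_SU3_SU2_def embedded_lie_group_def)
      then show ?case unfolding Z6_def by (simp add: generate.one)
    next
      case (Suc n)
      have "root_elem ?\<zeta> \<in> Z6" unfolding Z6_def gen by (rule generate.incl) simp
      from generate.eng[OF this[unfolded Z6_def] Suc[unfolded Z6_def]]
      have "root_elem ?\<zeta> \<otimes>\<^bsub>U1_SU3_SU2\<^esub> root_elem (?\<zeta> ^ n) \<in> Z6" unfolding Z6_def .
      moreover have "root_elem ?\<zeta> \<otimes>\<^bsub>U1_SU3_SU2\<^esub> root_elem (?\<zeta> ^ n) = root_elem (?\<zeta> ^ Suc n)"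
        using rm[of ?\<zeta> "?\<zeta> ^ n"] by (simp add: U1_SU3_SU2_def embedded_lie_group_def)
      ultimately show ?case by simp
    qed
    then show "root_elem z \<in> Z6" by (simp add: z)
  qed
  have sub: "subgroup (root_elem ` {z. z ^ 6 = 1}) SM_cover"
  proof (rule group.subgroupI[OF group_SM_cover])
    show "root_elem ` {z. z ^ 6 = 1} \<subseteq> carrier SM_cover" using root_elem_carrier by blast
    show "root_elem ` {z. z ^ 6 = 1} \<noteq> {}" using z6 by blast
  next
    fix x assume "x \<in> root_elem ` {z. z ^ 6 = 1}"
    then obtain z where z: "z ^ 6 = 1" "x = root_elem z" by blast
    have "z * cnj z = 1" by (rule unit_complex_mult_cnj[OF root_of_unity_cmod[OF z(1)]])
    then have "root_elem (cnj z) \<otimes>\<^bsub>SM_cover\<^esub> x = \<one>\<^bsub>SM_cover\<^esub>"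
      unfolding z rm SM_cover_simps(3) by (simp add: root_elem_def mult.commute)
    moreover have c6: "cnj z ^ 6 = 1" using arg_cong[OF z(1), of cnj] by simp
    ultimately have "inv\<^bsub>SM_cover\<^esub> x = root_elem (cnj z)"
      using group.inv_equality[OF group_SM_cover] root_elem_carrier z by metis
    then show "inv\<^bsub>SM_cover\<^esub> x \<in> root_elem ` {z. z ^ 6 = 1}" using c6 by blast
  next
    fix x y assume "x \<in> root_elem ` {z. z ^ 6 = 1}" "y \<in> root_elem ` {z. z ^ 6 = 1}"
    then obtain z w where "z ^ 6 = 1" "w ^ 6 = 1" "x = root_elem z" "y = root_elem w" by blast
    then show "x \<otimes>\<^bsub>SM_cover\<^esub> y \<in> root_elem ` {z. z ^ 6 = 1}"
      by (simp only: rm) (auto simp: power_mult_distrib)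
  qed
  show "Z6 \<subseteq> root_elem ` {z. z ^ 6 = 1}"
    unfolding Z6_def gen
    by (rule group.generate_subgroup_incl) (use z6 sub group_SM_cover in
      \<open>auto simp: U1_SU3_SU2_def embedded_group embedded_subgroup\<close>)
qed


section \<open>Smoothness of the covering homomorphism and its local sections\<close>

lemma bounded_bilinear_sm_op: "bounded_bilinear (\<lambda>p B. sm_op (fst p) (snd p) B)"
proof -
  have add: "sm_op (w + w') (U + U') B = sm_op w U B + sm_op w' U' B"
    "sm_op w U (B + B') = sm_op w U B + sm_op w U B'" for w w' U U' B B'
    by (rule spinor_op_eqI; simp add: sm_op_apply octo_eq_iff blinfun.add_left
        matrix_vector_mult_add_rdistrib vec.add algebra_simps)+
  have mv: "(r *\<^sub>R U) *v v = r *\<^sub>R (U *v v)" for r and U :: "complex^3^3" and v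
    by (simp add: matrix_vector_mult_def vec_eq_iff scaleR_sum_right)
  have scale: "sm_op (r *\<^sub>R w) (r *\<^sub>R U) B = r *\<^sub>R sm_op w U B"
    "sm_op w U (r *\<^sub>R B) = r *\<^sub>R sm_op w U B" for r w U B
    by (rule spinor_op_eqI; simp add: sm_op_apply octo_eq_iff blinfun.scaleR_left
        mv vec_scaleR_simps matrix_vector_scaleR scaleR_add_right vec.add algebra_simps)+
  show ?thesis
    unfolding bilinear_conv_bounded_bilinear[symmetric] bilinear_def
    by (auto intro!: linearI simp: add scale)
qed

lemma smooth_sm_rep: "smooth_on UNIV sm_rep"
proof -
  have *: "sm_rep = (\<lambda>k. sm_op (fst (cnj (fst k) ^ 3, \<chi> i j. fst k * fst (snd k) $ i $ j))
      (snd (cnj (fst k) ^ 3, \<chi> i j. fst k * fst (snd k) $ i $ j)) (snd (snd k)))"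
    by (rule ext) (simp add: sm_rep_def split_beta matrix_matrix_mult_def mat_def vec_eq_iff
        if_distrib if_distribR sum.delta cong: if_cong)
  have 1: "smooth_on UNIV (\<lambda>k. fst k)" "smooth_on UNIV (\<lambda>k. snd k)"
    by (auto intro: smooth_on_bounded_linear bounded_linear_fst bounded_linear_snd)
  have A: "smooth_on UNIV (\<lambda>k :: sm_ambient. fst (snd k))"
    by (rule smooth_on_compose_bounded_linear[OF bounded_linear_fst 1(2)])
  have B: "smooth_on UNIV (\<lambda>k :: sm_ambient. snd (snd k))"
    by (rule smooth_on_compose_bounded_linear[OF bounded_linear_snd 1(2)])
  show ?thesis
    unfolding *
    by (rule smooth_on_bounded_bilinear[OF bounded_bilinear_sm_op])
      (intro smooth_on_Pair smooth_on_power smooth_on_cnj smooth_on_vec smooth_on_mult smooth_on_vec_nth 1 A B)+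
qed

text \<open>Matrix coefficients, linear in the operator and defined on all operators; local sections
  built from them are therefore defined on open sets of the ambient space and not only on the
  group.\<close>

definition lep_entry :: "2 \<Rightarrow> 2 \<Rightarrow> operator \<Rightarrow> complex" where
  "lep_entry s t g = (let v = blinfun_apply g (if t = 1 then (octo_of 1 0, 0) else (0, octo_of 1 0))
     in cpart (if s = 1 then fst v else snd v))"

definition quark_entry :: "2 \<Rightarrow> 2 \<Rightarrow> 3 \<Rightarrow> 3 \<Rightarrow> operator \<Rightarrow> complex" where
  "quark_entry s t j k g = (let v = blinfun_apply g (if t = 1 then (octo_of 0 (axis k 1), 0) else (0, octo_of 0 (axis k 1)))
     in vpart (if s = 1 then fst v else snd v) $ j)"

lemma lep_entry_sm_op: "lep_entry s t (sm_op w U B) = w * B $ s $ t"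
  using exhaust_2[of s] exhaust_2[of t] by (auto simp: lep_entry_def sm_op_apply)

lemma quark_entry_sm_op: "quark_entry s t j k (sm_op w U B) = U $ j $ k * B $ s $ t"
  using exhaust_2[of s] exhaust_2[of t]
  by (auto simp: quark_entry_def sm_op_apply vec.scale matrix_vector_axis)

lemma bounded_linear_cpart: "bounded_linear cpart" and bounded_linear_vpart: "bounded_linear vpart"
  using linear_cpart linear_vpart by (simp_all add: linear_conv_bounded_linear)

lemma bounded_linear_blinfun_at: "bounded_linear (\<lambda>g. blinfun_apply g v)"
  by (rule bounded_bilinear.bounded_linear_left[OF bounded_bilinear_blinfun_apply])

lemma bounded_linear_lep_entry: "bounded_linear (lep_entry s t)"
proof -
  have "bounded_linear (\<lambda>g :: operator. cpart (fst (blinfun_apply g v)))"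
    "bounded_linear (\<lambda>g :: operator. cpart (snd (blinfun_apply g v)))" for v
    by (intro bounded_linear_compose[OF bounded_linear_cpart] bounded_linear_compose[OF bounded_linear_fst]
        bounded_linear_compose[OF bounded_linear_snd] bounded_linear_blinfun_at)+
  then show ?thesis by (cases "s = 1") (simp_all add: lep_entry_def[abs_def] Let_def)
qed

lemma bounded_linear_quark_entry: "bounded_linear (quark_entry s t j k)"
proof -
  have "bounded_linear (\<lambda>g :: operator. vpart (fst (blinfun_apply g v)) $ j)"
    "bounded_linear (\<lambda>g :: operator. vpart (snd (blinfun_apply g v)) $ j)" for v
    by (intro bounded_linear_compose[OF bounded_linear_vec_nth] bounded_linear_compose[OF bounded_linear_vpart]
        bounded_linear_compose[OF bounded_linear_fst]
        bounded_linear_compose[OF bounded_linear_snd] bounded_linear_blinfun_at)+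
  then show ?thesis by (cases "s = 1") (simp_all add: quark_entry_def[abs_def] Let_def)
qed

text \<open>The determinant of the lepton block of \<open>sm_rep (z, A, B)\<close> is the inverse of
  \<open>z ^ 6\<close>; the conjugate turns it into \<open>z ^ 6\<close>.\<close>

definition lep_det :: "operator \<Rightarrow> complex" where
  "lep_det g = cnj (lep_entry 1 1 g * lep_entry 2 2 g - lep_entry 1 2 g * lep_entry 2 1 g)"

lemma lep_det_sm_rep:
  assumes "(z, A, B) \<in> carrier SM_cover"
  shows "lep_det (sm_rep (z, A, B)) = z ^ 6"
proof -
  have "lep_det (sm_rep (z, A, B)) = z ^ 6 * cnj (det B)"
    by (simp add: lep_det_def sm_rep_def lep_entry_sm_op det_2 algebra_simps eval_nat_numeral)
  then show ?thesis using assms unfolding SM_cover_simps by simp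
qed

lemma smooth_lep_det: "smooth_on W lep_det"
proof -
  have "lep_det = (\<lambda>g. cnj (lep_entry 1 1 g * lep_entry 2 2 g + (- 1) * (lep_entry 1 2 g * lep_entry 2 1 g)))"
    by (simp add: lep_det_def fun_eq_iff)
  moreover have "smooth_on W \<dots>"
    by (intro smooth_on_cnj smooth_on_add smooth_on_mult smooth_on_const
        smooth_on_bounded_linear[OF bounded_linear_lep_entry])
  ultimately show ?thesis by simp
qed

text \<open>The factor \<open>1 / 2\<close> compensates \<open>\<Sum>\<^sub>s\<^sub>t |B\<^sub>s\<^sub>t|\<^sup>2 = 2\<close> when \<open>A\<close> is read off \<open>z A \<otimes> B\<close>.\<close>

definition section_of :: "(operator \<Rightarrow> complex) \<Rightarrow> operator \<Rightarrow> sm_ambient" where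
  "section_of r g = (r g, \<chi> j k. 1 / 2 * cnj (r g) *
      (\<Sum>s\<in>UNIV. \<Sum>t\<in>UNIV. cnj (r g ^ 3 * lep_entry s t g) * quark_entry s t j k g),
    \<chi> s t. r g ^ 3 * lep_entry s t g)"

lemma smooth_section_of:
  assumes "smooth_on W r"
  shows "smooth_on W (section_of r)"
  unfolding section_of_def
  by (intro smooth_on_Pair smooth_on_vec smooth_on_mult smooth_on_const smooth_on_sum smooth_on_cnj
      smooth_on_power assms smooth_on_bounded_linear[OF bounded_linear_lep_entry]
      smooth_on_bounded_linear[OF bounded_linear_quark_entry])

text \<open>The chosen root is z times a sixth root of unity x, so the section returns k multiplied
  by \<open>root_elem x\<close>, which lies in the kernel.\<close>

lemma section_of_sm_rep:
  assumes k: "k \<in> carrier SM_cover" and r: "r (sm_rep k) ^ 6 = lep_det (sm_rep k)"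
  shows "section_of r (sm_rep k) \<in> carrier SM_cover" "sm_rep (section_of r (sm_rep k)) = sm_rep k"
proof -
  obtain z A B where zAB: "k = (z, A, B)" by (metis prod_cases3)
  define y where "y = r (sm_rep k)"
  have y6: "y ^ 6 = z ^ 6" using r k lep_det_sm_rep by (simp add: y_def zAB)
  have cz: "cmod z = 1" and B: "cunitary B" "det B = 1" using k unfolding zAB SM_cover_simps by blast+
  have zz: "z * cnj z = 1" by (rule unit_complex_mult_cnj[OF cz])
  define x where "x = y * cnj z"
  have "x ^ 6 = (z * cnj z) ^ 6" by (simp add: x_def power_mult_distrib y6)
  then have x6: "x ^ 6 = 1" by (simp add: zz)
  have xx: "x * cnj x = 1" by (rule unit_complex_mult_cnj[OF root_of_unity_cmod[OF x6]])
  have y: "y = x * z" using zz by (simp add: x_def mult.assoc mult.commute[of "cnj z"])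
  have lep: "y ^ 3 * lep_entry s t (sm_rep k) = x ^ 3 * B $ s $ t" for s t
  proof -
    have "y ^ 3 * lep_entry s t (sm_rep k) = x ^ 3 * B $ s $ t * (z * cnj z) ^ 3"
      by (simp add: zAB sm_rep_def lep_entry_sm_op y power_mult_distrib mult_ac)
    then show ?thesis by (simp add: zz)
  qed
  have quark: "quark_entry s t j l (sm_rep k) = z * A $ j $ l * B $ s $ t" for s t j l
    by (simp add: zAB sm_rep_def quark_entry_sm_op matrix_matrix_mult_def mat_def
        if_distrib if_distribR sum.delta cong: if_cong)
  have BB: "(\<Sum>s\<in>UNIV. \<Sum>t\<in>UNIV. cnj (B $ s $ t) * B $ s $ t) = 2"
  proof -
    have "(\<Sum>t\<in>UNIV. cnj (B $ s $ t) * B $ s $ t) = (B ** cadjoint B) $ s $ s" for s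
      by (simp add: matrix_matrix_mult_def cadjoint_def mult.commute)
    then show ?thesis using B by (simp add: cunitary_def mat_def)
  qed
  have "1 / 2 * cnj y * (\<Sum>s\<in>UNIV. \<Sum>t\<in>UNIV. cnj (x ^ 3 * B $ s $ t) * (z * A $ j $ l * B $ s $ t))
      = x ^ 2 * A $ j $ l" for j l
  proof -
    have "1 / 2 * cnj y * (\<Sum>s\<in>UNIV. \<Sum>t\<in>UNIV. cnj (x ^ 3 * B $ s $ t) * (z * A $ j $ l * B $ s $ t))
      = 1 / 2 * cnj y * (cnj x ^ 3 * z * A $ j $ l * (\<Sum>s\<in>UNIV. \<Sum>t\<in>UNIV. cnj (B $ s $ t) * B $ s $ t))"
      by (simp add: sum_distrib_left mult_ac)
    also have "\<dots> = cnj x ^ 4 * (z * cnj z) * A $ j $ l"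
      unfolding BB y by (simp add: eval_nat_numeral mult_ac)
    \<comment> \<open>Inserting \<open>x ^ 6 = 1\<close> turns the fourth power of the conjugate
      into \<open>x ^ 2\<close>, the scalar in the SU(3) factor of
      \<open>root_elem x\<close>.\<close>
    also have "cnj x ^ 4 = cnj x ^ 4 * x ^ 6" by (simp add: x6)
    also have "\<dots> = x ^ 2 * (x * cnj x) ^ 4" by (simp add: eval_nat_numeral mult_ac)
    finally show ?thesis by (simp add: zz xx)
  qed
  then have sec: "section_of r (sm_rep k) = (x * z, \<chi> j l. x ^ 2 * A $ j $ l, \<chi> s t. x ^ 3 * B $ s $ t)"
    unfolding section_of_def y_def[symmetric] lep quark by (simp add: y)
  also have "\<dots> = root_elem x \<otimes>\<^bsub>SM_cover\<^esub> k"
    unfolding root_elem_def zAB SM_cover_simps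
    by (simp add: matrix_matrix_mult_def mat_def vec_eq_iff if_distrib if_distribR sum.delta cong: if_cong)
  finally have sec: "section_of r (sm_rep k) = root_elem x \<otimes>\<^bsub>SM_cover\<^esub> k" .
  show "section_of r (sm_rep k) \<in> carrier SM_cover"
    unfolding sec using monoid.m_closed[OF group.is_monoid[OF group_SM_cover] root_elem_carrier[OF x6] k] .
  show "sm_rep (section_of r (sm_rep k)) = sm_rep k"
    unfolding sec by (simp add: sm_rep_mult sm_rep_root_elem[OF x6])
qed

lemma smooth_sixth_root:
  fixes d :: complex
  assumes "d \<noteq> 0"
  obtains S and r :: "complex \<Rightarrow> complex" where "open S" "d \<in> S" "smooth_on S r" "\<And>\<zeta>. \<zeta> \<in> S \<Longrightarrow> r \<zeta> ^ 6 = \<zeta>"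
proof -
  \<comment> \<open>Dividing by d moves the base point to 1, away from the branch cut of the
    logarithm, whatever the phase of d.\<close>
  define S where "S = (\<lambda>\<zeta>. \<zeta> / d) -` (- \<real>\<^sub>\<le>\<^sub>0)"
  define r where "r \<zeta> = exp (Ln (\<zeta> / d) / 6) * exp (Ln d / 6)" for \<zeta>
  have S: "open S"
    unfolding S_def using closed_nonpos_Reals_complex by (intro open_vimage continuous_intros) (auto simp: assms)
  moreover have "d \<in> S" using assms by (simp add: S_def)
  moreover have "smooth_on S r"
    unfolding r_def by (intro smooth_on_holomorphic S holomorphic_intros) (auto simp: S_def assms)
  moreover have "r \<zeta> ^ 6 = \<zeta>" if "\<zeta> \<in> S" for \<zeta>
  proof -
    have "\<zeta> \<noteq> 0" using that by (auto simp: S_def)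
    have "r \<zeta> ^ 6 = exp (Ln (\<zeta> / d)) * exp (Ln d)"
      by (simp add: r_def power_mult_distrib exp_of_nat_mult[symmetric])
    then show ?thesis using \<open>\<zeta> \<noteq> 0\<close> assms by simp
  qed
  ultimately show thesis by (rule that)
qed

lemma sm_rep_local_section:
  assumes g: "g \<in> Spin9_commutant J0"
  obtains W \<sigma> where "open W" "g \<in> W" "smooth_on W \<sigma>"
    "\<And>y. y \<in> Spin9_commutant J0 \<Longrightarrow> y \<in> W \<Longrightarrow> \<sigma> y \<in> carrier SM_cover \<and> sm_rep (\<sigma> y) = y"
proof -
  obtain k where k: "k \<in> carrier SM_cover" "sm_rep k = g" using sm_rep_surj[OF g] by blast
  obtain z A B where zAB: "k = (z, A, B)" by (metis prod_cases3)
  then have "lep_det g = z ^ 6" "cmod z = 1"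
    using lep_det_sm_rep k unfolding zAB SM_cover_simps by blast+
  then have "lep_det g \<noteq> 0" by auto
  then obtain S r where S: "open S" "lep_det g \<in> S" "smooth_on S r" "\<And>\<zeta>. \<zeta> \<in> S \<Longrightarrow> r \<zeta> ^ 6 = \<zeta>"
    using smooth_sixth_root by blast
  define W where "W = lep_det -` S"
  obtain n l and e :: "nat \<Rightarrow> complex" where fr: "finite_frame n l e" by (rule finite_frame_euclidean)
  have sr: "smooth_on W (\<lambda>y. r (lep_det y))"
    by (rule smooth_on_compose[OF fr S(3) smooth_lep_det]) (auto simp: W_def)
  show thesis
  proof (rule that)
    show "open W" unfolding W_def
      using S(1) smooth_on_imp_continuous_on[OF smooth_lep_det] by (rule open_vimage)
    show "g \<in> W" using S(2) by (simp add: W_def)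
    show "smooth_on W (section_of (\<lambda>y. r (lep_det y)))" by (rule smooth_section_of[OF sr])
    fix y assume "y \<in> Spin9_commutant J0" "y \<in> W"
    obtain l where l: "l \<in> carrier SM_cover" "sm_rep l = y"
      using sm_rep_surj[OF \<open>y \<in> Spin9_commutant J0\<close>] by blast
    have "r (lep_det (sm_rep l)) ^ 6 = lep_det (sm_rep l)"
      using S(4) \<open>y \<in> W\<close> l(2) by (simp add: W_def)
    from section_of_sm_rep[where r = "\<lambda>y. r (lep_det y)", OF l(1) this]
    show "section_of (\<lambda>y. r (lep_det y)) y \<in> carrier SM_cover \<and> sm_rep (section_of (\<lambda>y. r (lep_det y)) y) = y"
      by (simp add: l(2))
  qed
qed

theorem theorem1:
  fixes i :: octo
  assumes "ocnj i = - i" and "(norm i)\<^sup>2 = 1"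
  shows "subgroup (Spin9_commutant (J_R i)) Spin9 \<and>
         lie_isomorphic
           (embedded_lie_group (Spin9\<lparr>carrier := Spin9_commutant (J_R i)\<rparr>))
           G_SM"
proof
  show sub: "subgroup (Spin9_commutant (J_R i)) Spin9" by (rule subgroup_Spin9_commutant)
  let ?G = "Spin9\<lparr>carrier := Spin9_commutant (J_R i)\<rparr>"
  have "norm i = 1" using assms(2) norm_ge_zero[of i] by (auto simp: power2_eq_1_iff)
  then obtain f where f: "octo_aut f" and fi: "f (octo_of \<i> 0) = i"
    using octo_aut_transitive assms(1) by blast
  obtain f' where f': "octo_aut f'" "\<And>x. f (f' x) = x" "\<And>x. f' (f x) = x"
    using octo_aut_inverse[OF f] by blast
  let ?F = "aut_op f" and ?F' = "aut_op f'"
  have FF: "?F o\<^sub>L ?F' = id_blinfun" "?F o\<^sub>L (?F' o\<^sub>L g) = g" "?F' o\<^sub>L ?F = id_blinfun" "?F' o\<^sub>L (?F o\<^sub>L g) = g" for g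
    using aut_op_inverse f f' by blast+
  have f'i: "f' i = octo_of \<i> 0" using f'(3)[of "octo_of \<i> 0"] fi by simp
  have fwd: "?F o\<^sub>L (g o\<^sub>L ?F') \<in> Spin9_commutant (J_R i)" if "g \<in> Spin9_commutant J0" for g
    using aut_op_commutant[OF f f' that] fi by simp
  have bwd: "?F' o\<^sub>L (g o\<^sub>L ?F) \<in> Spin9_commutant J0" if "g \<in> Spin9_commutant (J_R i)" for g
    using aut_op_commutant[OF f'(1) f f'(3,2) that] f'i by simp
  \<comment> \<open>The covering for the standard unit, transported to i by conjugation with the
    automorphism that takes \<open>octo_of \<i> 0\<close> to i.\<close>
  define \<psi> where "\<psi> k = ?F o\<^sub>L (sm_rep k o\<^sub>L ?F')" for k
  obtain nK lK and eK :: "nat \<Rightarrow> sm_ambient" where frK: "finite_frame nK lK eK"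
    by (rule finite_frame_euclidean)
  obtain nG lG and eG :: "nat \<Rightarrow> operator" where frG: "finite_frame nG lG eG"
    by (rule finite_frame_blinfun)
  have "lie_isomorphic (embedded_lie_group ?G) (quotient_lie_group (embedded_lie_group SM_cover) Z6)"
  proof (rule lie_isomorphic_quotient[OF group_SM_cover _ _ _ _ _ frK frG])
    show "group ?G" by (rule subgroup.subgroup_is_group[OF sub group_Spin9])
    show "\<psi> \<in> hom SM_cover ?G"
    proof (rule homI)
      show "\<psi> k \<in> carrier ?G" if "k \<in> carrier SM_cover" for k
        using fwd[OF sm_rep_in_commutant[OF that]] by (simp add: \<psi>_def)
      show "\<psi> (k \<otimes>\<^bsub>SM_cover\<^esub> l) = \<psi> k \<otimes>\<^bsub>?G\<^esub> \<psi> l" for k l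
        by (simp add: \<psi>_def sm_rep_mult blinfun_compose_assoc FF)
    qed
    show "\<psi> ` carrier SM_cover = carrier ?G"
    proof
      show "\<psi> ` carrier SM_cover \<subseteq> carrier ?G"
        using fwd[OF sm_rep_in_commutant] by (auto simp: \<psi>_def simp del: carrier_DirProd)
      show "carrier ?G \<subseteq> \<psi> ` carrier SM_cover"
      proof
        fix g assume "g \<in> carrier ?G"
        then have "?F' o\<^sub>L (g o\<^sub>L ?F) \<in> Spin9_commutant J0" using bwd by simp
        then obtain k where k: "k \<in> carrier SM_cover" "sm_rep k = ?F' o\<^sub>L (g o\<^sub>L ?F)" by (rule sm_rep_surj)
        then have "\<psi> k = g" by (simp add: \<psi>_def blinfun_compose_assoc FF)
        then show "g \<in> \<psi> ` carrier SM_cover" using k(1) by blast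
      qed
    qed
    have "\<psi> k = id_blinfun \<longleftrightarrow> sm_rep k = id_blinfun" for k
    proof
      assume "\<psi> k = id_blinfun"
      \<comment> \<open>Undoing the conjugation shows that \<open>\<psi>\<close> and
        \<open>sm_rep\<close> have the same kernel.\<close>
      then have "?F' o\<^sub>L (\<psi> k o\<^sub>L ?F) = id_blinfun" by (simp add: FF)
      then show "sm_rep k = id_blinfun" by (simp add: \<psi>_def blinfun_compose_assoc FF)
    qed (simp add: \<psi>_def FF)
    then have "kernel SM_cover ?G \<psi> = {k \<in> carrier SM_cover. sm_rep k = id_blinfun}"
      unfolding kernel_def by simp
    also have "\<dots> = Z6"
      unfolding Z6_eq using sm_rep_kernel sm_rep_root_elem root_elem_carrier by blast
    finally show "kernel SM_cover ?G \<psi> = Z6" .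
    have "smooth_on UNIV (\<lambda>k. ?F o\<^sub>L (sm_rep k o\<^sub>L ?F'))"
      by (intro smooth_on_compose_bounded_linear[OF comp.bounded_linear_right]
          smooth_on_compose_bounded_linear[OF comp.bounded_linear_left] smooth_sm_rep)
    then show "smooth_on UNIV \<psi>" by (simp add: \<psi>_def[abs_def])
    fix g assume "g \<in> carrier ?G"
    then have g: "?F' o\<^sub>L (g o\<^sub>L ?F) \<in> Spin9_commutant J0" using bwd by simp
    obtain W \<sigma> where W: "open W" "?F' o\<^sub>L (g o\<^sub>L ?F) \<in> W" "smooth_on W \<sigma>"
      "\<And>y. y \<in> Spin9_commutant J0 \<Longrightarrow> y \<in> W \<Longrightarrow> \<sigma> y \<in> carrier SM_cover \<and> sm_rep (\<sigma> y) = y"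
      using sm_rep_local_section[OF g] by blast
    \<comment> \<open>Conjugation back to the standard unit is linear, so composing it with a local
      section for \<open>J0\<close> gives a smooth local section near g.\<close>
    let ?c = "\<lambda>y. ?F' o\<^sub>L (y o\<^sub>L ?F)"
    have c: "smooth_on V ?c" for V
      by (intro smooth_on_compose_bounded_linear[OF comp.bounded_linear_right]
          smooth_on_bounded_linear[OF comp.bounded_linear_left])
    show "\<exists>W \<sigma>. open W \<and> g \<in> W \<and> smooth_on W \<sigma> \<and>
        (\<forall>y \<in> carrier ?G \<inter> W. \<sigma> y \<in> carrier SM_cover \<and> \<psi> (\<sigma> y) = y)"
    proof (intro exI conjI)
      show "open (?c -` W)"
        using W(1) smooth_on_imp_continuous_on[OF c] by (rule open_vimage)
      show "g \<in> ?c -` W" using W(2) by simp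
      show "smooth_on (?c -` W) (\<lambda>y. \<sigma> (?c y))"
        by (rule smooth_on_compose[OF frG W(3) c]) auto
      show "\<forall>y \<in> carrier ?G \<inter> ?c -` W. \<sigma> (?c y) \<in> carrier SM_cover \<and> \<psi> (\<sigma> (?c y)) = y"
      proof
        fix y assume "y \<in> carrier ?G \<inter> ?c -` W"
        then have y: "\<sigma> (?c y) \<in> carrier SM_cover" "sm_rep (\<sigma> (?c y)) = ?c y"
          using W(4)[OF bwd] by auto
        then show "\<sigma> (?c y) \<in> carrier SM_cover \<and> \<psi> (\<sigma> (?c y)) = y"
          by (simp add: \<psi>_def blinfun_compose_assoc FF del: carrier_DirProd)
      qed
    qed
  qed
  then show "lie_isomorphic (embedded_lie_group ?G) G_SM"
    by (simp add: G_SM_def U1_SU3_SU2_def)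
qed

end
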